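(* For any $n\in\mathbb{Z}$ one has $$\mathrm{ch}\,W_n(x,q^2)=E_n^{A_2^{(2)\dagger}}(x,q,0),\qquad \mathrm{ch}\,W_n^\sigma(x,q)=E_n^{A_2^{(2)}}(x,q,0),$$ where $W_n$, $W_n^\sigma$ are the untwisted and twisted Weyl modules attached to $\mathfrak{osp}(1,2)$ and $E_n^{A_2^{(2)\dagger}}$, $E_n^{A_2^{(2)}}$ are the nonsymmetric Macdonald polynomials of types $A_2^{(2)\dagger}$ and $A_2^{(2)}$.
   Context: Everything is over $\mathbb{C}$. $\mathfrak{osp}(1,2)$ is the Lie superalgebra with even part $\mathfrak{sl}_2$ (standard basis $e,h,f$) and odd part $\pi_1$ with basis $g^+,g^-$; the nontrivial brackets are $[e,f]=h$, $[h,e]=2e$, $[h,f]=-2f$, $[h,g^\pm]=\pm g^\pm$, $[g^+,g^-]_+=h$, $[g^+,g^+]_+=2e$, $[g^-,g^-]_+=-2f$, $[f,g^+]=-g^-$, $[e,g^-]=-g^+$. Put $\mathfrak n^-=\mathrm{span}(f,g^-)$, $\mathfrak n^+=\mathrm{span}(e,g^+)$, $\mathfrak h=\mathbb{C}h$, and $y_i=y\otimes t^i$. Untwisted: for $n\ge 0$, $W_{-n}$ is the cyclic $\mathfrak{osp}(1,2)\otimes\mathbb{C}[t]$-module with generator $w_{-n}$ and defining relations $(\mathfrak n^-\oplus\mathfrak h)\otimes t\mathbb{C}[t].w_{-n}=0$, $(\mathfrak n^-\otimes 1).w_{-n}=0$, $h_0w_{-n}=-nw_{-n}$, $e_0^{n+1}w_{-n}=0$.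 For $n>0$, $w_n=e_0^nw_{-n}\in W_{-n}$ and $W_n=U(\mathfrak n^-\otimes t\mathbb{C}[t]).w_n\subset W_{-n}$. Twisted: $\mathfrak{osp}(1,2)[t]^\sigma=\bigoplus_{i\ge0}\mathfrak{sl}_2\otimes t^{2i}\oplus\bigoplus_{i\ge0}\pi_1\otimes t^{2i+1}$. For $n\ge0$, $W^\sigma_{-n}$ is the cyclic ($\mathfrak{sl}_2$-integrable) $\mathfrak{osp}(1,2)[t]^\sigma$-module with generator $w_{-n}^\sigma$ and defining relations $f_{2i}w^\sigma_{-n}=0$, $g^-_{2i+1}w^\sigma_{-n}=0$, $h_{2i+2}w^\sigma_{-n}=0$ ($i\ge0$), $h_0w^\sigma_{-n}=-nw^\sigma_{-n}$, $e_0^{n+1}w^\sigma_{-n}=0$. For $n>0$, $w_n^\sigma=e_0^nw^\sigma_{-n}$ and $W_n^\sigma=U\big((\mathfrak{osp}(1,2)\otimes t\mathbb{C}[t])^\sigma\big).w_n^\sigma\subset W^\sigma_{-n}$, where $(\mathfrak{osp}(1,2)\otimes t\mathbb{C}[t])^\sigma=\mathfrak{sl}_2\otimes t^2\mathbb{C}[t^2]\oplus\pi_1\otimes t\mathbb{C}[t^2]$. All modules are graded by $t$-degree with the cyclic vector $w_{-n}$ (resp. $w^\sigma_{-n}$) in degree $0$; $\mathrm{ch}\,M(x,q)=\sum_s q^s\,\mathrm{tr}(x^h|_{M_s})$. Macdonald polynomials (rank one specializations of nonsymmetric Koornwinder polynomials), given explicitly by the Ram–Yip alcove walk formula, which may be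 taken as the definition. Alcoves are the intervals $(i,i+1)$, $i\in\mathbb{Z}$; the wall $i$ is labelled $s_1$ if $i$ is even, $s_0$ if $i$ is odd. For an alcove $a$, $2\,\mathrm{wt}(a)$ is its even endpoint, and $d(a)=0$ (resp. $1$) if the even endpoint is the left (resp. right) one. For $n\le 0$ let $l=-2n$ and let the type be $(s_1,s_0,\dots,s_1,s_0)$ ($l$ entries); for $n>0$ let $l=2n-1$ and the type be $(s_0,s_1,\dots,s_1,s_0)$ ($l$ entries). A walk is a binary word $b\in\{0,1\}^l$: start in the alcove $(0,1)$; at step $i$ look at the wall of the current alcove labelled by the $i$-th entry of the type; if $b_i=1$ cross it into the adjacent alcove, if $b_i=0$ stay (a folding). A folding is positive if that wall is the left endpoint of the current alcove and negative if it is the right endpoint. $J$ is the set of folding steps; $J_0=J_{0+}\sqcup J_{0-}$ are the (positive, negative) foldings at steps with label $s_0$, and $J_+,J_-$ the positive, negative foldings at steps with label $s_1$; $p_J$ is the final alcove. Let $v=t^{1/2}$, $\xi_j=q^{\,l+1-j}v^2$, $\varepsilon(n)=-1$ if $n>0$ and $\varepsilon(n)=0$ if $n\le0$. Then $$E_n^{A_2^{(2)}}(x,q,t)=\sum_{b}v^{\varepsilon(n)+d(p_J)-|J|}(1-v^2)^{|J|}\prod_{j\in J_0}\frac{\xi_j}{1-\xi_j^2}\prod_{j\in J_+}\frac1{1-\xi_j}\prod_{j\in J_-}\frac{\xi_j}{1-\xi_j}\;x^{\mathrm{wt}(p_J)},$$ $$E_n^{A_2^{(2)\dagger}}(x,q,t)=\sum_{b}v^{\varepsilon(n)+d(p_J)-|J|}(1-v^2)^{|J|}\prod_{j\in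 J_{0+}}\frac1{1-\xi_j^2}\prod_{j\in J_{0-}}\frac{\xi_j^2}{1-\xi_j^2}\prod_{j\in J_+}\frac1{1-\xi_j}\prod_{j\in J_-}\frac{\xi_j}{1-\xi_j}\;x^{\mathrm{wt}(p_J)}.$$ $E_n(x,q,0)$ denotes the value (limit) at $t\to0$. *)

theory Defs
  imports Complex_Main "HOL-Library.Poly_Mapping"
begin

section \<open>Free associative algebras over the complex numbers\<close>

text \<open>The monoid algebra of the free monoid on \<open>'a\<close> is the free unital associative algebra
  on \<open>'a\<close>; its ring structure is that of \<^theory>\<open>HOL-Library.Poly_Mapping\<close>, which needs the
  monoid to be written additively.\<close>

datatype 'a free_monoid = Word (letters: "'a list")

instantiation free_monoid :: (type) monoid_add
begin

definition zero_free_monoid :: "'a free_monoid" where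
  "zero_free_monoid = Word []"

definition plus_free_monoid :: "'a free_monoid \<Rightarrow> 'a free_monoid \<Rightarrow> 'a free_monoid" where
  "plus_free_monoid u v = Word (letters u @ letters v)"

instance
  by standard (simp_all add: zero_free_monoid_def plus_free_monoid_def)

end

type_synonym 'a free_algebra = "'a free_monoid \<Rightarrow>\<^sub>0 complex"

definition fa_scale :: "complex \<Rightarrow> 'a free_algebra \<Rightarrow> 'a free_algebra" where
  "fa_scale c p = Poly_Mapping.single 0 c * p"

interpretation fa: vector_space "fa_scale :: complex \<Rightarrow> 'a free_algebra \<Rightarrow> 'a free_algebra"
proof
  show "fa_scale a (fa_scale b x) = fa_scale (a * b) x" for a b and x :: "'a free_algebra"
    by (simp add: fa_scale_def mult.assoc [symmetric] mult_single)
qed (simp_all add: fa_scale_def distrib_left distrib_right single_add)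

definition monomials :: "'a set \<Rightarrow> 'a free_algebra set" where
  "monomials L = {Poly_Mapping.single (Word u) 1 | u. set u \<subseteq> L}"


section \<open>The Lie superalgebra osp(1,2) and its current algebra\<close>

datatype osp = osp_e | osp_f | osp_h | osp_gp | osp_gm

fun osp_parity :: "osp \<Rightarrow> nat" where
  "osp_parity osp_gp = 1"
| "osp_parity osp_gm = 1"
| "osp_parity _ = 0"

fun osp_bracket :: "osp \<Rightarrow> osp \<Rightarrow> (osp \<Rightarrow>\<^sub>0 complex)" where
  "osp_bracket osp_e osp_f = Poly_Mapping.single osp_h 1"
| "osp_bracket osp_f osp_e = Poly_Mapping.single osp_h (- 1)"
| "osp_bracket osp_h osp_e = Poly_Mapping.single osp_e 2"
| "osp_bracket osp_e osp_h = Poly_Mapping.single osp_e (- 2)"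
| "osp_bracket osp_h osp_f = Poly_Mapping.single osp_f (- 2)"
| "osp_bracket osp_f osp_h = Poly_Mapping.single osp_f 2"
| "osp_bracket osp_h osp_gp = Poly_Mapping.single osp_gp 1"
| "osp_bracket osp_gp osp_h = Poly_Mapping.single osp_gp (- 1)"
| "osp_bracket osp_h osp_gm = Poly_Mapping.single osp_gm (- 1)"
| "osp_bracket osp_gm osp_h = Poly_Mapping.single osp_gm 1"
| "osp_bracket osp_gp osp_gm = Poly_Mapping.single osp_h 1"
| "osp_bracket osp_gm osp_gp = Poly_Mapping.single osp_h 1"
| "osp_bracket osp_gp osp_gp = Poly_Mapping.single osp_e 2"
| "osp_bracket osp_gm osp_gm = Poly_Mapping.single osp_f (- 2)"
| "osp_bracket osp_f osp_gp = Poly_Mapping.single osp_gm (- 1)"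
| "osp_bracket osp_gp osp_f = Poly_Mapping.single osp_gm 1"
| "osp_bracket osp_e osp_gm = Poly_Mapping.single osp_gp (- 1)"
| "osp_bracket osp_gm osp_e = Poly_Mapping.single osp_gp 1"
| "osp_bracket _ _ = 0"

text \<open>The letter \<open>(y, i)\<close> stands for the element \<open>y \<otimes> t\<^sup>i\<close>.\<close>

type_synonym current_letter = "osp \<times> nat"

abbreviation gen :: "osp \<Rightarrow> nat \<Rightarrow> current_letter free_algebra" where
  "gen y i \<equiv> Poly_Mapping.single (Word [(y, i)]) 1"

definition lie_relator :: "current_letter \<Rightarrow> current_letter \<Rightarrow> current_letter free_algebra" where
  "lie_relator = (\<lambda>(a, i) (b, j).
     gen a i * gen b j - (- 1) ^ (osp_parity a * osp_parity b) * (gen b j * gen a i)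
     - (\<Sum>c\<in>Poly_Mapping.keys (osp_bracket a b).
          fa_scale (Poly_Mapping.lookup (osp_bracket a b) c) (gen c (i + j))))"

definition twisted_letters :: "current_letter set" where
  "twisted_letters = {(a, i). even i \<longleftrightarrow> osp_parity a = 0}"

text \<open>Let \<open>L\<close> be a set of letters whose linear span is a Lie subsuperalgebra. Modulo the two-sided
  ideal generated by the \<open>lie_relator x y\<close> with \<open>x, y \<in> L\<close>, the free algebra on \<open>L\<close> is the
  universal enveloping algebra \<open>U\<close> of that subsuperalgebra. The next set is the preimage in the
  free algebra of the left ideal \<open>U \<cdot> R\<close>, so that \<open>fa.span (monomials L)\<close> modulo
  \<open>relation_ideal L R\<close> is the cyclic module with generator (the class of) \<open>1\<close> and defining
  relations \<open>r \<cdot> 1 = 0\<close> for \<open>r \<in> R\<close>.\<close>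

definition relation_ideal ::
    "current_letter set \<Rightarrow> current_letter free_algebra set \<Rightarrow> current_letter free_algebra set" where
  "relation_ideal L R = fa.span
     ({u * lie_relator x y * v | u x y v. u \<in> monomials L \<and> v \<in> monomials L \<and> x \<in> L \<and> y \<in> L}
      \<union> {u * r | u r. u \<in> monomials L \<and> r \<in> R})"


section \<open>Weyl modules\<close>

text \<open>A pair \<open>(V, N)\<close> of subspaces of the free algebra represents the vector space \<open>(V + N) / N\<close>.\<close>

type_synonym subquotient = "current_letter free_algebra set \<times> current_letter free_algebra set"

definition weyl_relations :: "nat \<Rightarrow> current_letter free_algebra set" where
  "weyl_relations k =
     {gen y i | y i. y \<in> {osp_f, osp_gm, osp_h} \<and> i \<ge> 1}
     \<union> {gen osp_f 0, gen osp_gm 0, gen osp_h 0 + of_nat k, gen osp_e 0 ^ (k + 1)}"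

definition weyl :: "int \<Rightarrow> subquotient" where
  "weyl n =
     (if n \<le> 0
      then (fa.span (monomials UNIV), relation_ideal UNIV (weyl_relations (nat (- n))))
      else ({u * gen osp_e 0 ^ nat n | u.
               u \<in> fa.span (monomials {(y, i). y \<in> {osp_f, osp_gm} \<and> i \<ge> 1})},
            relation_ideal UNIV (weyl_relations (nat n))))"

definition twisted_weyl_relations :: "nat \<Rightarrow> current_letter free_algebra set" where
  "twisted_weyl_relations k =
     (\<Union>i. {gen osp_f (2 * i), gen osp_gm (2 * i + 1), gen osp_h (2 * i + 2)})
     \<union> {gen osp_h 0 + of_nat k, gen osp_e 0 ^ (k + 1)}"

definition twisted_weyl :: "int \<Rightarrow> subquotient" where
  "twisted_weyl n =
     (if n \<le> 0
      then (fa.span (monomials twisted_letters),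
            relation_ideal twisted_letters (twisted_weyl_relations (nat (- n))))
      else ({u * gen osp_e 0 ^ nat n | u.
               u \<in> fa.span (monomials {(y, i). (y, i) \<in> twisted_letters \<and> i \<ge> 1})},
            relation_ideal twisted_letters (twisted_weyl_relations (nat n))))"


section \<open>Graded characters\<close>

definition t_homogeneous :: "nat \<Rightarrow> current_letter free_algebra set" where
  "t_homogeneous s =
     {p. \<forall>u\<in>Poly_Mapping.keys p. sum_list (map snd (letters u)) = s}"

text \<open>The preimage of the space of vectors of \<open>t\<close>-degree \<open>s\<close> and \<open>h\<^sub>0\<close>-eigenvalue \<open>m\<close>
  in \<open>(V + N) / N\<close>.\<close>

definition weight_space :: "subquotient \<Rightarrow> nat \<Rightarrow> int \<Rightarrow> current_letter free_algebra set" where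
  "weight_space = (\<lambda>(V, N) s m.
     {p \<in> fa.span (V \<union> N).
        (\<exists>p'\<in>t_homogeneous s. p - p' \<in> N) \<and> gen osp_h 0 * p - fa_scale (of_int m) p \<in> N})"

text \<open>\<open>dim (A / N)\<close> for \<open>N \<subseteq> A\<close>, as the least size of a generating set modulo \<open>N\<close>;
  meaningful only if \<open>A / N\<close> is finite-dimensional.\<close>

definition quotient_dim ::
    "current_letter free_algebra set \<Rightarrow> current_letter free_algebra set \<Rightarrow> nat" where
  "quotient_dim A N = (LEAST k. \<exists>B. B \<subseteq> A \<and> finite B \<and> card B = k \<and> A \<subseteq> fa.span (B \<union> N))"

definition weight_mult :: "subquotient \<Rightarrow> nat \<Rightarrow> int \<Rightarrow> nat" where
  "weight_mult M s m = quotient_dim (weight_space M s m) (snd M)"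

text \<open>Finite-dimensional, and the sum of its homogeneous \<open>h\<^sub>0\<close>-eigenspaces with integer
  eigenvalues: exactly what is needed for \<open>tr (x\<^sup>h | M\<^sub>s)\<close> to be defined for all \<open>s\<close>.\<close>

definition finite_weight_module :: "subquotient \<Rightarrow> bool" where
  "finite_weight_module = (\<lambda>(V, N).
     (\<exists>B. finite B \<and> V \<subseteq> fa.span (B \<union> N)) \<and>
     V \<subseteq> fa.span (\<Union>s m. weight_space (V, N) s m))"

text \<open>\<open>x\<^sup>h\<close> acts by \<open>x\<^sup>m\<close> on \<open>h\<^sub>0\<close>-eigenvectors with eigenvalue \<open>m\<close>, so
  \<open>tr (x\<^sup>h | M\<^sub>s)\<close> is the sum of \<open>x\<^sup>m\<close> times the dimension of the \<open>m\<close>-eigenspace of \<open>M\<^sub>s\<close>.\<close>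

definition graded_char :: "subquotient \<Rightarrow> complex \<Rightarrow> complex \<Rightarrow> complex" where
  "graded_char M x q =
     (\<Sum>(s, m)\<in>{(s, m). weight_mult M s m \<noteq> 0}.
        q ^ s * (of_nat (weight_mult M s m) * x powi m))"


section \<open>Nonsymmetric Macdonald polynomials by the Ram--Yip formula\<close>

text \<open>The integer \<open>a\<close> encodes the alcove \<open>(a, a + 1)\<close>; the labels \<open>s\<^sub>0\<close>, \<open>s\<^sub>1\<close> are encoded
  as \<open>0\<close>, \<open>1\<close>; steps are numbered from \<open>1\<close>, so that step \<open>j\<close> uses the entry \<open>b ! (j - 1)\<close>
  of the word \<open>b\<close>.\<close>

definition wall_label :: "int \<Rightarrow> nat" where
  "wall_label i = (if even i then 1 else 0)"

definition alcove_d :: "int \<Rightarrow> int" where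
  "alcove_d a = (if even a then 0 else 1)"

definition alcove_wt :: "int \<Rightarrow> int" where
  "alcove_wt a = (if even a then a else a + 1) div 2"

definition walk_length :: "int \<Rightarrow> nat" where
  "walk_length n = nat (if n \<le> 0 then - 2 * n else 2 * n - 1)"

definition step_label :: "int \<Rightarrow> nat \<Rightarrow> nat" where
  "step_label n j = (if n \<le> 0 then (if odd j then 1 else 0) else (if odd j then 0 else 1))"

text \<open>The alcove reached after \<open>j\<close> steps.\<close>

fun walk :: "int \<Rightarrow> bool list \<Rightarrow> nat \<Rightarrow> int" where
  "walk n b 0 = 0"
| "walk n b (Suc j) =
     (let a = walk n b j
      in if \<not> b ! j then a
         else if wall_label a = step_label n (Suc j) then a - 1 else a + 1)"

definition foldings :: "int \<Rightarrow> bool list \<Rightarrow> nat set" where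
  "foldings n b = {j \<in> {1..walk_length n}. \<not> b ! (j - 1)}"

definition positive_step :: "int \<Rightarrow> bool list \<Rightarrow> nat \<Rightarrow> bool" where
  "positive_step n b j \<longleftrightarrow> wall_label (walk n b (j - 1)) = step_label n j"

definition J0pos :: "int \<Rightarrow> bool list \<Rightarrow> nat set" where
  "J0pos n b = {j \<in> foldings n b. step_label n j = 0 \<and> positive_step n b j}"

definition J0neg :: "int \<Rightarrow> bool list \<Rightarrow> nat set" where
  "J0neg n b = {j \<in> foldings n b. step_label n j = 0 \<and> \<not> positive_step n b j}"

definition J1pos :: "int \<Rightarrow> bool list \<Rightarrow> nat set" where
  "J1pos n b = {j \<in> foldings n b. step_label n j = 1 \<and> positive_step n b j}"

definition J1neg :: "int \<Rightarrow> bool list \<Rightarrow> nat set" where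
  "J1neg n b = {j \<in> foldings n b. step_label n j = 1 \<and> \<not> positive_step n b j}"

definition macdonald_eps :: "int \<Rightarrow> int" where
  "macdonald_eps n = (if n > 0 then - 1 else 0)"

definition xi :: "int \<Rightarrow> complex \<Rightarrow> complex \<Rightarrow> nat \<Rightarrow> complex" where
  "xi n q v j = q ^ (walk_length n + 1 - j) * v ^ 2"

text \<open>In both formulas only even powers of \<open>v = t\<^sup>1\<^sup>/\<^sup>2\<close> occur, because the exponent
  of \<open>v\<close> in front is even for every walk; the choice of the square root is therefore irrelevant.\<close>

definition macdonald_A22 :: "int \<Rightarrow> complex \<Rightarrow> complex \<Rightarrow> complex \<Rightarrow> complex" where
  "macdonald_A22 n x q t =
     (let v = csqrt t; l = walk_length n in
      \<Sum>b\<in>{b :: bool list. length b = l}.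
        v powi (macdonald_eps n + alcove_d (walk n b l) - int (card (foldings n b)))
        * (1 - v ^ 2) ^ card (foldings n b)
        * (\<Prod>j\<in>J0pos n b \<union> J0neg n b. xi n q v j / (1 - xi n q v j ^ 2))
        * (\<Prod>j\<in>J1pos n b. 1 / (1 - xi n q v j))
        * (\<Prod>j\<in>J1neg n b. xi n q v j / (1 - xi n q v j))
        * x powi alcove_wt (walk n b l))"

definition macdonald_A22_dagger :: "int \<Rightarrow> complex \<Rightarrow> complex \<Rightarrow> complex \<Rightarrow> complex" where
  "macdonald_A22_dagger n x q t =
     (let v = csqrt t; l = walk_length n in
      \<Sum>b\<in>{b :: bool list. length b = l}.
        v powi (macdonald_eps n + alcove_d (walk n b l) - int (card (foldings n b)))
        * (1 - v ^ 2) ^ card (foldings n b)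
        * (\<Prod>j\<in>J0pos n b. 1 / (1 - xi n q v j ^ 2))
        * (\<Prod>j\<in>J0neg n b. xi n q v j ^ 2 / (1 - xi n q v j ^ 2))
        * (\<Prod>j\<in>J1pos n b. 1 / (1 - xi n q v j))
        * (\<Prod>j\<in>J1neg n b. xi n q v j / (1 - xi n q v j))
        * x powi alcove_wt (walk n b l))"

end

theory Submission
  imports Defs "HOL-Library.Product_Plus" "HOL-Library.Function_Algebras"
    "HOL-Computational_Algebra.Polynomial"
begin

text \<open>The Iwahori subalgebras of the untwisted and of the twisted current algebra are isomorphic,
  with the roles of the two simple root vectors \<open>E\<^sub>0\<close> (even) and \<open>B\<^sub>0\<close> (odd) exchanged. Over this
  algebra, let a cyclic vector \<open>w\<close> be killed by the opposite letters and by \<open>E\<^sub>0\<^sup>m\<^sup>+\<^sup>1\<close>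
  (respectively \<open>B\<^sub>0\<^sup>k\<^sup>+\<^sup>1\<close>). Then \<open>E\<^sub>0\<^sup>m w\<close> (respectively \<open>B\<^sub>0\<^sup>k w\<close>) generates a submodule of the
  other kind, and the quotient by it is of the same kind with the exponent lowered by one. The
  resulting upper bounds for the characters satisfy the recursion that the alcove walks satisfy at
  \<open>t = 0\<close>.

  Conversely, the Weyl module with lowest weight \<open>-k\<close> degenerates a tensor product of \<open>k\<close>
  three-dimensional evaluation modules at distinct points, so its dimension is at least \<open>3\<^sup>k\<close>. This is
  the sum of the upper bounds for the submodule generated by \<open>e\<^sub>0\<^sup>k w\<close> and for the quotient by it, so
  all the bounds are attained.\<close>

section \<open>Upper bounds by induction over an Iwahori subalgebra\<close>

text \<open>One scheme covers both families because, over the Iwahori subalgebra, the vacuum is a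
  highest weight vector in the untwisted case and a lowest weight vector in the twisted case:
  \<open>E 0\<close>, \<open>B 0\<close> are f t, g^+ in the former and e, g^- t in the latter. The
  relation on e_0 bounds the power of one simple root vector. The exponents for the other are forced
  by weights, which produces the recursion of \<open>PG\<close> and \<open>QG\<close>. For k > 0,
  W_k is what the first step of this recursion splits off W_{-k}.

  The lower bound cannot come from a quotient map: on the tensor product h_i with i > 0 acts on the
  lowest vector by -sum z^i, in general not zero, so the relations hold only in leading order. The
  degeneration thus controls just the total dimension. That is enough: the upper bounds are lists of
  words refined by degree and weight, and 3^k words spanning a space of dimension at least 3^k form
  a basis, from which all graded multiplicities are read off.\<close>

locale super_action = vector_space scale
  for scale :: "complex \<Rightarrow> 'v::ab_group_add \<Rightarrow> 'v" (infixr \<open>*s\<close> 75) +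
  fixes L :: "'l set" and act :: "'l \<Rightarrow> 'v \<Rightarrow> 'v"
    and par :: "'l \<Rightarrow> nat" and bc :: "'l \<Rightarrow> 'l \<Rightarrow> complex" and bz :: "'l \<Rightarrow> 'l \<Rightarrow> 'l"
  assumes act_add: "x \<in> L \<Longrightarrow> act x (u + v) = act x u + act x v"
    and act_scale: "x \<in> L \<Longrightarrow> act x (c *s v) = c *s act x v"
    and bz_closed: "x \<in> L \<Longrightarrow> y \<in> L \<Longrightarrow> bc x y \<noteq> 0 \<Longrightarrow> bz x y \<in> L"
    and act_act: "x \<in> L \<Longrightarrow> y \<in> L \<Longrightarrow>
      act x (act y v) = (- 1) ^ (par x * par y) *s act y (act x v) + bc x y *s act (bz x y) v"
begin

definition wact :: "'l list \<Rightarrow> 'v \<Rightarrow> 'v" where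
  "wact u v = foldr act u v"

lemma wact_simps [simp]: "wact [] v = v" "wact (x # u) v = act x (wact u v)"
  "wact (u @ u') v = wact u (wact u' v)"
  by (simp_all add: wact_def)

lemma wact_replicate: "wact (replicate k x) v = (act x ^^ k) v"
  by (induction k) auto

lemma act_zero: "x \<in> L \<Longrightarrow> act x 0 = 0"
  using act_add[of x 0 0] by simp

text \<open>\<open>N\<close> plays the role of zero: statements about quotient modules are made
  modulo \<open>N\<close>, and dividing further means enlarging \<open>N\<close>.\<close>

definition submodule :: "'v set \<Rightarrow> bool" where
  "submodule N \<longleftrightarrow> subspace N \<and> (\<forall>x\<in>L. \<forall>v\<in>N. act x v \<in> N)"

lemma submodule_act: "submodule N \<Longrightarrow> x \<in> L \<Longrightarrow> v \<in> N \<Longrightarrow> act x v \<in> N"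
  by (auto simp: submodule_def)

lemma submodule_funpow: "submodule N \<Longrightarrow> x \<in> L \<Longrightarrow> v \<in> N \<Longrightarrow> (act x ^^ k) v \<in> N"
  by (induction k) (auto intro: submodule_act)

lemma act_span:
  assumes "x \<in> L" "v \<in> span S" "\<And>s. s \<in> S \<Longrightarrow> act x s \<in> span T"
  shows "act x v \<in> span T"
  using assms(2)
proof (induction rule: span_induct_alt)
  case base
  then show ?case by (simp add: act_zero assms(1) span_zero)
next
  case (step c s v)
  then show ?case by (simp add: act_add act_scale assms span_add span_scale)
qed

definition cyclic :: "'v \<Rightarrow> 'v set" where
  "cyclic w = span {wact u w | u. set u \<subseteq> L}"

lemma wact_in_cyclic: "set u \<subseteq> L \<Longrightarrow> wact u w \<in> cyclic w"
  by (auto simp: cyclic_def intro!: span_base)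

lemma submodule_sum_cyclic:
  assumes N: "submodule N"
  shows "submodule (span (N \<union> cyclic w))"
  unfolding submodule_def
proof safe
  fix x v assume x: "x \<in> L" and v: "v \<in> span (N \<union> cyclic w)"
  have *: "act x s \<in> span (N \<union> cyclic w)" if s: "s \<in> N \<union> cyclic w" for s
  proof (cases "s \<in> N")
    case True
    then show ?thesis using N x by (auto intro: span_base submodule_act)
  next
    case False
    with s have "s \<in> span {wact u w | u. set u \<subseteq> L}" by (auto simp: cyclic_def)
    then have "act x s \<in> span {wact u w | u. set u \<subseteq> L}"
    proof (rule act_span[OF x])
      fix s assume "s \<in> {wact u w | u. set u \<subseteq> L}"
      then obtain u where "s = wact u w" "set u \<subseteq> L" by auto
      then have "act x s = wact (x # u) w" "set (x # u) \<subseteq> L" using x by auto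
      then show "act x s \<in> span {wact u w | u. set u \<subseteq> L}"
        by (intro span_base) blast
    qed
    then show ?thesis by (auto simp: cyclic_def intro: span_base)
  qed
  show "act x v \<in> span (N \<union> cyclic w)"
    using x v * by (rule act_span)
qed

text \<open>The spanning half of the Poincare--Birkhoff--Witt theorem: letters outside \<open>Pos\<close> are moved
  to the right until they meet \<open>w\<close>, which is an eigenvector modulo \<open>N\<close>.\<close>

lemma positive_words_span:
  fixes gr :: "'l \<Rightarrow> 'g::comm_monoid_add"
  assumes N: "submodule N" and Pos: "Pos \<subseteq> L"
    and kill: "\<And>x. x \<in> L \<Longrightarrow> x \<notin> Pos \<Longrightarrow> act x w \<in> N \<or> gr x = 0 \<and> (\<exists>c. act x w - c *s w \<in> N)"
    and gr: "\<And>x y. x \<in> L \<Longrightarrow> y \<in> L \<Longrightarrow> bc x y \<noteq> 0 \<Longrightarrow> gr (bz x y) = gr x + gr y"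
    and u: "set u \<subseteq> L"
  shows "wact u w \<in> span ({wact u' w | u'. set u' \<subseteq> Pos \<and>
           sum_list (map gr u') = sum_list (map gr u)} \<union> N)"
proof -
  define S where "S g = span ({wact u' w | u'. set u' \<subseteq> Pos \<and> sum_list (map gr u') = g} \<union> N)" for g
  have NS: "v \<in> S g" if "v \<in> N" for v g
    using that by (auto simp: S_def intro: span_base)
  have wS: "wact u w \<in> S (sum_list (map gr u))" if "set u \<subseteq> Pos" for u
    using that unfolding S_def by (intro span_base) auto
  have PosS: "act x v \<in> S (gr x + g)" if x: "x \<in> Pos" and v: "v \<in> S g" for x v g
    using v unfolding S_def
  proof (rule act_span[rotated])
    show "x \<in> L" using Pos x by auto
    fix s assume "s \<in> {wact u' w |u'. set u' \<subseteq> Pos \<and> sum_list (map gr u') = g} \<union> N"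
    then consider u' where "s = wact u' w" "set u' \<subseteq> Pos" "sum_list (map gr u') = g" | "s \<in> N"
      by auto
    then have "act x s \<in> S (gr x + g)"
    proof cases
      case 1
      then show ?thesis using wS[of "x # u'"] x by simp
    next
      case 2
      then show ?thesis using NS submodule_act[OF N] \<open>x \<in> L\<close> by auto
    qed
    then show "act x s \<in> span ({wact u' w |u'. set u' \<subseteq> Pos \<and> sum_list (map gr u') = gr x + g} \<union> N)"
      by (simp add: S_def)
  qed
  \<comment> \<open>The letter \<open>x\<close> must stay arbitrary in the induction: passing it
    over the first letter of the word leaves either \<open>x\<close> or the bracket letter in front
    of a shorter word.\<close>
  have word: "act x (wact u w) \<in> S (gr x + sum_list (map gr u))" if "x \<in> L" "set u \<subseteq> Pos" for x u
    using that
  proof (induction u arbitrary: x)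
    case Nil
    show ?case
    proof (cases "x \<in> Pos")
      case True
      then show ?thesis using wS[of "[x]"] by simp
    next
      case False
      with kill[OF Nil(1)] consider "act x w \<in> N" | c where "gr x = 0" "act x w - c *s w \<in> N" by blast
      then show ?thesis
      proof cases
        case 1
        then show ?thesis using NS by auto
      next
        case 2
        have "(act x w - c *s w) + c *s w \<in> S 0"
          using NS[OF 2(2), of 0] wS[of "[]"] unfolding S_def
          by (intro span_add span_scale) auto
        then show ?thesis using 2 by simp
      qed
    qed
  next
    case (Cons y u)
    have y: "y \<in> Pos" "y \<in> L" using Cons.prems Pos by auto
    let ?g = "gr x + (gr y + sum_list (map gr u))"
    have "act y (act x (wact u w)) \<in> S ?g"
      using PosS[OF y(1) Cons.IH[OF Cons.prems(1)]] Cons.prems by (simp add: add.left_commute)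
    moreover have "bc x y *s act (bz x y) (wact u w) \<in> S ?g"
    proof (cases "bc x y = 0")
      case True
      then show ?thesis by (simp add: S_def span_zero)
    next
      case False
      then have "act (bz x y) (wact u w) \<in> S (gr (bz x y) + sum_list (map gr u))"
        using Cons y bz_closed by auto
      then show ?thesis
        using False gr Cons.prems y by (auto simp: S_def add.assoc intro: span_scale)
    qed
    ultimately have "act x (act y (wact u w)) \<in> S ?g"
      using act_act[OF Cons.prems(1) y(2)] by (simp add: S_def span_add span_scale)
    then show ?case by simp
  qed
  have "wact u w \<in> S (sum_list (map gr u))" using u
  proof (induction u)
    case Nil
    then show ?case using wS[of "[]"] by simp
  next
    case (Cons x u)
    then have x: "x \<in> L" and IH: "wact u w \<in> S (sum_list (map gr u))" by auto
    let ?g = "gr x + sum_list (map gr u)"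
    have "act x (wact u w) \<in> S ?g"
      using IH unfolding S_def
    proof (rule act_span[OF x])
      fix s assume "s \<in> {wact u' w |u'. set u' \<subseteq> Pos \<and> sum_list (map gr u') = sum_list (map gr u)} \<union> N"
      then have "act x s \<in> S ?g"
        using word[OF x] NS submodule_act[OF N x] by force
      then show "act x s \<in> span ({wact u' w |u'. set u' \<subseteq> Pos \<and> sum_list (map gr u') = ?g} \<union> N)"
        by (simp add: S_def)
    qed
    then show ?case by simp
  qed
  then show ?thesis by (simp add: S_def)
qed

end

text \<open>The Iwahori subalgebra, in a normalization in which \<open>[G\<^sub>i, G\<^sub>j] = 2 E\<^sub>i\<^sub>+\<^sub>j\<^sub>+\<^sub>1\<close> and
  \<open>[B\<^sub>i, B\<^sub>j] = -2 A\<^sub>i\<^sub>+\<^sub>j\<close>. In the twisted algebra \<open>E, G, H, A, B\<close> are built from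
  \<open>e, g\<^sup>+, h, f, g\<^sup>-\<close>, in the untwisted algebra from \<open>f, g\<^sup>-, h, e, g\<^sup>+\<close>.\<close>

datatype iw = E nat | G nat | H nat | A nat | B nat

fun iw_par :: "iw \<Rightarrow> nat" where
  "iw_par (G _) = 1" | "iw_par (B _) = 1" | "iw_par _ = 0"

fun iw_coeff :: "iw \<Rightarrow> iw \<Rightarrow> complex" where
  "iw_coeff (G _) (G _) = 2" | "iw_coeff (B _) (B _) = - 2"
| "iw_coeff (G _) (B _) = 1" | "iw_coeff (B _) (G _) = 1"
| "iw_coeff (E _) (A _) = 1" | "iw_coeff (A _) (E _) = - 1"
| "iw_coeff (H _) (E _) = 2" | "iw_coeff (E _) (H _) = - 2"
| "iw_coeff (H _) (A _) = - 2" | "iw_coeff (A _) (H _) = 2"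
| "iw_coeff (H _) (G _) = 1" | "iw_coeff (G _) (H _) = - 1"
| "iw_coeff (H _) (B _) = - 1" | "iw_coeff (B _) (H _) = 1"
| "iw_coeff (A _) (G _) = - 1" | "iw_coeff (G _) (A _) = 1"
| "iw_coeff (E _) (B _) = - 1" | "iw_coeff (B _) (E _) = 1"
| "iw_coeff _ _ = 0"

text \<open>The last equation is a dummy: it is reached only where \<open>iw_coeff\<close>
  vanishes.\<close>

fun iw_letter :: "iw \<Rightarrow> iw \<Rightarrow> iw" where
  "iw_letter (G i) (G j) = E (i + j + 1)" | "iw_letter (B i) (B j) = A (i + j)"
| "iw_letter (G i) (B j) = H (i + j + 1)" | "iw_letter (B i) (G j) = H (i + j + 1)"
| "iw_letter (E i) (A j) = H (i + j + 1)" | "iw_letter (A i) (E j) = H (i + j + 1)"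
| "iw_letter (H i) (E j) = E (i + j)" | "iw_letter (E i) (H j) = E (i + j)"
| "iw_letter (H i) (A j) = A (i + j)" | "iw_letter (A i) (H j) = A (i + j)"
| "iw_letter (H i) (G j) = G (i + j)" | "iw_letter (G i) (H j) = G (i + j)"
| "iw_letter (H i) (B j) = B (i + j)" | "iw_letter (B i) (H j) = B (i + j)"
| "iw_letter (A i) (G j) = B (i + j + 1)" | "iw_letter (G i) (A j) = B (i + j + 1)"
| "iw_letter (E i) (B j) = G (i + j)" | "iw_letter (B i) (E j) = G (i + j)"
| "iw_letter x _ = x"

text \<open>The grading by the root lattice: the multiplicities of the simple roots of \<open>B 0\<close> and \<open>E 0\<close>.\<close>

fun grB :: "iw \<Rightarrow> nat" where
  "grB (E i) = 2 * i" | "grB (G i) = 2 * i + 1" | "grB (H i) = 2 * i"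
| "grB (A i) = 2 * i + 2" | "grB (B i) = 2 * i + 1"

fun grE :: "iw \<Rightarrow> nat" where
  "grE (E i) = i + 1" | "grE (G i) = i + 1" | "grE (H i) = i" | "grE (A i) = i" | "grE (B i) = i"

lemma grB_letter: "iw_coeff x y \<noteq> 0 \<Longrightarrow> grB (iw_letter x y) = grB x + grB y"
  and grE_letter: "iw_coeff x y \<noteq> 0 \<Longrightarrow> grE (iw_letter x y) = grE x + grE y"
  by (cases x; cases y; simp)+

definition word_gf :: "iw list list \<Rightarrow> complex \<Rightarrow> complex \<Rightarrow> complex" where
  "word_gf us y z = (\<Sum>u\<leftarrow>us. y ^ sum_list (map grB u) * z ^ sum_list (map grE u))"

text \<open>\<open>PG y z k\<close> belongs to a highest weight vector killed by \<open>B 0\<close>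
  to the power k + 1, \<open>QG y z m\<close> to a lowest weight vector killed by \<open>E 0\<close>
  to the power m + 1; y and z record the degrees in the roots of \<open>B 0\<close> and
  \<open>E 0\<close>. The first summand counts the submodule generated by the last power not known
  to vanish, the second the quotient by it. On the generator of that submodule the other root vector
  vanishes to the power k div 2 + 1, respectively 2m + 2, for reasons of weight.\<close>

function PG QG :: "complex \<Rightarrow> complex \<Rightarrow> nat \<Rightarrow> complex" where
  "PG y z 0 = 1"
| "PG y z (Suc k) = y ^ Suc k * QG y z (k div 2) + PG y z k"
| "QG y z 0 = 1"
| "QG y z (Suc m) = z ^ Suc m * PG y z (2 * m + 1) + QG y z m"
  by pat_completeness auto
termination
  \<comment> \<open>\<open>QG\<close> at m is weighed like \<open>PG\<close> at 2m, so both
    exchanges decrease the measure.\<close>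
  by (relation "measure (\<lambda>p. case p of Inl (_, _, k) \<Rightarrow> 2 * k | Inr (_, _, m) \<Rightarrow> 4 * m)") auto

lemma word_gf_append [simp]: "word_gf (us @ us') y z = word_gf us y z + word_gf us' y z"
  by (simp add: word_gf_def)

lemma word_gf_map_append:
  "word_gf (map (\<lambda>u. u @ r) us) y z =
     y ^ sum_list (map grB r) * z ^ sum_list (map grE r) * word_gf us y z"
  by (induction us) (simp_all add: word_gf_def power_add algebra_simps)

section \<open>Lowest and highest weight vectors over the Iwahori subalgebra\<close>

locale iwahori_action =
  super_action scale "UNIV :: iw set" act iw_par iw_coeff iw_letter
  for scale :: "complex \<Rightarrow> 'v::ab_group_add \<Rightarrow> 'v" (infixr \<open>*s\<close> 75) and act
begin

text \<open>Lowest and (next) highest weight vectors modulo \<open>N\<close>, with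
  \<open>H 0\<close>-eigenvalue \<open>c\<close>. A vector of one kind becomes one of the other kind
  under the top power of a simple root vector.\<close>

definition low :: "'v set \<Rightarrow> 'v \<Rightarrow> complex \<Rightarrow> bool" where
  "low N w c \<longleftrightarrow> submodule N \<and> (\<forall>i. act (A i) w \<in> N \<and> act (B i) w \<in> N \<and> act (H (Suc i)) w \<in> N)
     \<and> act (H 0) w - c *s w \<in> N"

definition high :: "'v set \<Rightarrow> 'v \<Rightarrow> complex \<Rightarrow> bool" where
  "high N w c \<longleftrightarrow> submodule N \<and> (\<forall>i. act (E i) w \<in> N \<and> act (G i) w \<in> N \<and> act (H (Suc i)) w \<in> N)
     \<and> act (H 0) w - c *s w \<in> N"

text \<open>A list rather than a set, because generating functions count words with multiplicity;
  that the words are distinct follows only once the dimension is known.\<close>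

definition spans :: "iw list list \<Rightarrow> 'v \<Rightarrow> 'v set \<Rightarrow> bool" where
  "spans us w N \<longleftrightarrow> (\<forall>u. wact u w \<in> span ((\<lambda>u. wact u w) ` set us \<union> N))"

definition grade :: "iw \<Rightarrow> nat \<times> nat" where
  "grade x = (grB x, grE x)"

lemma sum_list_grade: "sum_list (map grade u) = (sum_list (map grB u), sum_list (map grE u))"
  by (induction u) (simp_all add: grade_def zero_prod_def)

section \<open>Commutation relations and powers of simple root vectors\<close>

lemma act_simps:
  "act (E i) (act (E j) v) = act (E j) (act (E i) v)"
  "act (A i) (act (A j) v) = act (A j) (act (A i) v)"
  "act (A i) (act (B j) v) = act (B j) (act (A i) v)"
  "act (H i) (act (E j) v) = act (E j) (act (H i) v) + 2 *s act (E (i + j)) v"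
  "act (H i) (act (A j) v) = act (A j) (act (H i) v) - 2 *s act (A (i + j)) v"
  "act (H i) (act (B j) v) = act (B j) (act (H i) v) - act (B (i + j)) v"
  "act (A i) (act (E j) v) = act (E j) (act (A i) v) - act (H (i + j + 1)) v"
  "act (E i) (act (A j) v) = act (A j) (act (E i) v) + act (H (i + j + 1)) v"
  "act (B i) (act (E j) v) = act (E j) (act (B i) v) + act (G (i + j)) v"
  "act (G i) (act (A j) v) = act (A j) (act (G i) v) + act (B (i + j + 1)) v"
  "act (B i) (act (B j) v) = - act (B j) (act (B i) v) - 2 *s act (A (i + j)) v"
  using act_act[of "E i" "E j" v] act_act[of "A i" "A j" v] act_act[of "A i" "B j" v]
    act_act[of "H i" "E j" v] act_act[of "H i" "A j" v] act_act[of "H i" "B j" v]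
    act_act[of "A i" "E j" v] act_act[of "E i" "A j" v] act_act[of "B i" "E j" v]
    act_act[of "G i" "A j" v] act_act[of "B i" "B j" v]
  by simp_all

lemma act_diff: "act x (u - v) = act x u - act x v"
  using act_add[of x u "- v"] act_scale[of x "-1" v] by simp

lemma funpow_act_add: "(act x ^^ k) (u + v) = (act x ^^ k) u + (act x ^^ k) v"
  and funpow_act_scale: "(act x ^^ k) (c *s v) = c *s (act x ^^ k) v"
  by (induction k) (simp_all add: act_add act_scale)

text \<open>Leibniz rule: since \<open>z\<close> commutes with \<open>x\<close>, the m terms
  coincide. The truncated exponent at m = 0 is harmless because its coefficient vanishes.\<close>

lemma act_power_commutator:
  assumes "\<And>v. act y (act x v) = act x (act y v) + d *s act z v"
    and "\<And>v. act x (act z v) = act z (act x v)"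
  shows "act y ((act x ^^ m) v) =
    (act x ^^ m) (act y v) + (d * of_nat m) *s act z ((act x ^^ (m - 1)) v)"
proof (induction m)
  case (Suc m)
  show ?case
  proof (cases m)
    case 0
    then show ?thesis using assms(1) by simp
  next
    case (Suc k)
    have "act y ((act x ^^ Suc m) v) = act x (act y ((act x ^^ m) v)) + d *s act z ((act x ^^ m) v)"
      by (simp add: assms(1))
    also have "act x (act z ((act x ^^ (m - 1)) v)) = act z ((act x ^^ m) v)"
      using Suc assms(2) by simp
    then have "act x (act y ((act x ^^ m) v)) =
        (act x ^^ Suc m) (act y v) + (d * of_nat m) *s act z ((act x ^^ m) v)"
      unfolding Suc.IH by (simp add: act_add act_scale)
    finally show ?thesis by (simp add: algebra_simps)
  qed
qed simp

text \<open>Here the commutator \<open>h\<close> does not commute with \<open>x\<close>. Moving it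
  to the right in each of the m Leibniz terms costs 0, 1, ..., m - 1 further commutators, hence the
  factor m(m-1)/2.\<close>

lemma act_power_double_commutator:
  assumes yx: "\<And>v. act y (act x v) = act x (act y v) + d *s act h v"
    and hx: "\<And>v. act h (act x v) = act x (act h v) + e *s act z v"
    and xz: "\<And>v. act x (act z v) = act z (act x v)"
  shows "act y ((act x ^^ m) v) =
    (act x ^^ m) (act y v) + (d * of_nat m) *s (act x ^^ (m - 1)) (act h v)
    + (d * e * (of_nat m * (of_nat m - 1) / 2)) *s act z ((act x ^^ (m - 2)) v)"
proof (induction m)
  case (Suc m)
  show ?case
  proof (cases m)
    case 0
    then show ?thesis using yx by simp
  next
    case m: (Suc k)
    let ?z = "act z ((act x ^^ (m - 1)) v)" and ?h = "(act x ^^ m) (act h v)"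
    let ?c = "of_nat m :: complex"
    have 1: "act x ((act x ^^ (m - Suc 0)) u) = (act x ^^ m) u" for u
      using m by simp
    have 2: "(?c * (?c - 1) / 2) *s act x (act z ((act x ^^ (m - 2)) v)) = (?c * (?c - 1) / 2) *s ?z"
      using m xz by (cases k) simp_all
    have "act y ((act x ^^ Suc m) v) = act x (act y ((act x ^^ m) v)) + d *s act h ((act x ^^ m) v)"
      by (simp add: yx)
    also have "act x (act y ((act x ^^ m) v)) =
        (act x ^^ Suc m) (act y v) + (d * ?c) *s ?h + (d * e) *s (?c * (?c - 1) / 2) *s ?z"
      unfolding Suc.IH 2[symmetric] by (simp add: act_add act_scale 1)
    also have "act h ((act x ^^ m) v) = ?h + (e * ?c) *s ?z"
      by (rule act_power_commutator[OF hx xz])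
    also have "(act x ^^ Suc m) (act y v) + (d * ?c) *s ?h + (d * e) *s (?c * (?c - 1) / 2) *s ?z
        + d *s (?h + (e * ?c) *s ?z) =
        (act x ^^ Suc m) (act y v) + (d * ?c + d) *s ?h
        + (d * e * (?c * (?c - 1) / 2) + d * (e * ?c)) *s ?z"
      by (simp only: scale_left_distrib scale_right_distrib scale_scale add_ac)
    also have "d * e * (?c * (?c - 1) / 2) + d * (e * ?c) =
        d * e * (of_nat (Suc m) * (of_nat (Suc m) - 1) / 2)"
      by (simp add: field_simps)
    finally show ?thesis by (simp add: distrib_left add.commute)
  qed
qed simp

lemma H_E0: "act (H i) ((act (E 0) ^^ m) v) =
    (act (E 0) ^^ m) (act (H i) v) + (2 * of_nat m) *s act (E i) ((act (E 0) ^^ (m - 1)) v)"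
  by (rule act_power_commutator) (use act_simps(4)[of i 0] act_simps(1)[of 0 i] in simp_all)

lemma B_E0: "act (B j) ((act (E 0) ^^ m) v) =
    (act (E 0) ^^ m) (act (B j) v) + of_nat m *s act (G j) ((act (E 0) ^^ (m - 1)) v)"
  using act_power_commutator[of "B j" "E 0" 1 "G j" m v] act_simps(9)[of j 0] act_act[of "E 0" "G j"]
  by simp

lemma A_E0: "act (A j) ((act (E 0) ^^ m) v) =
    (act (E 0) ^^ m) (act (A j) v) - of_nat m *s (act (E 0) ^^ (m - 1)) (act (H (Suc j)) v)
    - (of_nat m * (of_nat m - 1)) *s act (E (Suc j)) ((act (E 0) ^^ (m - 2)) v)"
  using act_power_double_commutator[of "A j" "E 0" "- 1" "H (Suc j)" 2 "E (Suc j)" m v]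
    act_simps(7)[of j 0] act_simps(4)[of "Suc j" 0] act_simps(1)[of 0 "Suc j"]
  by (simp add: scale_minus_left)

lemma G_A0: "act (G j) ((act (A 0) ^^ m) v) =
    (act (A 0) ^^ m) (act (G j) v) + of_nat m *s act (B (Suc j)) ((act (A 0) ^^ (m - 1)) v)"
  using act_power_commutator[of "G j" "A 0" 1 "B (Suc j)" m v] act_simps(10)[of j 0] act_simps(3)[of 0 "Suc j"]
  by simp

lemma H_A0: "act (H i) ((act (A 0) ^^ m) v) =
    (act (A 0) ^^ m) (act (H i) v) - (2 * of_nat m) *s act (A i) ((act (A 0) ^^ (m - 1)) v)"
  using act_power_commutator[of "H i" "A 0" "- 2" "A i" m v] act_simps(5)[of i 0] act_simps(2)[of 0 i]
  by (simp add: scale_minus_left)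

lemma E_A0: "act (E j) ((act (A 0) ^^ m) v) =
    (act (A 0) ^^ m) (act (E j) v) + of_nat m *s (act (A 0) ^^ (m - 1)) (act (H (Suc j)) v)
    - (of_nat m * (of_nat m - 1)) *s act (A (Suc j)) ((act (A 0) ^^ (m - 2)) v)"
  using act_power_double_commutator[of "E j" "A 0" 1 "H (Suc j)" "- 2" "A (Suc j)" m v]
    act_simps(8)[of j 0] act_simps(5)[of "Suc j" 0] act_simps(2)[of 0 "Suc j"]
  by (simp add: scale_minus_left)

text \<open>For an odd letter the bracket with itself is twice the square, so 2 \<open>B 0\<close>^2
  = -2 \<open>A 0\<close>. Powers of \<open>B 0\<close> are thereby reduced to powers of
  \<open>A 0\<close>.\<close>

lemma B0_B0: "act (B 0) (act (B 0) v) = - act (A 0) v"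
proof -
  let ?X = "act (B 0) (act (B 0) v)"
  have "?X = - ?X - 2 *s act (A 0) v" using act_simps(11)[of 0 0 v] by simp
  then have "?X + ?X = ?X + (- ?X - 2 *s act (A 0) v)" by simp
  then have "2 *s ?X = 2 *s (- act (A 0) v)"
    using scale_left_distrib[of 1 1 ?X] by simp
  then show ?thesis using scale_left_imp_eq[of 2 ?X "- act (A 0) v"] by simp
qed

lemma B0_even: "(act (B 0) ^^ (2 * m)) v = (- 1) ^ m *s (act (A 0) ^^ m) v"
  by (induction m) (simp_all add: act_scale B0_B0)

lemma H0_E0: "act (H 0) ((act (E 0) ^^ m) v) =
    (act (E 0) ^^ m) (act (H 0) v) + (2 * of_nat m) *s (act (E 0) ^^ m) v"
proof (cases m)
  case (Suc k)
  then have "act (E 0) ((act (E 0) ^^ (m - 1)) v) = (act (E 0) ^^ m) v" by simp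
  then show ?thesis using H_E0[of 0 m v] by simp
qed simp

lemma H0_B0: "act (H 0) ((act (B 0) ^^ k) v) =
    (act (B 0) ^^ k) (act (H 0) v) - of_nat k *s (act (B 0) ^^ k) v"
proof (induction k)
  case (Suc k)
  have "act (H 0) ((act (B 0) ^^ Suc k) v) =
      act (B 0) (act (H 0) ((act (B 0) ^^ k) v)) - (act (B 0) ^^ Suc k) v"
    using act_simps(6)[of 0 0] by simp
  then show ?case unfolding Suc.IH by (simp add: act_diff act_scale algebra_simps)
qed simp

lemma subspace_unscale: "subspace N \<Longrightarrow> c *s v \<in> N \<Longrightarrow> c \<noteq> 0 \<Longrightarrow> v \<in> N"
  using subspace_scale[of N "c *s v" "inverse c"] by simp

text \<open>Solves a commutator formula modulo \<open>N\<close> for the one term not yet known to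
  lie in \<open>N\<close>.\<close>

lemma subspace_cancel:
  assumes "subspace N" "x \<in> N" "u \<in> N" "c \<noteq> 0" "x = u + c *s v \<or> x = u - c *s v"
  shows "v \<in> N"
proof -
  have "x - u \<in> N" "u - x \<in> N" using assms(1-3) by (auto intro: subspace_diff)
  then show ?thesis using assms(1,4,5) subspace_unscale[of N c v] by auto
qed

section \<open>Weights, vanishing and top vectors\<close>

lemma low_positive_span:
  assumes "low N w c"
  shows "wact u w \<in> span ({wact u' w | u'. set u' \<subseteq> range E \<union> range G \<and>
           sum_list (map grade u') = sum_list (map grade u)} \<union> N)"
proof (rule positive_words_span)
  show "submodule N" using assms by (simp add: low_def)
  fix x assume "x \<notin> range E \<union> range G"
  then show "act x w \<in> N \<or> grade x = 0 \<and> (\<exists>c. act x w - c *s w \<in> N)"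
    using assms
    by (cases x; cases "x = H 0") (auto simp: low_def grade_def zero_prod_def gr0_conv_Suc)
qed (auto simp: grade_def grB_letter grE_letter)

lemma high_positive_span:
  assumes "high N w c"
  shows "wact u w \<in> span ({wact u' w | u'. set u' \<subseteq> range A \<union> range B \<and>
           sum_list (map grade u') = sum_list (map grade u)} \<union> N)"
proof (rule positive_words_span)
  show "submodule N" using assms by (simp add: high_def)
  fix x assume "x \<notin> range A \<union> range B"
  then show "act x w \<in> N \<or> grade x = 0 \<and> (\<exists>c. act x w - c *s w \<in> N)"
    using assms
    by (cases x; cases "x = H 0") (auto simp: high_def grade_def zero_prod_def gr0_conv_Suc)
qed (auto simp: grade_def grB_letter grE_letter)

text \<open>The form 2 \<open>grE\<close> - \<open>grB\<close> is the weight under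
  \<open>H 0\<close>: it is 2, 1, 0, -1, -2 on E, G, H, B, A. So a word in E and G without positive
  weight is empty.\<close>

lemma grade_EG: "set u \<subseteq> range E \<union> range G \<Longrightarrow>
    sum_list (map grB u) + length u \<le> 2 * sum_list (map grE u)"
  by (induction u) auto

lemma grade_AB: "set u \<subseteq> range A \<union> range B \<Longrightarrow>
    2 * sum_list (map grE u) + length u \<le> sum_list (map grB u)"
  by (induction u) auto

text \<open>A word of nonzero degree that does not move the weight of \<open>w\<close> in the direction of its module
  annihilates \<open>w\<close>.\<close>

lemma low_vanish:
  assumes "low N w c" "2 * sum_list (map grE u) \<le> sum_list (map grB u)" "sum_list (map grE u) > 0"
  shows "wact u w \<in> N"
proof -
  have "{wact u' w | u'. set u' \<subseteq> range E \<union> range G \<and>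
           sum_list (map grade u') = sum_list (map grade u)} = {}"
  proof safe
    fix u' assume u': "set u' \<subseteq> range E \<union> range G" "sum_list (map grade u') = sum_list (map grade u)"
    have "length u' = 0"
      using grade_EG[OF u'(1)] u'(2) assms(2) unfolding sum_list_grade prod.inject by linarith
    then have "u' = []" by simp
    then have "sum_list (map grE u) = 0"
      using u'(2) unfolding sum_list_grade prod.inject by (simp only: list.map sum_list.Nil)
    then show "wact u' w \<in> {}" using assms(3) by linarith
  qed
  moreover have "span N = N"
    using assms(1) by (simp add: low_def submodule_def span_eq_iff)
  ultimately show ?thesis using low_positive_span[OF assms(1), of u] by (simp only: Un_empty_left)
qed

lemma high_vanish:
  assumes "high N w c" "sum_list (map grB u) \<le> 2 * sum_list (map grE u)" "sum_list (map grB u) > 0"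
  shows "wact u w \<in> N"
proof -
  have "{wact u' w | u'. set u' \<subseteq> range A \<union> range B \<and>
           sum_list (map grade u') = sum_list (map grade u)} = {}"
  proof safe
    fix u' assume u': "set u' \<subseteq> range A \<union> range B" "sum_list (map grade u') = sum_list (map grade u)"
    have "length u' = 0"
      using grade_AB[OF u'(1)] u'(2) assms(2) unfolding sum_list_grade prod.inject by linarith
    then have "u' = []" by simp
    then have "sum_list (map grB u) = 0"
      using u'(2) unfolding sum_list_grade prod.inject by (simp only: list.map sum_list.Nil)
    then show "wact u' w \<in> {}" using assms(3) by linarith
  qed
  moreover have "span N = N"
    using assms(1) by (simp add: high_def submodule_def span_eq_iff)
  ultimately show ?thesis using high_positive_span[OF assms(1), of u] by (simp only: Un_empty_left)
qed

text \<open>Commute \<open>H i\<close>, \<open>B j\<close> and \<open>A j\<close> with the vanishing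
  power m + 1 of \<open>E 0\<close>. One term ends in a letter that kills w, and what remains is
  \<open>E i\<close> or \<open>G j\<close> on the top vector, or, one power lower, the term that
  gives \<open>H (Suc i)\<close>. The second claim holds because the word has weight zero and
  positive degree.\<close>

lemma low_top:
  assumes low: "low N w c" and top: "(act (E 0) ^^ Suc m) w \<in> N"
  shows "high N ((act (E 0) ^^ m) w) (c + 2 * of_nat m)"
    and "m > 0 \<Longrightarrow> (act (B 0) ^^ (2 * m)) ((act (E 0) ^^ m) w) \<in> N"
proof -
  have sub: "submodule N" and sp: "subspace N" and aN: "act (A i) w \<in> N" and bN: "act (B i) w \<in> N"
    and hN: "act (H (Suc i)) w \<in> N" and h0: "act (H 0) w - c *s w \<in> N" for i
    using low by (auto simp: low_def submodule_def)
  note N = submodule_funpow[OF sub UNIV_I] submodule_act[OF sub UNIV_I]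
    subspace_add[OF sp] subspace_diff[OF sp] subspace_scale[OF sp]
  let ?w = "(act (E 0) ^^ m) w"
  have e1: "act (E i) ?w \<in> N" for i
  proof (cases i)
    case 0
    then show ?thesis using top by simp
  next
    case (Suc j)
    show ?thesis
      by (rule subspace_cancel[OF sp N(2)[OF top] N(1)[OF hN], where c = "2 * of_nat (Suc m)"])
        (use H_E0[of i "Suc m" w] Suc in \<open>auto simp del: of_nat_Suc funpow.simps\<close>)
  qed
  have g: "act (G i) ?w \<in> N" for i
    by (rule subspace_cancel[OF sp N(2)[OF top] N(1)[OF bN], where c = "of_nat (Suc m)"])
      (use B_E0[of i "Suc m" w] in \<open>auto simp del: of_nat_Suc funpow.simps\<close>)
  have h: "act (H (Suc i)) ?w \<in> N" for i
  proof (cases m)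
    case 0
    then show ?thesis using hN by simp
  next
    case (Suc k)
    then have nz: "of_nat (Suc m) * (of_nat (Suc m) - 1) \<noteq> (0 :: complex)"
      by (simp del: of_nat_Suc; simp)
    let ?u = "(act (E 0) ^^ Suc m) (act (A i) w) - of_nat (Suc m) *s (act (E 0) ^^ (Suc m - 1)) (act (H (Suc i)) w)"
    have "?u \<in> N" using N(1)[OF aN] N(1)[OF hN] by (intro N(4) N(5))
    then have "act (E (Suc i)) ((act (E 0) ^^ (Suc m - 2)) w) \<in> N"
      by (rule subspace_cancel[OF sp N(2)[OF top] _ nz disjI2[OF A_E0]])
    then show ?thesis unfolding H_E0 using N(1)[OF hN] by (intro N(3) N(5)) (simp_all add: numeral_2_eq_2)
  qed
  have "act (H 0) ?w - (c + 2 * of_nat m) *s ?w = (act (E 0) ^^ m) (act (H 0) w + (- c) *s w)"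
    unfolding H0_E0 funpow_act_add funpow_act_scale by (simp add: algebra_simps)
  also have "\<dots> \<in> N" using N(1) h0 by simp
  finally show "high N ?w (c + 2 * of_nat m)"
    using sub e1 g h by (simp add: high_def)
  assume "m > 0"
  then have "wact (replicate (2 * m) (B 0) @ replicate m (E 0)) w \<in> N"
    by (intro low_vanish[OF low]) (simp_all add: sum_list_replicate)
  then show "(act (B 0) ^^ (2 * m)) ?w \<in> N" by (simp add: wact_replicate)
qed

text \<open>The mirror image of \<open>low_top\<close>, except that the odd root vector
  \<open>B 0\<close> supplies the powers: commutators are computed with \<open>A 0\<close>, and the
  parity of k decides how they reach \<open>B 0\<close>.\<close>

lemma high_top:
  assumes high: "high N w c" and top: "(act (B 0) ^^ Suc k) w \<in> N"
  shows "low N ((act (B 0) ^^ k) w) (c - of_nat k)"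
    and "k > 0 \<Longrightarrow> (act (E 0) ^^ Suc ((k - 1) div 2)) ((act (B 0) ^^ k) w) \<in> N"
proof -
  have sub: "submodule N" and sp: "subspace N" and eN: "act (E i) w \<in> N" and gN: "act (G i) w \<in> N"
    and hN: "act (H (Suc i)) w \<in> N" and h0: "act (H 0) w - c *s w \<in> N" for i
    using high by (auto simp: high_def submodule_def)
  note N = submodule_funpow[OF sub UNIV_I] submodule_act[OF sub UNIV_I]
    subspace_add[OF sp] subspace_diff[OF sp] subspace_scale[OF sp]
  let ?A = "\<lambda>m. (act (A 0) ^^ m) w"
  \<comment> \<open>As in \<open>low_top\<close>, with \<open>A 0\<close> for \<open>E 0\<close>.
    The bracket of \<open>G j\<close> with \<open>A 0\<close> is \<open>B (Suc j)\<close>, so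
    \<open>B 0\<close> itself is never obtained and is treated in the parity cases below.\<close>
  have a: "act (A i) (?A m) \<in> N" "act (B (Suc i)) (?A m) \<in> N" "act (H (Suc i)) (?A m) \<in> N"
    if "?A (Suc m) \<in> N" for i m
  proof -
    show "act (A i) (?A m) \<in> N"
    proof (cases i)
      case 0
      then show ?thesis using that by simp
    next
      case (Suc j)
      show ?thesis
        by (rule subspace_cancel[OF sp N(2)[OF that] N(1)[OF hN], where c = "2 * of_nat (Suc m)"])
          (use H_A0[of i "Suc m" w] Suc in \<open>auto simp del: of_nat_Suc funpow.simps\<close>)
    qed
    show "act (B (Suc i)) (?A m) \<in> N"
      by (rule subspace_cancel[OF sp N(2)[OF that] N(1)[OF gN], where c = "of_nat (Suc m)"])
        (use G_A0[of i "Suc m" w] in \<open>auto simp del: of_nat_Suc funpow.simps\<close>)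
    show "act (H (Suc i)) (?A m) \<in> N"
    proof (cases m)
      case 0
      then show ?thesis using hN by simp
    next
      case (Suc k)
      then have nz: "of_nat (Suc m) * (of_nat (Suc m) - 1) \<noteq> (0 :: complex)"
        by (simp del: of_nat_Suc; simp)
      let ?u = "(act (A 0) ^^ Suc m) (act (E i) w) + of_nat (Suc m) *s (act (A 0) ^^ (Suc m - 1)) (act (H (Suc i)) w)"
      have "?u \<in> N" using N(1)[OF eN] N(1)[OF hN] by (intro N(3) N(5))
      then have "act (A (Suc i)) ((act (A 0) ^^ (Suc m - 2)) w) \<in> N"
        by (rule subspace_cancel[OF sp N(2)[OF that] _ nz disjI2[OF E_A0]])
      then show ?thesis unfolding H_A0 using N(1)[OF hN] by (intro N(4) N(5)) (simp_all add: numeral_2_eq_2)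
    qed
  qed
  let ?w = "(act (B 0) ^^ k) w"
  have ab: "act (A i) ?w \<in> N \<and> act (B i) ?w \<in> N \<and> act (H (Suc i)) ?w \<in> N" for i
  \<comment> \<open>With m = k div 2 the top vector is, up to sign, the m-th power of
    \<open>A 0\<close> on w, with one more \<open>B 0\<close> in front when k is odd. In both cases
    the power m + 1 of \<open>A 0\<close> kills w.\<close>
  proof (cases "even k")
    case True
    then obtain m where k: "k = 2 * m" by blast
    have "(act (B 0) ^^ (2 * Suc m)) w \<in> N" using N(2)[OF top, of "B 0"] k by simp
    then have A: "?A (Suc m) \<in> N"
      unfolding B0_even by (rule subspace_unscale[OF sp]) simp
    have w: "?w = (- 1) ^ m *s ?A m" unfolding k by (rule B0_even)
    have "act (B i) ?w \<in> N"
    proof (cases i)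
      case 0
      then show ?thesis using top by simp
    next
      case (Suc j)
      then show ?thesis using a(2)[OF A] N(5) by (simp add: w act_scale)
    qed
    then show ?thesis using a[OF A] N(5) by (simp add: w act_scale)
  next
    case False
    then obtain m where k: "k = 2 * m + 1" by (auto elim: oddE)
    have "(act (B 0) ^^ (2 * Suc m)) w \<in> N" using top k by simp
    then have A: "?A (Suc m) \<in> N"
      unfolding B0_even by (rule subspace_unscale[OF sp]) simp
    have w: "?w = (- 1) ^ m *s act (B 0) (?A m)" unfolding k using B0_even[of m w] by (simp add: act_scale)
    have "act (B i) (act (B 0) (?A m)) \<in> N"
    proof (cases i)
      case 0
      then show ?thesis using A by (simp add: B0_B0 subspace_neg[OF sp])
    next
      case (Suc j)
      have "act (B i) (act (B 0) (?A m)) = - act (B 0) (act (B i) (?A m)) - 2 *s act (A i) (?A m)"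
        using act_simps(11)[of i 0] by simp
      then show ?thesis using a[OF A] Suc N subspace_neg[OF sp] by metis
    qed
    moreover have "act (A i) (act (B 0) (?A m)) \<in> N"
      unfolding act_simps(3) by (rule N(2)[OF a(1)[OF A]])
    moreover have "act (H (Suc i)) (act (B 0) (?A m)) \<in> N"
      unfolding act_simps(6) using a[OF A] N by simp
    ultimately show ?thesis using N(5) by (simp add: w act_scale)
  qed
  have "act (H 0) ?w - (c - of_nat k) *s ?w = (act (B 0) ^^ k) (act (H 0) w + (- c) *s w)"
    unfolding H0_B0 funpow_act_add funpow_act_scale by (simp add: algebra_simps)
  also have "\<dots> \<in> N" using N(1) h0 by simp
  finally show "low N ?w (c - of_nat k)"
    using sub ab by (simp add: low_def)
  assume "k > 0"
  \<comment> \<open>k / 2 rounded up: the least M for which the weight of \<open>E 0\<close>^M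
    \<open>B 0\<close>^k is not negative.\<close>
  define M where "M = Suc ((k - 1) div 2)"
  have "k \<le> 2 * M" unfolding M_def by presburger
  with \<open>k > 0\<close> have "wact (replicate M (E 0) @ replicate k (B 0)) w \<in> N"
    by (intro high_vanish[OF high]) (simp_all add: sum_list_replicate)
  then show "(act (E 0) ^^ Suc ((k - 1) div 2)) ?w \<in> N"
    unfolding M_def[symmetric] by (simp add: wact_replicate)
qed

section \<open>Spanning words by mutual induction\<close>

lemma spans_single:
  assumes "submodule N" "\<And>x. act x w \<in> N \<or> grade x = 0 \<and> (\<exists>c. act x w - c *s w \<in> N)"
  shows "spans [[]] w N"
  unfolding spans_def
proof
  fix u
  have "wact u w \<in> span ({wact u' w | u'. set u' \<subseteq> {} \<and>
           sum_list (map grade u') = sum_list (map grade u)} \<union> N)"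
    using assms by (intro positive_words_span) (auto simp: grade_def grB_letter grE_letter)
  also have "\<dots> \<subseteq> span ((\<lambda>u. wact u w) ` set [[]] \<union> N)"
    by (rule span_mono) auto
  finally show "wact u w \<in> span ((\<lambda>u. wact u w) ` set [[]] \<union> N)" .
qed

text \<open>The extension step: \<open>us1\<close> spans the submodule generated by
  \<open>wact r w\<close>, so its words receive \<open>r\<close> on the right, and
  \<open>us2\<close> spans the quotient by that submodule.\<close>

lemma spans_split:
  assumes N: "submodule N" and us1: "spans us1 (wact r w) N"
    and us2: "spans us2 w (span (N \<union> cyclic (wact r w)))"
  shows "spans (map (\<lambda>u. u @ r) us1 @ us2) w N"
  unfolding spans_def
proof
  fix u
  let ?S = "span ((\<lambda>u. wact u w) ` set (map (\<lambda>u. u @ r) us1 @ us2) \<union> N)"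
  have 1: "cyclic (wact r w) \<subseteq> ?S"
    unfolding cyclic_def
  proof (intro span_minimal subspace_span subsetI)
    fix v assume "v \<in> {wact u (wact r w) |u. set u \<subseteq> UNIV}"
    then obtain u where "v = wact u (wact r w)" by auto
    then have "v \<in> span ((\<lambda>u. wact u (wact r w)) ` set us1 \<union> N)"
      using us1 by (simp add: spans_def)
    also have "\<dots> \<subseteq> ?S"
      by (rule span_mono) (auto simp: image_image image_Un)
    finally show "v \<in> ?S" .
  qed
  have "wact u w \<in> span ((\<lambda>u. wact u w) ` set us2 \<union> span (N \<union> cyclic (wact r w)))"
    using us2 by (simp add: spans_def)
  also have "\<dots> \<subseteq> ?S"
    using 1 by (intro span_minimal subspace_span Un_least) (auto intro: span_base)
  finally show "wact u w \<in> ?S" .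
qed

text \<open>Quantified over all \<open>N\<close>, since the inductive step replaces \<open>N\<close>
  by a larger submodule. One list has to serve all y and z.\<close>

definition low_bound :: "nat \<Rightarrow> bool" where
  "low_bound m \<longleftrightarrow> (\<forall>N w c. low N w c \<longrightarrow> (act (E 0) ^^ Suc m) w \<in> N \<longrightarrow>
     (\<exists>us. spans us w N \<and> (\<forall>y z. word_gf us y z = QG y z m)))"

definition high_bound :: "nat \<Rightarrow> bool" where
  "high_bound k \<longleftrightarrow> (\<forall>N w c. high N w c \<longrightarrow> (act (B 0) ^^ Suc k) w \<in> N \<longrightarrow>
     (\<exists>us. spans us w N \<and> (\<forall>y z. word_gf us y z = PG y z k)))"

lemma low_mono: "low N w c \<Longrightarrow> submodule N' \<Longrightarrow> N \<subseteq> N' \<Longrightarrow> low N' w c"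
  and high_mono: "high N w c \<Longrightarrow> submodule N' \<Longrightarrow> N \<subseteq> N' \<Longrightarrow> high N' w c"
  by (auto simp: low_def high_def)

text \<open>Keeps the two halves apart, because \<open>us1\<close> alone describes the module of
  positive index while only both halves together can be compared with the dimension 3^k.\<close>

lemma low_split:
  assumes bounds: "high_bound (2 * m + 1)" "low_bound m"
    and low: "low N w c" and top: "(act (E 0) ^^ Suc (Suc m)) w \<in> N"
  shows "\<exists>us1 us2. spans us1 ((act (E 0) ^^ Suc m) w) N \<and>
      spans (map (\<lambda>u. u @ replicate (Suc m) (E 0)) us1 @ us2) w N \<and>
      (\<forall>y z. word_gf us1 y z = PG y z (2 * m + 1)) \<and> (\<forall>y z. word_gf us2 y z = QG y z m)"
proof -
  let ?r = "replicate (Suc m) (E 0)"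
  let ?w = "(act (E 0) ^^ Suc m) w"
  let ?N = "span (N \<union> cyclic (wact ?r w))"
  have r: "wact ?r w = ?w" by (simp only: wact_replicate)
  have N: "submodule N" using low by (simp add: low_def)
  have "(act (B 0) ^^ Suc (2 * m + 1)) ?w \<in> N"
    using low_top(2)[OF low top] by simp
  with low_top(1)[OF low top] bounds(1) obtain us1 where
    us1: "spans us1 ?w N" "\<forall>y z. word_gf us1 y z = PG y z (2 * m + 1)"
    unfolding high_bound_def by blast
  have "?w \<in> ?N"
    using wact_in_cyclic[of "[]" ?w] unfolding r by (intro span_base) simp
  moreover have "low ?N w c"
    by (rule low_mono[OF low submodule_sum_cyclic[OF N]]) (auto intro: span_base)
  ultimately obtain us2 where
    us2: "spans us2 w ?N" "\<forall>y z. word_gf us2 y z = QG y z m"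
    using bounds(2) unfolding low_bound_def by blast
  have "spans (map (\<lambda>u. u @ ?r) us1 @ us2) w N"
    using us1(1) us2(1) by (intro spans_split[OF N]) (simp_all only: r)
  with us1 us2 show ?thesis by blast
qed

lemma high_split:
  assumes bounds: "low_bound (k div 2)" "high_bound k"
    and high: "high N w c" and top: "(act (B 0) ^^ Suc (Suc k)) w \<in> N"
  shows "\<exists>us1 us2. spans us1 ((act (B 0) ^^ Suc k) w) N \<and>
      spans (map (\<lambda>u. u @ replicate (Suc k) (B 0)) us1 @ us2) w N \<and>
      (\<forall>y z. word_gf us1 y z = QG y z (k div 2)) \<and> (\<forall>y z. word_gf us2 y z = PG y z k)"
proof -
  let ?r = "replicate (Suc k) (B 0)"
  let ?w = "(act (B 0) ^^ Suc k) w"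
  let ?N = "span (N \<union> cyclic (wact ?r w))"
  have r: "wact ?r w = ?w" by (simp only: wact_replicate)
  have N: "submodule N" using high by (simp add: high_def)
  have "(act (E 0) ^^ Suc (k div 2)) ?w \<in> N"
    using high_top(2)[OF high top] by simp
  with high_top(1)[OF high top] bounds(1) obtain us1 where
    us1: "spans us1 ?w N" "\<forall>y z. word_gf us1 y z = QG y z (k div 2)"
    unfolding low_bound_def by blast
  have "?w \<in> ?N"
    using wact_in_cyclic[of "[]" ?w] unfolding r by (intro span_base) simp
  moreover have "high ?N w c"
    by (rule high_mono[OF high submodule_sum_cyclic[OF N]]) (auto intro: span_base)
  ultimately obtain us2 where
    us2: "spans us2 w ?N" "\<forall>y z. word_gf us2 y z = PG y z k"
    using bounds(2) unfolding high_bound_def by blast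
  have "spans (map (\<lambda>u. u @ ?r) us1 @ us2) w N"
    using us1(1) us2(1) by (intro spans_split[OF N]) (simp_all only: r)
  with us1 us2 show ?thesis by blast
qed

lemma not_H0_cases: "x = H 0 \<or> (\<exists>i. x \<in> {E i, G i, H (Suc i), A i, B i})"
proof (cases x)
  case (H i)
  then show ?thesis by (cases i) auto
qed auto

text \<open>All letters act on w by scalars modulo \<open>N\<close>. This starts both recursions:
  with exponent 0 the top vector is w itself, hence of both kinds.\<close>

lemma low_high_single:
  assumes "low N w c" "high N w c"
  shows "spans [[]] w N"
proof (rule spans_single)
  show "submodule N" using assms by (simp add: low_def)
  fix x
  show "act x w \<in> N \<or> grade x = 0 \<and> (\<exists>c. act x w - c *s w \<in> N)"
  proof (cases "x = H 0")
    case True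
    then show ?thesis using assms by (auto simp: low_def grade_def zero_prod_def)
  next
    case False
    then show ?thesis using assms not_H0_cases[of x] by (auto simp: low_def high_def)
  qed
qed

text \<open>The zeros are placeholders for y and z: only the recursion pattern of \<open>PG\<close>
  and \<open>QG\<close> in k and m is used.\<close>

lemma high_bound: "high_bound k" and low_bound: "low_bound m"
proof (induction "0::complex" "0::complex" k and "0::complex" "0::complex" m rule: PG_QG.induct)
  case 1
  show ?case unfolding high_bound_def
  proof (intro allI impI)
    fix N w c assume h: "high N w c" and t: "(act (B 0) ^^ Suc 0) w \<in> N"
    have "spans [[]] w N"
      using high_top(1)[OF h t] h by (intro low_high_single[of _ _ "c - 0"]) simp_all
    then show "\<exists>us. spans us w N \<and> (\<forall>y z. word_gf us y z = PG y z 0)"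
      by (intro exI[of _ "[[]]"]) (simp add: word_gf_def)
  qed
next
  case (2 k)
  show ?case unfolding high_bound_def
  proof (intro allI impI)
    fix N w c assume h: "high N w c" and t: "(act (B 0) ^^ Suc (Suc k)) w \<in> N"
    from high_split[OF 2 h t] obtain us1 us2 where
      "spans (map (\<lambda>u. u @ replicate (Suc k) (B 0)) us1 @ us2) w N"
      "\<forall>y z. word_gf us1 y z = QG y z (k div 2)" "\<forall>y z. word_gf us2 y z = PG y z k" by blast
    then show "\<exists>us. spans us w N \<and> (\<forall>y z. word_gf us y z = PG y z (Suc k))"
      by (intro exI conjI) (assumption, simp add: word_gf_map_append sum_list_replicate)
  qed
next
  case 3
  show ?case unfolding low_bound_def
  proof (intro allI impI)
    fix N w c assume h: "low N w c" and t: "(act (E 0) ^^ Suc 0) w \<in> N"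
    have "spans [[]] w N"
      using low_top(1)[OF h t] h by (intro low_high_single[of _ _ c]) simp_all
    then show "\<exists>us. spans us w N \<and> (\<forall>y z. word_gf us y z = QG y z 0)"
      by (intro exI[of _ "[[]]"]) (simp add: word_gf_def)
  qed
next
  case (4 m)
  show ?case unfolding low_bound_def
  proof (intro allI impI)
    fix N w c assume h: "low N w c" and t: "(act (E 0) ^^ Suc (Suc m)) w \<in> N"
    from low_split[OF 4 h t] obtain us1 us2 where
      "spans (map (\<lambda>u. u @ replicate (Suc m) (E 0)) us1 @ us2) w N"
      "\<forall>y z. word_gf us1 y z = PG y z (2 * m + 1)" "\<forall>y z. word_gf us2 y z = QG y z m" by blast
    then show "\<exists>us. spans us w N \<and> (\<forall>y z. word_gf us y z = QG y z (Suc m))"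
      by (intro exI conjI) (assumption, simp add: word_gf_map_append sum_list_replicate)
  qed
qed

end

section \<open>Modules given by generators and relations\<close>

locale complex_vector_space = vector_space scale
  for scale :: "complex \<Rightarrow> 'b::ab_group_add \<Rightarrow> 'b" (infixr \<open>*s\<close> 75)
begin

definition lift :: "('w \<Rightarrow> 'b) \<Rightarrow> ('w \<Rightarrow>\<^sub>0 complex) \<Rightarrow> 'b" where
  "lift g p = (\<Sum>w\<in>Poly_Mapping.keys p. Poly_Mapping.lookup p w *s g w)"

lemma lift_superset:
  "finite S \<Longrightarrow> Poly_Mapping.keys p \<subseteq> S \<Longrightarrow> lift g p = (\<Sum>w\<in>S. Poly_Mapping.lookup p w *s g w)"
  unfolding lift_def by (rule sum.mono_neutral_left) (auto simp: in_keys_iff)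

lemma lift_add: "lift g (p + q) = lift g p + lift g q"
proof -
  let ?S = "Poly_Mapping.keys p \<union> Poly_Mapping.keys q"
  have "lift g (p + q) = (\<Sum>w\<in>?S. Poly_Mapping.lookup (p + q) w *s g w)"
    by (rule lift_superset) (auto dest: subsetD[OF keys_add])
  moreover have "lift g p = (\<Sum>w\<in>?S. Poly_Mapping.lookup p w *s g w)"
    "lift g q = (\<Sum>w\<in>?S. Poly_Mapping.lookup q w *s g w)" by (rule lift_superset; auto)+
  ultimately show ?thesis
    by (simp add: lookup_add scale_left_distrib sum.distrib)
qed

lemma lift_single: "lift g (Poly_Mapping.single w c) = c *s g w"
  by (subst lift_superset[of "{w}"]) auto

lemma lift_zero: "lift g 0 = 0"
  by (simp add: lift_def)

text \<open>A basis of \<open>N\<close> is extended to the whole space and sent to zero. Used twice: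
  to realize the module by operators, and to turn independence modulo \<open>N\<close> into
  independence.\<close>

lemma projection_exists:
  assumes "subspace N"
  shows "\<exists>\<pi>. (\<forall>u v. \<pi> (u + v) = \<pi> u + \<pi> v) \<and> (\<forall>c v. \<pi> (c *s v) = c *s \<pi> v) \<and>
     (\<forall>v. \<pi> v - v \<in> N) \<and> (\<forall>v\<in>N. \<pi> v = 0)"
proof -
  interpret vector_space_pair scale scale ..
  obtain B where B: "B \<subseteq> N" "independent B" "N \<subseteq> span B"
    using maximal_independent_subset by blast
  let ?C = "extend_basis B"
  have C: "B \<subseteq> ?C" "independent ?C" "span ?C = UNIV"
    using B extend_basis_superset independent_extend_basis span_extend_basis by auto
  obtain \<pi> where lin: "Vector_Spaces.linear scale scale \<pi>"
    and \<pi>: "\<forall>x\<in>?C. \<pi> x = (if x \<in> B then 0 else x)"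
    using linear_independent_extend[OF C(2), of "\<lambda>x. if x \<in> B then 0 else x"] by blast
  interpret L: Vector_Spaces.linear scale scale \<pi> by (rule lin)
  have "\<pi> v - v \<in> N" for v
  proof -
    have "v \<in> span ?C" using C by simp
    then show ?thesis
    proof (induction rule: span_induct_alt)
      case base
      then show ?case using assms by (simp add: L.zero subspace_0)
    next
      case (step c x y)
      have "\<pi> x - x \<in> N"
        using \<pi> step(1) B(1) assms by (auto simp: subspace_0 subspace_neg)
      then have "c *s (\<pi> x - x) + (\<pi> y - y) \<in> N"
        using step assms by (intro subspace_add subspace_scale)
      then show ?case by (simp add: L.add L.scale algebra_simps)
    qed
  qed
  moreover have "\<pi> v = 0" if "v \<in> N" for v
  proof -
    have "v \<in> span B" using B that by auto
    then show ?thesis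
      using \<pi> C by (induction rule: span_induct_alt) (auto simp: L.zero L.add L.scale)
  qed
  ultimately show ?thesis using L.add L.scale by blast
qed

end

interpretation fac: complex_vector_space "fa_scale :: complex \<Rightarrow> 'a free_algebra \<Rightarrow> 'a free_algebra"
  by unfold_locales

section \<open>Words and spans in the free algebra\<close>

abbreviation mon :: "'a list \<Rightarrow> 'a free_algebra" where
  "mon u \<equiv> Poly_Mapping.single (Word u) 1"

lemma mon_mult: "mon u * mon v = mon (u @ v)"
  by (simp add: mult_single plus_free_monoid_def)

lemma mon_Nil: "mon [] = 1"
  by (metis single_one zero_free_monoid_def)

lemma fa_scale_single: "fa_scale c (Poly_Mapping.single w d) = Poly_Mapping.single w (c * d)"
  by (simp add: fa_scale_def mult_single)

lemma mon_in_monomials: "set u \<subseteq> L \<Longrightarrow> mon u \<in> monomials L"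
  by (auto simp: monomials_def)

lemma mon_mult_monomials: "set u \<subseteq> L \<Longrightarrow> m \<in> monomials L \<Longrightarrow> mon u * m \<in> monomials L"
  unfolding monomials_def mem_Collect_eq
proof (elim exE conjE)
  fix v assume "set u \<subseteq> L" "m = mon v" "set v \<subseteq> L"
  then show "\<exists>w. mon u * m = mon w \<and> set w \<subseteq> L"
    by (intro exI[of _ "u @ v"]) (simp add: mon_mult)
qed

lemma span_monomials_UNIV: "p \<in> fa.span (monomials UNIV)"
proof -
  have "p = fac.lift (\<lambda>w. mon (letters w)) p"
    by (rule poly_mapping_eqI)
       (simp add: fac.lift_def lookup_sum lookup_single in_keys_iff when_def fa_scale_single)
  also have "\<dots> \<in> fa.span (monomials UNIV)"
    unfolding fac.lift_def by (intro fa.span_sum fa.span_scale fa.span_base mon_in_monomials) auto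
  finally show ?thesis .
qed

lemma free_algebra_induct [case_names zero add]:
  assumes "P 0" "\<And>c u p. P p \<Longrightarrow> P (fa_scale c (mon u) + p)"
  shows "P p"
  using span_monomials_UNIV[of p]
  by (induction rule: fa.span_induct_alt) (auto simp: monomials_def assms)

lemma (in complex_vector_space) lift_scale: "lift g (fa_scale c p) = c *s lift g p"
proof (induction p rule: free_algebra_induct)
  case zero
  then show ?case by (simp add: lift_zero)
next
  case (add d u p)
  then show ?case
    by (simp add: fa.scale_right_distrib scale_right_distrib lift_add lift_single fa_scale_single)
qed

lemma fa_scale_mult_left: "fa_scale c p * q = fa_scale c (p * q)"
  by (simp add: fa_scale_def mult.assoc)

lemma fa_scale_mult_right: "p * fa_scale c q = fa_scale c (p * q)"
proof -
  have "p * Poly_Mapping.single 0 c = Poly_Mapping.single 0 c * p"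
  proof (induction p rule: free_algebra_induct)
    case (add d u p)
    then show ?case by (simp add: distrib_left distrib_right fa_scale_def mult_single mult.commute)
  qed simp
  then show ?thesis by (simp add: fa_scale_def flip: mult.assoc)
qed

lemma gen_power: "gen y i ^ k = mon (replicate k (y, i))"
  by (induction k) (simp_all add: mon_Nil mon_mult)

fun osp_coeff :: "osp \<Rightarrow> osp \<Rightarrow> complex" where
  "osp_coeff osp_e osp_f = 1" | "osp_coeff osp_f osp_e = - 1"
| "osp_coeff osp_h osp_e = 2" | "osp_coeff osp_e osp_h = - 2"
| "osp_coeff osp_h osp_f = - 2" | "osp_coeff osp_f osp_h = 2"
| "osp_coeff osp_h osp_gp = 1" | "osp_coeff osp_gp osp_h = - 1"
| "osp_coeff osp_h osp_gm = - 1" | "osp_coeff osp_gm osp_h = 1"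
| "osp_coeff osp_gp osp_gm = 1" | "osp_coeff osp_gm osp_gp = 1"
| "osp_coeff osp_gp osp_gp = 2" | "osp_coeff osp_gm osp_gm = - 2"
| "osp_coeff osp_f osp_gp = - 1" | "osp_coeff osp_gp osp_f = 1"
| "osp_coeff osp_e osp_gm = - 1" | "osp_coeff osp_gm osp_e = 1"
| "osp_coeff _ _ = 0"

text \<open>Each bracket of basis elements is a multiple of a single basis element; where
  \<open>osp_coeff\<close> vanishes the letter is arbitrary.\<close>

fun osp_letter :: "osp \<Rightarrow> osp \<Rightarrow> osp" where
  "osp_letter osp_e osp_f = osp_h" | "osp_letter osp_f osp_e = osp_h"
| "osp_letter osp_h y = y" | "osp_letter y osp_h = y"
| "osp_letter osp_gp osp_gm = osp_h" | "osp_letter osp_gm osp_gp = osp_h"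
| "osp_letter osp_gp osp_gp = osp_e" | "osp_letter osp_gm osp_gm = osp_f"
| "osp_letter osp_f osp_gp = osp_gm" | "osp_letter osp_gp osp_f = osp_gm"
| "osp_letter osp_e osp_gm = osp_gp" | "osp_letter osp_gm osp_e = osp_gp"
| "osp_letter x y = x"

lemma osp_bracket_single:
  "osp_bracket x y = Poly_Mapping.single (osp_letter x y) (osp_coeff x y)"
  by (cases x; cases y) simp_all

lemma lie_relator_eq:
  "lie_relator (a, i) (b, j) = gen a i * gen b j
     - fa_scale ((- 1) ^ (osp_parity a * osp_parity b)) (gen b j * gen a i)
     - fa_scale (osp_coeff a b) (gen (osp_letter a b) (i + j))"
proof -
  have "(- 1) ^ n * p = fa_scale ((- 1) ^ n) p" for n and p :: "current_letter free_algebra"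
    by (cases "even n") (simp_all add: fa.scale_minus_left)
  moreover have "(\<Sum>c\<in>Poly_Mapping.keys (osp_bracket a b).
      fa_scale (Poly_Mapping.lookup (osp_bracket a b) c) (gen c (i + j))) =
    fa_scale (osp_coeff a b) (gen (osp_letter a b) (i + j))"
    by (simp add: osp_bracket_single)
  ultimately show ?thesis by (simp add: lie_relator_def)
qed

definition restr :: "'a set \<Rightarrow> 'a free_algebra \<Rightarrow> 'a free_algebra" where
  "restr L = fac.lift (\<lambda>w. if set (letters w) \<subseteq> L then mon (letters w) else 0)"

lemma restr_mono: "restr L (mon u) = (if set u \<subseteq> L then mon u else 0)"
  by (simp add: restr_def fac.lift_single)

lemma restr_add: "restr L (p + q) = restr L p + restr L q"
  and restr_scale: "restr L (fa_scale c p) = fa_scale c (restr L p)"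
  and restr_zero: "restr L 0 = 0"
  by (simp_all add: restr_def fac.lift_add fac.lift_scale fac.lift_zero)

lemma restr_diff: "restr L (p - q) = restr L p - restr L q"
  using restr_add[of L "p - q" q] by simp

lemma restr_in_span: "restr L p \<in> fa.span (monomials L)"
proof (induction p rule: free_algebra_induct)
  case zero
  then show ?case by (simp add: restr_zero fa.span_zero)
next
  case (add c u p)
  have "restr L (mon u) \<in> fa.span (monomials L)"
    by (auto simp: restr_mono fa.span_zero monomials_def intro!: fa.span_base)
  then show ?case using add by (simp add: restr_add restr_scale fa.span_add fa.span_scale)
qed

lemma restr_id: "p \<in> fa.span (monomials L) \<Longrightarrow> restr L p = p"
  by (induction rule: fa.span_induct_alt)
     (auto simp: restr_zero restr_add restr_scale restr_mono monomials_def)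

lemma restr_mono_mult:
  assumes "set u \<subseteq> L"
  shows "restr L (mon u * p) = mon u * restr L p"
proof (induction p rule: free_algebra_induct)
  case (add c v p)
  then show ?case using assms
    by (simp add: distrib_left restr_add fa_scale_mult_right restr_scale mon_mult restr_mono)
qed (simp add: restr_zero)

lemma fa_span_mult_left:
  assumes "p \<in> fa.span S" "\<And>s. s \<in> S \<Longrightarrow> a * s \<in> fa.span T"
  shows "a * p \<in> fa.span T"
  using assms(1)
  by (induction rule: fa.span_induct_alt)
     (auto simp: distrib_left fa_scale_mult_right fa.span_zero intro: fa.span_add fa.span_scale assms(2))

lemma fa_span_mult_right:
  assumes "p \<in> fa.span S" "\<And>s. s \<in> S \<Longrightarrow> s * a \<in> fa.span T"
  shows "p * a \<in> fa.span T"
  using assms(1)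
  by (induction rule: fa.span_induct_alt)
     (auto simp: distrib_right fa_scale_mult_left fa.span_zero intro: fa.span_add fa.span_scale assms(2))

lemma mono_in_span: "set u \<subseteq> L \<Longrightarrow> mon u \<in> fa.span (monomials L)"
  by (auto simp: monomials_def intro!: fa.span_base)

abbreviation ideal_generators ::
    "current_letter set \<Rightarrow> current_letter free_algebra set \<Rightarrow> current_letter free_algebra set" where
  "ideal_generators L R \<equiv>
     {u * lie_relator x y * v | u x y v. u \<in> monomials L \<and> v \<in> monomials L \<and> x \<in> L \<and> y \<in> L}
     \<union> {u * r | u r. u \<in> monomials L \<and> r \<in> R}"

lemma relation_ideal_mult:
  assumes "set u \<subseteq> L" "p \<in> relation_ideal L R"
  shows "mon u * p \<in> relation_ideal L R"
proof -
  have u: "mon u * m \<in> monomials L" if "m \<in> monomials L" for m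
    using that assms(1) by (rule mon_mult_monomials[rotated])
  show ?thesis
    using assms(2) unfolding relation_ideal_def
    by (rule fa_span_mult_left, intro fa.span_base) (use u in \<open>auto simp: mult.assoc[symmetric], blast+\<close>)
qed

lemma relation_ideal_relator:
  assumes "x \<in> L" "y \<in> L" "p \<in> fa.span (monomials L)"
  shows "lie_relator x y * p \<in> relation_ideal L R"
  using assms(3) unfolding relation_ideal_def
proof (rule fa_span_mult_left)
  fix v assume "v \<in> monomials L"
  moreover have "1 \<in> monomials L" using mon_Nil by (auto simp: monomials_def intro!: exI[of _ "[]"])
  ultimately have "1 * lie_relator x y * v \<in>
      {u * lie_relator x y * v |u x y v. u \<in> monomials L \<and> v \<in> monomials L \<and> x \<in> L \<and> y \<in> L}"
    using assms(1,2) by blast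
  then show "lie_relator x y * v \<in> fa.span (ideal_generators L R)"
    by (intro fa.span_base UnI1) simp
qed

lemma relation_ideal_relation:
  assumes "r \<in> R" "p \<in> fa.span (monomials L)"
  shows "p * r \<in> relation_ideal L R"
  using assms(2) unfolding relation_ideal_def
  by (rule fa_span_mult_right, intro fa.span_base) (use assms(1) in blast)

lemma subspace_relation_ideal: "fa.subspace (relation_ideal L R)"
  by (simp add: relation_ideal_def)

section \<open>The cyclic module as a space of operators\<close>

locale cyclic_module =
  fixes L :: "current_letter set" and R :: "current_letter free_algebra set"
  assumes L_closed: "(a, i) \<in> L \<Longrightarrow> (b, j) \<in> L \<Longrightarrow> osp_coeff a b \<noteq> 0 \<Longrightarrow> (osp_letter a b, i + j) \<in> L"
    and R_subset: "R \<subseteq> fa.span (monomials L)"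
begin

abbreviation "N \<equiv> relation_ideal L R"

text \<open>\<open>N1\<close> extends \<open>N\<close> by the words with a letter outside \<open>L\<close>, so that it can be divided out of the
  whole free algebra.\<close>

definition N1 :: "current_letter free_algebra set" where
  "N1 = {p. restr L p \<in> N}"

lemma subspace_N1: "fa.subspace N1"
  using subspace_relation_ideal[of L R]
  by (auto simp: N1_def fa.subspace_def restr_zero restr_add restr_scale)

lemma N1_mult: "set u \<subseteq> L \<Longrightarrow> p \<in> N1 \<Longrightarrow> mon u * p \<in> N1"
  by (simp add: N1_def restr_mono_mult relation_ideal_mult)

lemma relator_mult_in_span:
  assumes "x \<in> L" "y \<in> L" "p \<in> fa.span (monomials L)"
  shows "lie_relator x y * p \<in> fa.span (monomials L)"
proof -
  obtain a i b j where xy: "x = (a, i)" "y = (b, j)" by (cases x; cases y)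
  have m: "mon u * p \<in> fa.span (monomials L)" if "set u \<subseteq> L" for u
    using assms(3) by (rule fa_span_mult_left) (use that in \<open>auto intro!: fa.span_base mon_mult_monomials\<close>)
  have "fa_scale (osp_coeff a b) (gen (osp_letter a b) (i + j) * p) \<in> fa.span (monomials L)"
    using L_closed[of a i b j] assms(1,2) m[of "[(osp_letter a b, i + j)]"] xy
    by (cases "osp_coeff a b = 0") (auto simp: fa.span_zero intro: fa.span_scale)
  then show ?thesis
    using m[of "[(a, i), (b, j)]"] m[of "[(b, j), (a, i)]"] assms(1,2) xy
    by (simp add: lie_relator_eq left_diff_distrib fa_scale_mult_left mon_mult fa.span_diff fa.span_scale)
qed

lemma N_subset: "N \<subseteq> fa.span (monomials L)"
  unfolding relation_ideal_def
proof (rule fa.span_minimal)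
  show "ideal_generators L R \<subseteq> fa.span (monomials L)"
  proof
    fix p assume "p \<in> ideal_generators L R"
    then have "\<exists>m p'. p = m * p' \<and> m \<in> monomials L \<and> p' \<in> fa.span (monomials L)"
    proof
      assume "p \<in> {u * r |u r. u \<in> monomials L \<and> r \<in> R}"
      then show ?thesis using R_subset by blast
    next
      assume "p \<in> {u * lie_relator x y * v |u x y v. u \<in> monomials L \<and> v \<in> monomials L \<and> x \<in> L \<and> y \<in> L}"
      then obtain u x y v where "p = u * (lie_relator x y * v)" "u \<in> monomials L" "v \<in> monomials L"
        "x \<in> L" "y \<in> L" by (auto simp: mult.assoc)
      then show ?thesis using relator_mult_in_span[of x y v] fa.span_base by blast
    qed
    then obtain u p' where p: "p = mon u * p'" "set u \<subseteq> L" "p' \<in> fa.span (monomials L)"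
      by (auto simp: monomials_def)
    show "p \<in> fa.span (monomials L)" unfolding p(1)
      using p(3) by (rule fa_span_mult_left) (use p(2) in \<open>auto intro!: fa.span_base mon_mult_monomials\<close>)
  qed
qed simp

lemma N_subset_N1: "N \<subseteq> N1"
  using N_subset by (auto simp: N1_def restr_id)

text \<open>Instead of a quotient type, the module is realized by the projection along \<open>N1\<close> onto a
  complement, so that the super-commutation relations hold as identities of operators.\<close>

definition pr :: "current_letter free_algebra \<Rightarrow> current_letter free_algebra" where
  "pr = (SOME \<pi>. (\<forall>u v. \<pi> (u + v) = \<pi> u + \<pi> v) \<and> (\<forall>c v. \<pi> (fa_scale c v) = fa_scale c (\<pi> v)) \<and>
     (\<forall>v. \<pi> v - v \<in> N1) \<and> (\<forall>v\<in>N1. \<pi> v = 0))"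

lemma pr: "pr (u + v) = pr u + pr v" "pr (fa_scale c v) = fa_scale c (pr v)" "pr v - v \<in> N1"
    "v \<in> N1 \<Longrightarrow> pr v = 0"
  using someI_ex[OF fac.projection_exists[OF subspace_N1]] unfolding pr_def[symmetric] by blast+

lemma pr_diff: "pr (u - v) = pr u - pr v"
  using pr(1)[of "u - v" v] by simp

lemma pr_eq: "u - v \<in> N1 \<Longrightarrow> pr u = pr v"
  using pr(4)[of "u - v"] by (simp add: pr_diff)

definition act :: "current_letter \<Rightarrow> current_letter free_algebra \<Rightarrow> current_letter free_algebra" where
  "act x v = pr (mon [x] * v)"

lemma act_act_eq:
  assumes "x \<in> L" "y \<in> L"
  shows "act x (act y v) = pr (mon [x, y] * v)"
proof -
  have "mon [x] * (pr (mon [y] * v) - mon [y] * v) \<in> N1"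
    using assms by (intro N1_mult pr) auto
  then show ?thesis
    unfolding act_def by (intro pr_eq) (simp add: right_diff_distrib mon_mult flip: mult.assoc)
qed

sublocale full: super_action fa_scale L act "\<lambda>x. osp_parity (fst x)"
    "\<lambda>x y. osp_coeff (fst x) (fst y)" "\<lambda>x y. (osp_letter (fst x) (fst y), snd x + snd y)"
proof unfold_locales
  show "act x (u + v) = act x u + act x v" for x u v
    by (simp add: act_def distrib_left pr)
  show "act x (fa_scale c v) = fa_scale c (act x v)" for x c v
    by (simp add: act_def fa_scale_mult_right pr)
  show "(osp_letter (fst x) (fst y), snd x + snd y) \<in> L"
    if "x \<in> L" "y \<in> L" "osp_coeff (fst x) (fst y) \<noteq> 0" for x y
    using that L_closed by (cases x; cases y) auto
  fix x y v assume xy: "x \<in> L" "y \<in> L"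
  obtain a i b j where ab: "x = (a, i)" "y = (b, j)" by (cases x; cases y)
  have "lie_relator x y * v \<in> N1"
  proof -
    have v: "restr L v \<in> fa.span (monomials L)" by (rule restr_in_span)
    have "restr L (lie_relator x y * v) = lie_relator x y * restr L v"
    \<comment> \<open>If the coefficient vanishes, the bracket letter is arbitrary and may lie
      outside \<open>L\<close>, so closure is available only in the other case.\<close>
    proof (cases "osp_coeff a b = 0")
      case True
      then show ?thesis
        using restr_mono_mult[of "[x, y]" L v] restr_mono_mult[of "[y, x]" L v] xy ab
        by (simp add: lie_relator_eq left_diff_distrib fa_scale_mult_left restr_diff restr_scale mon_mult)
    next
      case False
      then show ?thesis
        using restr_mono_mult[of "[x, y]" L v] restr_mono_mult[of "[y, x]" L v]
          restr_mono_mult[of "[(osp_letter a b, i + j)]" L v] L_closed xy ab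
        by (simp add: lie_relator_eq left_diff_distrib fa_scale_mult_left restr_diff restr_scale mon_mult)
    qed
    then show ?thesis using relation_ideal_relator[OF xy v] by (simp add: N1_def)
  qed
  then have "pr (lie_relator x y * v) = 0" by (rule pr)
  then show "act x (act y v) = fa_scale ((- 1) ^ (osp_parity (fst x) * osp_parity (fst y))) (act y (act x v))
      + fa_scale (osp_coeff (fst x) (fst y)) (act (osp_letter (fst x) (fst y), snd x + snd y) v)"
    unfolding act_act_eq[OF xy] act_act_eq[OF xy(2,1)] unfolding act_def ab
    by (simp add: lie_relator_eq left_diff_distrib fa_scale_mult_left pr pr_diff mon_mult algebra_simps)
qed

lemma submodule_N1: "full.submodule N1"
  using subspace_N1 by (auto simp: full.submodule_def act_def pr N1_mult fa.subspace_0)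

text \<open>Each operator projects after multiplying, which changes the result by an element of
  \<open>N1\<close>, and later letters preserve \<open>N1\<close>. So operators and multiplication
  by words agree modulo \<open>N1\<close>.\<close>

lemma wact_mono:
  assumes "set u \<subseteq> L" "w - p \<in> N1"
  shows "full.wact u w - mon u * p \<in> N1"
  using assms(1)
proof (induction u)
  case Nil
  then show ?case using assms(2) by (simp add: mon_Nil)
next
  case (Cons x u)
  then have x: "set [x] \<subseteq> L" by simp
  have "(act x (full.wact u w) - mon [x] * full.wact u w) + mon [x] * (full.wact u w - mon u * p) \<in> N1"
    using Cons N1_mult[OF x] by (intro fa.subspace_add[OF subspace_N1] pr(3)[of "mon [x] * full.wact u w", folded act_def]) auto
  then show ?case by (simp add: right_diff_distrib mon_mult flip: mult.assoc)
qed

lemma span_N1_cong: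
  assumes "p \<in> fa.span (S \<union> N1)" "\<And>s. s \<in> S \<Longrightarrow> \<exists>c t. t \<in> T \<and> s - fa_scale c t \<in> N1"
  shows "p \<in> fa.span (T \<union> N1)"
proof -
  have "S \<union> N1 \<subseteq> fa.span (T \<union> N1)"
  proof
    fix s assume "s \<in> S \<union> N1"
    then consider "s \<in> N1" | c t where "t \<in> T" "s - fa_scale c t \<in> N1" using assms(2) by blast
    then show "s \<in> fa.span (T \<union> N1)"
    proof cases
      case 1
      then show ?thesis by (auto intro: fa.span_base)
    next
      case 2
      then have "(s - fa_scale c t) + fa_scale c t \<in> fa.span (T \<union> N1)"
        by (intro fa.span_add fa.span_scale) (auto intro: fa.span_base)
      then show ?thesis by simp
    qed
  qed
  then have "fa.span (S \<union> N1) \<subseteq> fa.span (T \<union> N1)" by (intro fa.span_minimal) simp_all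
  then show ?thesis using assms(1) by auto
qed

text \<open>Returns from \<open>N1\<close> to the relation ideal: \<open>restr L\<close> fixes the
  words over \<open>L\<close> and maps \<open>N1\<close> into \<open>N\<close>.\<close>

lemma span_N1_restr:
  assumes "p \<in> fa.span (T \<union> N1)" "T \<subseteq> fa.span (monomials L)" "p \<in> fa.span (monomials L)"
  shows "p \<in> fa.span (T \<union> N)"
proof -
  have "restr L p \<in> fa.span (T \<union> N)"
    using assms(1)
  proof (induction rule: fa.span_induct_alt)
    case base
    then show ?case by (simp add: restr_zero fa.span_zero)
  next
    case (step c s q)
    then have "restr L s \<in> fa.span (T \<union> N)"
      using assms(2) by (auto simp: N1_def restr_id subset_eq intro: fa.span_base)
    then show ?case using step by (simp add: restr_add restr_scale fa.span_add fa.span_scale)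
  qed
  then show ?thesis using assms(3) by (simp add: restr_id)
qed

end

text \<open>The scalars \<open>c\<close> absorb the signs by which the structure constants of the
  chosen letters differ from the Iwahori normalization.\<close>

lemma (in super_action) iwahori_transport:
  fixes tr :: "iw \<Rightarrow> 'l" and c :: "iw \<Rightarrow> complex"
  assumes L: "\<And>x. tr x \<in> L" and par: "\<And>x. par (tr x) = iw_par x" and c: "\<And>x. c x \<noteq> 0"
    and bc: "\<And>x y. c x * c y * bc (tr x) (tr y) = iw_coeff x y * c (iw_letter x y)"
    and bz: "\<And>x y. iw_coeff x y \<noteq> 0 \<Longrightarrow> bz (tr x) (tr y) = tr (iw_letter x y)"
  shows "iwahori_action scale (\<lambda>x v. c x *s act (tr x) v)"
proof unfold_locales
  fix x y v
  have "(c x * c y) *s act (tr x) (act (tr y) v) =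
      (c x * c y) *s ((- 1) ^ (iw_par x * iw_par y) *s act (tr y) (act (tr x) v))
      + (c x * c y * bc (tr x) (tr y)) *s act (bz (tr x) (tr y)) v"
    using act_act[OF L L, of x y v] by (simp add: par scale_right_distrib)
  also have "(c x * c y * bc (tr x) (tr y)) *s act (bz (tr x) (tr y)) v =
      (iw_coeff x y * c (iw_letter x y)) *s act (tr (iw_letter x y)) v"
    using bc[of x y] bz[of x y] by (cases "iw_coeff x y = 0") simp_all
  finally show "c x *s act (tr x) (c y *s act (tr y) v) =
      (- 1) ^ (iw_par x * iw_par y) *s c y *s act (tr y) (c x *s act (tr x) v)
      + iw_coeff x y *s c (iw_letter x y) *s act (tr (iw_letter x y)) v"
    using L by (simp add: act_scale mult_ac)
qed (use L in \<open>simp_all add: act_add act_scale scale_right_distrib mult.commute\<close>)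

fun osp_weight :: "osp \<Rightarrow> int" where
  "osp_weight osp_e = 2" | "osp_weight osp_f = - 2" | "osp_weight osp_h = 0"
| "osp_weight osp_gp = 1" | "osp_weight osp_gm = - 1"

definition word_degree :: "current_letter list \<Rightarrow> nat" where
  "word_degree u = sum_list (map snd u)"

definition word_weight :: "current_letter list \<Rightarrow> int" where
  "word_weight u = (\<Sum>(y, i)\<leftarrow>u. osp_weight y)"

definition weight_gf :: "current_letter list list \<Rightarrow> complex \<Rightarrow> complex \<Rightarrow> complex" where
  "weight_gf us x q = (\<Sum>u\<leftarrow>us. q ^ word_degree u * x powi word_weight u)"

text \<open>Besides the embedding \<open>tr\<close>, it is required that all letters with e or g^+
  lie in the Iwahori subalgebra and that the other ones kill the generator or scale it. Hence the
  generator is cyclic already over the Iwahori subalgebra.\<close>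

locale iwahori_module = cyclic_module +
  fixes tr :: "iw \<Rightarrow> current_letter" and c :: "iw \<Rightarrow> complex" and k :: nat
  assumes tr_L: "tr x \<in> L" and tr_par: "osp_parity (fst (tr x)) = iw_par x" and c_nonzero: "c x \<noteq> 0"
    and tr_coeff: "c x * c y * osp_coeff (fst (tr x)) (fst (tr y)) = iw_coeff x y * c (iw_letter x y)"
    and tr_letter: "iw_coeff x y \<noteq> 0 \<Longrightarrow>
      (osp_letter (fst (tr x)) (fst (tr y)), snd (tr x) + snd (tr y)) = tr (iw_letter x y)"
    and raising: "(a, i) \<in> L \<Longrightarrow> a \<in> {osp_e, osp_gp} \<Longrightarrow> (a, i) \<in> range tr"
    and lowering: "(a, i) \<in> L \<Longrightarrow> a \<in> {osp_f, osp_gm} \<or> a = osp_h \<and> i \<ge> 1 \<Longrightarrow> gen a i \<in> R"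
    and weight_relation: "gen osp_h 0 + of_nat k \<in> R"
    and e_power_relation: "gen osp_e 0 ^ (k + 1) \<in> R"
begin

definition iact :: "iw \<Rightarrow> current_letter free_algebra \<Rightarrow> current_letter free_algebra" where
  "iact x v = fa_scale (c x) (act (tr x) v)"

sublocale iw: iwahori_action fa_scale iact
proof -
  have "iwahori_action fa_scale (\<lambda>x v. fa_scale (c x) (act (tr x) v))"
    by (rule full.iwahori_transport) (use tr_L tr_par c_nonzero tr_coeff tr_letter in auto)
  then show "iwahori_action fa_scale iact" by (simp add: iact_def[abs_def])
qed

lemma iw_wact: "\<exists>d. d \<noteq> 0 \<and> (\<forall>v. iw.wact u v = fa_scale d (full.wact (map tr u) v))"
proof (induction u)
  case Nil
  then show ?case by (auto intro: exI[of _ 1])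
next
  case (Cons x u)
  then obtain d where d: "d \<noteq> 0" "\<And>v. iw.wact u v = fa_scale d (full.wact (map tr u) v)" by blast
  have "iw.wact (x # u) v = fa_scale (c x * d) (full.wact (map tr (x # u)) v)" for v
  proof -
    have "iw.wact (x # u) v = iact x (iw.wact u v)" by simp
    then show ?thesis unfolding d(2) using tr_L[of x] by (simp add: iact_def full.act_scale)
  qed
  then show ?case using c_nonzero[of x] d(1) by (intro exI[of _ "c x * d"]) simp
qed

lemma set_map_tr: "set (map tr u) \<subseteq> L"
  using tr_L by auto

lemma iw_wact_mon:
  assumes "w - fa_scale e (mon r) \<in> N1" "e \<noteq> 0"
  shows "\<exists>d. d \<noteq> 0 \<and> iw.wact u w - fa_scale d (mon (map tr u @ r)) \<in> N1"
proof -
  obtain d where d: "d \<noteq> 0" "\<And>v. iw.wact u v = fa_scale d (full.wact (map tr u) v)"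
    using iw_wact by blast
  have "fa_scale d (full.wact (map tr u) w - mon (map tr u) * fa_scale e (mon r)) \<in> N1"
    by (intro fa.subspace_scale[OF subspace_N1] wact_mono set_map_tr assms)
  then show ?thesis using d assms(2)
    by (intro exI[of _ "d * e"]) (simp add: fa.scale_right_diff_distrib fa_scale_mult_right mon_mult)
qed

lemma submodule_iw: "full.submodule M \<Longrightarrow> iw.submodule M"
  using tr_L by (auto simp: full.submodule_def iw.submodule_def iact_def intro: fa.subspace_scale)

lemma mon_in_span:
  assumes p: "p \<in> fa.span (S \<union> N1)" "p - fa_scale d (mon s) \<in> N1" "d \<noteq> 0" "set s \<subseteq> L"
    and S: "\<And>s'. s' \<in> S \<Longrightarrow> \<exists>d t. t \<in> T \<and> s' - fa_scale d (mon t) \<in> N1"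
    and T: "\<And>t. t \<in> T \<Longrightarrow> set t \<subseteq> L"
  shows "mon s \<in> fa.span (mon ` T \<union> N)"
proof -
  have "p - (p - fa_scale d (mon s)) \<in> fa.span (S \<union> N1)"
    by (rule fa.span_diff[OF p(1) fa.span_base]) (use p in simp)
  then have "fa_scale d (mon s) \<in> fa.span (S \<union> N1)" by simp
  from fa.span_scale[OF this, of "inverse d"] have "mon s \<in> fa.span (S \<union> N1)" using p(3) by simp
  then have "mon s \<in> fa.span (mon ` T \<union> N1)"
    by (rule span_N1_cong) (use S in blast)
  then show ?thesis
    by (rule span_N1_restr) (use T p(4) in \<open>auto intro!: fa.span_base mon_in_monomials\<close>)
qed

lemma spans_mon:
  assumes sp: "iw.spans us w N1" and w: "w - fa_scale e (mon r) \<in> N1" "e \<noteq> 0" and r: "set r \<subseteq> L" and u: "set u \<subseteq> range tr"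
  shows "mon (u @ r) \<in> fa.span (mon ` (\<lambda>u. map tr u @ r) ` set us \<union> N)"
proof -
  obtain u' where u': "u = map tr u'" using u by (metis ex_map_conv subset_iff rangeE)
  obtain d where d: "d \<noteq> 0" "iw.wact u' w - fa_scale d (mon (u @ r)) \<in> N1"
    using iw_wact_mon[OF w, of u'] u' by blast
  show ?thesis
  proof (rule mon_in_span)
    show "iw.wact u' w \<in> fa.span ((\<lambda>u. iw.wact u w) ` set us \<union> N1)"
      using sp by (simp add: iw.spans_def)
    show "iw.wact u' w - fa_scale d (mon (u @ r)) \<in> N1" "d \<noteq> 0" by fact+
    show "set (u @ r) \<subseteq> L" using r u' set_map_tr[of u'] by simp
    show "\<exists>d t. t \<in> (\<lambda>u. map tr u @ r) ` set us \<and> s' - fa_scale d (mon t) \<in> N1"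
      if "s' \<in> (\<lambda>u. iw.wact u w) ` set us" for s'
      using that iw_wact_mon[OF w] by blast
    show "set t \<subseteq> L" if "t \<in> (\<lambda>u. map tr u @ r) ` set us" for t
      using that r set_map_tr by fastforce
  qed
qed

lemma one_eq_mon: "1 - mon [] \<in> N1"
  using subspace_N1 by (simp add: mon_Nil fa.subspace_0)

lemma relation_N1: "r \<in> R \<Longrightarrow> r \<in> N1"
  using relation_ideal_relation[of r R 1 L] N_subset_N1 mon_in_monomials[of "[]" L]
  by (auto simp: mon_Nil fa.span_base)

lemma act_one: "x \<in> L \<Longrightarrow> act x 1 - mon [x] \<in> N1"
  unfolding act_def using pr(3)[of "mon [x]"] by simp

lemma act_one_zero:
  assumes "(y, i) \<in> L" "y \<in> {osp_f, osp_gm} \<or> y = osp_h \<and> i \<ge> 1"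
  shows "act (y, i) 1 = 0"
  unfolding act_def using lowering[OF assms] by (simp add: pr relation_N1)

lemma of_nat_eq_scale: "(of_nat m :: current_letter free_algebra) = fa_scale (of_nat m) 1"
  by (simp add: fa_scale_def)

lemma act_h_one: assumes "(osp_h, 0) \<in> L" shows "act (osp_h, 0) 1 - fa_scale (- of_nat k) 1 \<in> N1"
proof -
  have "(act (osp_h, 0) 1 - mon [(osp_h, 0)]) + (gen osp_h 0 + of_nat k) \<in> N1"
    by (intro fa.subspace_add[OF subspace_N1] act_one relation_N1 weight_relation assms)
  then show ?thesis by (simp add: of_nat_eq_scale fa.scale_minus_left)
qed

lemma raising_words_span:
  assumes "set u \<subseteq> L"
  shows "full.wact u 1 \<in> fa.span ({full.wact u' 1 | u'. set u' \<subseteq> range tr} \<union> N1)"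
proof -
  let ?P = "{x \<in> L. fst x \<in> {osp_e, osp_gp}}"
  have P: "?P \<subseteq> range tr" using raising by auto
  \<comment> \<open>The constant grading 0 switches off the degree bookkeeping of
    \<open>positive_words_span\<close>.\<close>
  have "full.wact u 1 \<in> fa.span ({full.wact u' 1 | u'. set u' \<subseteq> ?P \<and>
      sum_list (map (\<lambda>_. 0 :: nat) u') = sum_list (map (\<lambda>_. 0) u)} \<union> N1)"
  proof (rule full.positive_words_span[OF submodule_N1])
    fix x assume x: "x \<in> L" "x \<notin> ?P"
    show "act x 1 \<in> N1 \<or> (0 :: nat) = 0 \<and> (\<exists>c. act x 1 - fa_scale c 1 \<in> N1)"
    proof (cases "x = (osp_h, 0)")
      case True
      then show ?thesis using act_h_one x by blast
    next
      case False
      then have "act x 1 = 0"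
        using x act_one_zero[of "fst x" "snd x"] by (cases x; cases "fst x") auto
      then show ?thesis using subspace_N1 by (simp add: fa.subspace_0)
    qed
  qed (use assms in auto)
  then show ?thesis
    by (rule subsetD[OF fa.span_mono, rotated]) (use P in auto)
qed

lemma mon_span_all:
  assumes "\<And>u. set u \<subseteq> range tr \<Longrightarrow> mon u \<in> fa.span (mon ` T \<union> N)" "\<And>t. t \<in> T \<Longrightarrow> set t \<subseteq> L"
  shows "fa.span (monomials L) \<subseteq> fa.span (mon ` T \<union> N)"
proof (intro fa.span_minimal fa.subspace_span subsetI)
  fix p assume "p \<in> monomials L"
  then obtain u where u: "p = mon u" "set u \<subseteq> L" by (auto simp: monomials_def)
  have "mon u \<in> fa.span (mon ` {t. set t \<subseteq> range tr} \<union> N)"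
  proof (rule mon_in_span[OF raising_words_span[OF u(2)]])
    show "full.wact u 1 - fa_scale 1 (mon u) \<in> N1"
      using wact_mono[OF u(2) one_eq_mon] by (simp add: mon_mult)
    fix s' assume "s' \<in> {full.wact u' 1 |u'. set u' \<subseteq> range tr}"
    then obtain u' where "s' = full.wact u' 1" "set u' \<subseteq> range tr" by auto
    moreover have "set u' \<subseteq> L" using tr_L calculation by auto
    ultimately show "\<exists>d t. t \<in> {t. set t \<subseteq> range tr} \<and> s' - fa_scale d (mon t) \<in> N1"
      using wact_mono[OF _ one_eq_mon, of u'] by (intro exI[of _ 1] exI[of _ u']) (simp add: mon_mult)
  qed (use u tr_L in auto)
  also have "\<dots> \<subseteq> fa.span (mon ` T \<union> N)"
    using assms(1) by (intro fa.span_minimal) (auto intro: fa.span_base)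
  finally show "p \<in> fa.span (mon ` T \<union> N)" using u by simp
qed

end

text \<open>The simple root vectors are f t (even) and g^+ (odd); among all letters only f_0 and
  g^-_0 are missed.\<close>

fun untw_tr :: "iw \<Rightarrow> current_letter" where
  "untw_tr (E i) = (osp_f, i + 1)" | "untw_tr (G i) = (osp_gm, i + 1)" | "untw_tr (H i) = (osp_h, i)"
| "untw_tr (A i) = (osp_e, i)" | "untw_tr (B i) = (osp_gp, i)"

text \<open>Positive and negative root vectors trade places in \<open>untw_tr\<close>, which changes
  signs of structure constants; these factors restore them.\<close>

fun untw_c :: "iw \<Rightarrow> complex" where
  "untw_c (G i) = 1" | "untw_c _ = - 1"

text \<open>The simple root vectors are e (even) and g^- t (odd); among the twisted letters only f_0
  is missed.\<close>

fun tw_tr :: "iw \<Rightarrow> current_letter" where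
  "tw_tr (E i) = (osp_e, 2 * i)" | "tw_tr (G i) = (osp_gp, 2 * i + 1)" | "tw_tr (H i) = (osp_h, 2 * i)"
| "tw_tr (A i) = (osp_f, 2 * i + 2)" | "tw_tr (B i) = (osp_gm, 2 * i + 1)"

lemma gen_in_span: "(y, i) \<in> L \<Longrightarrow> gen y i \<in> fa.span (monomials L)"
  by (intro fa.span_base mon_in_monomials) simp

lemma of_nat_in_span: "(of_nat m :: current_letter free_algebra) \<in> fa.span (monomials L)"
proof -
  have "(of_nat m :: current_letter free_algebra) = fa_scale (of_nat m) (mon [])"
    by (simp add: fa_scale_def mon_Nil)
  also have "\<dots> \<in> fa.span (monomials L)"
    by (intro fa.span_scale fa.span_base mon_in_monomials) simp
  finally show ?thesis .
qed

lemma gen_power_in_span: "(y, i) \<in> L \<Longrightarrow> gen y i ^ m \<in> fa.span (monomials L)"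
  unfolding gen_power by (intro fa.span_base mon_in_monomials) auto

lemma cyclic_module_untwisted: "cyclic_module UNIV (weyl_relations k)"
  using span_monomials_UNIV by unfold_locales auto

lemma iwahori_module_untwisted: "iwahori_module UNIV (weyl_relations k) untw_tr untw_c k"
proof -
  interpret cyclic_module UNIV "weyl_relations k" by (rule cyclic_module_untwisted)
  show ?thesis
  proof unfold_locales
    fix y i assume "y \<in> {osp_e, osp_gp}"
    then show "(y, i) \<in> range untw_tr"
      using rangeI[of untw_tr "A i"] rangeI[of untw_tr "B i"] by auto
  next
    fix y i assume "y \<in> {osp_f, osp_gm} \<or> y = osp_h \<and> 1 \<le> (i :: nat)"
    then show "gen y i \<in> weyl_relations k"
      by (cases i) (auto simp: weyl_relations_def)
  next
    fix x y show "untw_c x * untw_c y * osp_coeff (fst (untw_tr x)) (fst (untw_tr y)) = iw_coeff x y * untw_c (iw_letter x y)"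
      by (cases x; cases y; simp)
    show "iw_coeff x y \<noteq> 0 \<Longrightarrow>
        (osp_letter (fst (untw_tr x)) (fst (untw_tr y)), snd (untw_tr x) + snd (untw_tr y)) = untw_tr (iw_letter x y)"
      by (cases x; cases y; simp)
    show "osp_parity (fst (untw_tr x)) = iw_par x" "untw_c x \<noteq> 0"
      by (cases x; simp)+
  qed (auto simp: weyl_relations_def)
qed

lemma osp_parity_letter: "osp_coeff x y \<noteq> 0 \<Longrightarrow>
    even (osp_parity (osp_letter x y)) = even (osp_parity x + osp_parity y)"
  by (cases x; cases y; simp)

lemma osp_parity_eq_0: "osp_parity x = 0 \<longleftrightarrow> even (osp_parity x)"
  by (cases x) auto

lemma cyclic_module_twisted: "cyclic_module twisted_letters (twisted_weyl_relations k)"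
proof
  fix a b i j assume "(a, i) \<in> twisted_letters" "(b, j) \<in> twisted_letters" "osp_coeff a b \<noteq> 0"
  then show "(osp_letter a b, i + j) \<in> twisted_letters"
    using osp_parity_letter[of a b] by (auto simp: twisted_letters_def osp_parity_eq_0)
next
  show "twisted_weyl_relations k \<subseteq> fa.span (monomials twisted_letters)"
  proof -
    have "gen osp_f (2 * i) \<in> fa.span (monomials twisted_letters)"
      "gen osp_gm (2 * i + 1) \<in> fa.span (monomials twisted_letters)"
      "gen osp_h (2 * i + 2) \<in> fa.span (monomials twisted_letters)" for i
      by (intro gen_in_span; simp add: twisted_letters_def)+
    moreover have "gen osp_e 0 ^ (k + 1) \<in> fa.span (monomials twisted_letters)"
      by (intro gen_power_in_span) (simp add: twisted_letters_def)
    moreover have "gen osp_h 0 + of_nat k \<in> fa.span (monomials twisted_letters)"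
      by (intro fa.span_add gen_in_span of_nat_in_span) (simp add: twisted_letters_def)
    ultimately show ?thesis
      unfolding twisted_weyl_relations_def by blast
  qed
qed

lemma iwahori_module_twisted: "iwahori_module twisted_letters (twisted_weyl_relations k) tw_tr (\<lambda>_. 1) k"
proof -
  interpret cyclic_module twisted_letters "twisted_weyl_relations k" by (rule cyclic_module_twisted)
  show ?thesis
  proof unfold_locales
    fix y i assume yi: "(y, i) \<in> twisted_letters" "y \<in> {osp_e, osp_gp}"
    obtain j where "i = 2 * j \<or> i = 2 * j + 1" by (meson evenE oddE)
    with yi have "(y, i) = tw_tr (E j) \<or> (y, i) = tw_tr (G j)"
      by (auto simp: twisted_letters_def)
    then show "(y, i) \<in> range tw_tr" by (elim disjE) (simp_all only: rangeI)
  next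
    fix y i assume yi: "(y, i) \<in> twisted_letters" "y \<in> {osp_f, osp_gm} \<or> y = osp_h \<and> 1 \<le> i"
    obtain j where "i = 2 * j \<or> i = 2 * j + 1" by (meson evenE oddE)
    with yi have "y = osp_f \<and> i = 2 * j \<or> y = osp_gm \<and> i = 2 * j + 1 \<or> y = osp_h \<and> i = 2 * (j - 1) + 2"
      by (auto simp: twisted_letters_def)
    then show "gen y i \<in> twisted_weyl_relations k"
      unfolding twisted_weyl_relations_def by blast
  next
    fix x y show "1 * 1 * osp_coeff (fst (tw_tr x)) (fst (tw_tr y)) = iw_coeff x y * 1"
      by (cases x; cases y; simp)
    show "iw_coeff x y \<noteq> 0 \<Longrightarrow>
        (osp_letter (fst (tw_tr x)) (fst (tw_tr y)), snd (tw_tr x) + snd (tw_tr y)) = tw_tr (iw_letter x y)"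
      by (cases x; cases y; simp)
    show "osp_parity (fst (tw_tr x)) = iw_par x" "tw_tr x \<in> twisted_letters"
      by (cases x; simp add: twisted_letters_def)+
  qed (auto simp: twisted_weyl_relations_def twisted_letters_def)
qed

section \<open>Spanning words for the Weyl modules\<close>

context iwahori_module
begin

lemma one_eq_scale: "1 - fa_scale 1 (mon []) \<in> N1"
  using one_eq_mon by simp

text \<open>\<open>r'\<close> is the Iwahori word of the top vector and \<open>r\<close> the word in
  e_0 that it equals up to a nonzero factor. The two differ in length in the untwisted case, where
  \<open>B 0\<close>^2 is e_0.\<close>

lemma spans_split_mon:
  assumes sp: "iw.spans (map (\<lambda>u. u @ r') us1 @ us2) 1 N1"
    and w: "iw.wact r' 1 - fa_scale e (mon r) \<in> N1" "e \<noteq> 0" "set r \<subseteq> L"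
  defines "T \<equiv> (\<lambda>u. u @ r) ` set (map (map tr) us1) \<union> set (map (map tr) us2)"
  shows "fa.span (monomials L) \<subseteq> fa.span (mon ` T \<union> N)"
proof (rule mon_span_all)
  show "set t \<subseteq> L" if "t \<in> T" for t
    using that w(3) tr_L by (fastforce simp: T_def)
  fix u assume u: "set u \<subseteq> range tr"
  obtain u' where u': "u = map tr u'" using u by (metis ex_map_conv subset_iff rangeE)
  obtain d where d: "d \<noteq> 0" "iw.wact u' 1 - fa_scale d (mon u) \<in> N1"
    using iw_wact_mon[OF one_eq_scale, of u'] u' by auto
  show "mon u \<in> fa.span (mon ` T \<union> N)"
  proof (rule mon_in_span)
    show "iw.wact u' 1 \<in> fa.span ((\<lambda>u. iw.wact u 1) ` set (map (\<lambda>u. u @ r') us1 @ us2) \<union> N1)"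
      using sp unfolding iw.spans_def by blast
    show "iw.wact u' 1 - fa_scale d (mon u) \<in> N1" "d \<noteq> 0" by fact+
    show "set u \<subseteq> L" using u tr_L by auto
    fix s assume "s \<in> (\<lambda>u. iw.wact u 1) ` set (map (\<lambda>u. u @ r') us1 @ us2)"
    then consider v where "v \<in> set us1" "s = iw.wact v (iw.wact r' 1)" | v where "v \<in> set us2" "s = iw.wact v 1"
      by auto
    then show "\<exists>d t. t \<in> T \<and> s - fa_scale d (mon t) \<in> N1"
    proof cases
      case 1
      then have "map tr v @ r \<in> T" by (simp add: T_def)
      then show ?thesis using iw_wact_mon[OF w(1,2), of v] 1 by blast
    next
      case 2
      then have "map tr v \<in> T" by (simp add: T_def)
      then show ?thesis using iw_wact_mon[OF one_eq_scale, of v] 2 by auto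
    qed
  qed fact
qed

lemma spans_all_mon:
  assumes "iw.spans us 1 N1"
  shows "fa.span (monomials L) \<subseteq> fa.span (mon ` set (map (map tr) us) \<union> N)"
  using spans_split_mon[of "[]" "[]" us 1 "[]"] assms one_eq_scale by simp

lemma spans_top:
  assumes sp: "iw.spans us w N1" and w: "w - fa_scale e (mon r) \<in> N1" "e \<noteq> 0" "set r \<subseteq> L"
    and S: "S \<subseteq> range tr"
  shows "{u * mon r | u. u \<in> fa.span (monomials S)} \<subseteq>
     fa.span (mon ` (\<lambda>u. u @ r) ` set (map (map tr) us) \<union> N)"
proof clarify
  fix u assume "u \<in> fa.span (monomials S)"
  then show "u * mon r \<in> fa.span (mon ` (\<lambda>u. u @ r) ` set (map (map tr) us) \<union> N)"
  proof (rule fa_span_mult_right)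
    fix s assume "s \<in> monomials S"
    then obtain v where "s = mon v" "set v \<subseteq> range tr" using S by (auto simp: monomials_def)
    then show "s * mon r \<in> fa.span (mon ` (\<lambda>u. u @ r) ` set (map (map tr) us) \<union> N)"
      using spans_mon[OF sp w, of v] by (simp add: mon_mult image_image)
  qed
qed

text \<open>The module of positive index is generated from the top vector by the letters
  \<open>S\<close> only, not by the whole Iwahori subalgebra. Since the top vector is a weight
  vector of the opposite kind, the letters in \<open>Pos\<close> suffice, and these lie in
  \<open>S\<close>. With \<open>spans_top\<close> this identifies the two submodules.\<close>

lemma top_span:
  assumes pbw: "iw.wact u w \<in> fa.span ({iw.wact u' w | u'. set u' \<subseteq> Pos \<and> Q u'} \<union> N1)"
    and w: "w - fa_scale e (mon r) \<in> N1" "e \<noteq> 0" "set r \<subseteq> L"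
    and Pos: "tr ` Pos \<subseteq> S"
  shows "mon (map tr u @ r) \<in> fa.span ({u * mon r | u. u \<in> fa.span (monomials S)} \<union> N)"
proof -
  let ?T = "(\<lambda>u. map tr u @ r) ` {u. set u \<subseteq> Pos}"
  obtain d where d: "d \<noteq> 0" "iw.wact u w - fa_scale d (mon (map tr u @ r)) \<in> N1"
    using iw_wact_mon[OF w(1,2)] by blast
  have "mon (map tr u @ r) \<in> fa.span (mon ` ?T \<union> N)"
  proof (rule mon_in_span[OF pbw d(2,1)])
    show "set (map tr u @ r) \<subseteq> L" using w(3) tr_L by auto
    show "set t \<subseteq> L" if "t \<in> ?T" for t using that w(3) tr_L by auto
    fix s assume "s \<in> {iw.wact u' w | u'. set u' \<subseteq> Pos \<and> Q u'}"
    then show "\<exists>d t. t \<in> ?T \<and> s - fa_scale d (mon t) \<in> N1"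
      using iw_wact_mon[OF w(1,2)] by blast
  qed
  also have "\<dots> \<subseteq> fa.span ({u * mon r | u. u \<in> fa.span (monomials S)} \<union> N)"
  proof (rule fa.span_mono, rule Un_mono)
    show "mon ` ?T \<subseteq> {u * mon r | u. u \<in> fa.span (monomials S)}"
    proof clarify
      fix v assume "set v \<subseteq> Pos"
      then have "mon (map tr v) \<in> fa.span (monomials S)"
        using Pos by (intro fa.span_base mon_in_monomials) auto
      then show "\<exists>u. mon (map tr v @ r) = u * mon r \<and> u \<in> fa.span (monomials S)"
        by (metis mon_mult)
    qed
  qed simp
  finally show ?thesis .
qed

lemma iw_power_e:
  assumes "tr x = (osp_e, 0)"
  shows "\<exists>d. d \<noteq> 0 \<and> (iact x ^^ j) 1 - fa_scale d (mon (replicate j (osp_e, 0))) \<in> N1"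
  using iw_wact_mon[OF one_eq_scale, of "replicate j x"] assms
  by (auto simp: iw.wact_replicate)

lemma iw_power_e_vanish:
  assumes "tr x = (osp_e, 0)"
  shows "(iact x ^^ Suc k) 1 \<in> N1"
proof -
  obtain d where "(iact x ^^ Suc k) 1 - fa_scale d (mon (replicate (Suc k) (osp_e, 0))) \<in> N1"
    using iw_power_e[OF assms] by blast
  moreover have "fa_scale d (mon (replicate (Suc k) (osp_e, 0))) \<in> N1"
    using relation_N1[OF e_power_relation] unfolding gen_power
    by (intro fa.subspace_scale[OF subspace_N1]) (simp only: Suc_eq_plus1)
  ultimately have "((iact x ^^ Suc k) 1 - fa_scale d (mon (replicate (Suc k) (osp_e, 0)))) +
      fa_scale d (mon (replicate (Suc k) (osp_e, 0))) \<in> N1"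
    by (rule fa.subspace_add[OF subspace_N1])
  then show ?thesis by simp
qed

lemma zero_N1: "0 \<in> N1"
  using subspace_N1 by (rule fa.subspace_0)

end

section \<open>Characters of words and the four kinds of modules\<close>

lemma weight_gf_map:
  assumes "x \<noteq> 0" "\<And>y. q ^ snd (tr y) * x powi osp_weight (fst (tr y)) = a ^ grB y * b ^ grE y"
  shows "weight_gf (map (map tr) us) x q = word_gf us a b"
proof -
  have "q ^ word_degree (map tr u) * x powi word_weight (map tr u) =
      a ^ sum_list (map grB u) * b ^ sum_list (map grE u)" for u
  proof (induction u)
    case (Cons y u)
    have "q ^ word_degree (map tr (y # u)) * x powi word_weight (map tr (y # u)) =
        (q ^ snd (tr y) * x powi osp_weight (fst (tr y))) * (q ^ word_degree (map tr u) * x powi word_weight (map tr u))"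
      using assms(1) by (simp add: word_degree_def word_weight_def power_add power_int_add case_prod_beta)
    then show ?case by (simp add: assms(2) Cons.IH power_add)
  qed (simp add: word_degree_def word_weight_def)
  then show ?thesis by (simp add: weight_gf_def word_gf_def comp_def)
qed

lemma power_double: "z ^ (2 * i) = z ^ i * z ^ i" "z ^ (i * 2) = z ^ i * z ^ i" for z :: complex
  by (simp_all add: mult_2 mult_2_right power_add)

text \<open>The substituted values are the characters of the simple root vectors: x for
  \<open>B 0\<close>, which is g^+, and q / x^2 for \<open>E 0\<close>, which is f t.\<close>

lemma untw_gf:
  assumes "x \<noteq> 0"
  shows "weight_gf (map (map untw_tr) us) x q = word_gf us x (q / x ^ 2)"
proof (rule weight_gf_map[OF assms])
  show "q ^ snd (untw_tr y) * x powi osp_weight (fst (untw_tr y)) = x ^ grB y * (q / x ^ 2) ^ grE y" for y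
    using assms by (cases y) (simp_all add: power_double power_divide power_mult_distrib
        power_int_minus power2_eq_square field_simps)
qed

text \<open>Here \<open>B 0\<close> is g^- t with character q / x, and \<open>E 0\<close> is e with
  character x^2.\<close>

lemma tw_gf:
  assumes "x \<noteq> 0"
  shows "weight_gf (map (map tw_tr) us) x q = word_gf us (q / x) (x ^ 2)"
proof (rule weight_gf_map[OF assms])
  show "q ^ snd (tw_tr y) * x powi osp_weight (fst (tw_tr y)) = (q / x) ^ grB y * (x ^ 2) ^ grE y" for y
    using assms by (cases y) (simp_all add: power_double power_divide power_mult_distrib
        power_int_minus power2_eq_square field_simps)
qed

text \<open>\<open>us1\<close> is meant to be a basis of the submodule represented by \<open>V\<close>, and \<open>us2\<close> of the quotient by it.\<close>

definition split_words :: "current_letter set \<Rightarrow> current_letter free_algebra set \<Rightarrow>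
    current_letter free_algebra set \<Rightarrow> current_letter list list \<Rightarrow> current_letter list list \<Rightarrow> bool" where
  "split_words L N V us1 us2 \<longleftrightarrow>
     (\<forall>u\<in>set us1 \<union> set us2. set u \<subseteq> L) \<and>
     fa.span (monomials L) \<subseteq> fa.span (mon ` (set us1 \<union> set us2) \<union> N) \<and>
     (\<forall>u\<in>set us1. mon u \<in> fa.span (V \<union> N)) \<and> V \<subseteq> fa.span (mon ` set us1 \<union> N)"

definition basis_words :: "current_letter set \<Rightarrow> current_letter free_algebra set \<Rightarrow>
    current_letter free_algebra set \<Rightarrow> (complex \<Rightarrow> complex \<Rightarrow> complex) \<Rightarrow>
    (complex \<Rightarrow> complex \<Rightarrow> complex) \<Rightarrow> bool" where
  "basis_words L N V f1 f2 \<longleftrightarrow> (\<exists>us1 us2. split_words L N V us1 us2 \<and>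
     (\<forall>x q. x \<noteq> 0 \<longrightarrow> weight_gf us1 x q = f1 x q) \<and>
     (\<forall>x q. x \<noteq> 0 \<longrightarrow> weight_gf us2 x q = f2 x q))"

lemma basis_wordsI:
  assumes "split_words L N V us1 us2"
    "\<And>x q. x \<noteq> 0 \<Longrightarrow> weight_gf us1 x q = f1 x q" "\<And>x q. x \<noteq> 0 \<Longrightarrow> weight_gf us2 x q = f2 x q"
  shows "basis_words L N V f1 f2"
  using assms unfolding basis_words_def by blast

lemma weight_gf_append_power:
  "weight_gf (map (\<lambda>u. u @ replicate k (osp_e, 0)) us) x q = x ^ (2 * k) * weight_gf us x q" if "x \<noteq> 0"
proof -
  have "word_weight (u @ replicate k (osp_e, 0)) = word_weight u + int (2 * k)"
    "word_degree (u @ replicate k (osp_e, 0)) = word_degree u" for u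
    by (simp_all add: word_weight_def word_degree_def sum_list_replicate)
  then have "q ^ word_degree (u @ replicate k (osp_e, 0)) * x powi word_weight (u @ replicate k (osp_e, 0)) =
      x ^ (2 * k) * (q ^ word_degree u * x powi word_weight u)" for u
    using that by (simp only: power_int_add power_int_of_nat simp_thms) (simp only: mult_ac)
  then show ?thesis
    by (simp add: weight_gf_def comp_def sum_list_const_mult)
qed

text \<open>The relation e_0^(k+1) w = 0 only gives \<open>B 0\<close>^(2k+2) w = 0, one power too
  weak. Apply g^-_0, which kills w and lies outside the Iwahori subalgebra: as [g^-, e] = g^+, this
  yields (k+1) g^+_0 e_0^k w = 0, that is \<open>B 0\<close>^(2k+1) w = 0.\<close>

lemma untwisted_vacuum:
  shows untwisted_high: "iwahori_action.high fa_scale (iwahori_module.iact UNIV (weyl_relations k) untw_tr untw_c)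
      (cyclic_module.N1 UNIV (weyl_relations k)) 1 (of_nat k)"
    and untwisted_vanish: "(iwahori_module.iact UNIV (weyl_relations k) untw_tr untw_c (B 0) ^^ Suc (2 * k)) 1
      \<in> cyclic_module.N1 UNIV (weyl_relations k)"
proof -
  interpret iwahori_module UNIV "weyl_relations k" untw_tr untw_c k
    by (rule iwahori_module_untwisted)
  have "iact (H 0) 1 - fa_scale (of_nat k) 1 = fa_scale (- 1) (act (osp_h, 0) 1 - fa_scale (- of_nat k) 1)"
    by (simp add: iact_def fa.scale_minus_left fa.scale_right_diff_distrib fa.scale_right_distrib)
  also have "\<dots> \<in> N1" by (intro fa.subspace_scale[OF subspace_N1] act_h_one) simp
  finally show "iw.high N1 1 (of_nat k)"
    using submodule_iw[OF submodule_N1] zero_N1 act_one_zero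
    by (simp add: iw.high_def iact_def)
  let ?e = "act (osp_e, 0)"
  have gm: "act (osp_gm, 0) ((?e ^^ Suc m) v) =
      (?e ^^ Suc m) (act (osp_gm, 0) v) + fa_scale (of_nat (Suc m)) (act (osp_gp, 0) ((?e ^^ m) v))" for m v
  proof (induction m)
    case 0
    then show ?case using full.act_act[of "(osp_gm, 0)" "(osp_e, 0)" v] by simp
  next
    case (Suc m)
    have "act (osp_gm, 0) ((?e ^^ Suc (Suc m)) v) =
        ?e (act (osp_gm, 0) ((?e ^^ Suc m) v)) + act (osp_gp, 0) ((?e ^^ Suc m) v)"
      using full.act_act[of "(osp_gm, 0)" "(osp_e, 0)"] by simp
    moreover have two: "fa_scale 2 z = z + z" for z :: "current_letter free_algebra"
      using fa.scale_left_distrib[of 1 1 z] by simp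
    moreover have "?e (act (osp_gp, 0) ((?e ^^ m) v)) = act (osp_gp, 0) ((?e ^^ Suc m) v)"
      using full.act_act[of "(osp_e, 0)" "(osp_gp, 0)"] by simp
    ultimately show ?case
      by (simp only: Suc.IH full.act_add[OF UNIV_I] full.act_scale[OF UNIV_I])
        (simp add: fa.scale_left_distrib add_ac two)
  qed
  have sub: "full.submodule N1" by (rule submodule_N1)
  obtain d where d: "d \<noteq> 0" "\<And>v. iw.wact (replicate (Suc k) (A 0)) v = fa_scale d (full.wact (map untw_tr (replicate (Suc k) (A 0))) v)"
    using iw_wact by blast
  have "(iact (A 0) ^^ Suc k) 1 = fa_scale d ((?e ^^ Suc k) 1)"
    using d(2)[of 1] by (simp only: iw.wact_replicate full.wact_replicate map_replicate untw_tr.simps)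
  then have "fa_scale d ((?e ^^ Suc k) 1) \<in> N1"
    using iw_power_e_vanish[of "A 0"] by simp
  from fa.subspace_scale[OF subspace_N1 this, of "inverse d"] have "(?e ^^ Suc k) 1 \<in> N1" using d(1) by simp
  then have "act (osp_gm, 0) ((?e ^^ Suc k) 1) \<in> N1"
    by (rule full.submodule_act[OF sub UNIV_I])
  moreover have "(?e ^^ Suc k) (act (osp_gm, 0) 1) \<in> N1"
    using act_one_zero[of osp_gm 0] zero_N1 by (intro full.submodule_funpow[OF sub UNIV_I]) simp
  ultimately have "fa_scale (of_nat (Suc k)) (act (osp_gp, 0) ((?e ^^ k) 1)) \<in> N1"
    using fa.subspace_diff[OF subspace_N1] unfolding gm by fastforce
  from fa.subspace_scale[OF subspace_N1 this, of "inverse (of_nat (Suc k))"]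
  have g: "act (osp_gp, 0) ((?e ^^ k) 1) \<in> N1" by (simp del: of_nat_Suc)
  obtain d' where d': "\<And>v. iw.wact (replicate k (A 0)) v = fa_scale d' (full.wact (map untw_tr (replicate k (A 0))) v)"
    using iw_wact by blast
  have "(iact (B 0) ^^ (2 * k)) 1 = fa_scale ((- 1) ^ k * d') ((?e ^^ k) 1)"
    using iw.B0_even[of k 1] d'[of 1]
    by (simp only: iw.wact_replicate full.wact_replicate map_replicate untw_tr.simps fa.scale_scale)
  then have eq: "(iact (B 0) ^^ Suc (2 * k)) 1 = fa_scale (- ((- 1) ^ k * d')) (act (osp_gp, 0) ((?e ^^ k) 1))"
    by (simp add: iact_def full.act_scale fa.scale_minus_left)
  show "(iact (B 0) ^^ Suc (2 * k)) 1 \<in> N1"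
    unfolding eq by (rule fa.subspace_scale[OF subspace_N1 g])
qed

lemma untwisted_words_nonpos:
  "basis_words UNIV (relation_ideal UNIV (weyl_relations k)) (fa.span (monomials UNIV))
     (\<lambda>x q. PG x (q / x ^ 2) (2 * k)) (\<lambda>_ _. 0)"
proof -
  interpret iwahori_module UNIV "weyl_relations k" untw_tr untw_c k
    by (rule iwahori_module_untwisted)
  obtain us where us: "iw.spans us 1 N1" "\<forall>y z. word_gf us y z = PG y z (2 * k)"
    using iw.high_bound[of "2 * k"] untwisted_high[of k] untwisted_vanish[of k] unfolding iw.high_bound_def by blast
  have "split_words UNIV N (fa.span (monomials UNIV)) (map (map untw_tr) us) []"
    using spans_all_mon[OF us(1)] span_monomials_UNIV
    by (auto simp: split_words_def intro: fa.span_base)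
  then show ?thesis
    by (rule basis_wordsI) (simp_all add: untw_gf us(2) weight_gf_def[of "[]"])
qed

text \<open>The first step of the recursion for k = m + 1: the power 2k of \<open>B 0\<close> on the
  vacuum is a multiple of e_0^k w, so the submodule split off is W_k. Weights are counted relative
  to the vacuum, so e_0^k contributes x^(2k).\<close>

lemma untwisted_words_pos:
  "basis_words UNIV (relation_ideal UNIV (weyl_relations (Suc m)))
     {u * gen osp_e 0 ^ Suc m | u. u \<in> fa.span (monomials {(y, i). y \<in> {osp_f, osp_gm} \<and> i \<ge> 1})}
     (\<lambda>x q. x ^ (2 * Suc m) * QG x (q / x ^ 2) m) (\<lambda>x q. PG x (q / x ^ 2) (Suc (2 * m)))"
proof -
  let ?k = "Suc m" and ?r = "replicate (Suc m) (osp_e, 0 :: nat)"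
  let ?S = "{(y, i). y \<in> {osp_f, osp_gm} \<and> i \<ge> 1} :: current_letter set"
  interpret iwahori_module UNIV "weyl_relations ?k" untw_tr untw_c ?k
    by (rule iwahori_module_untwisted)
  let ?w = "(iact (B 0) ^^ Suc (2 * m + 1)) 1"
  have v: "(iact (B 0) ^^ Suc (Suc (2 * m + 1))) 1 \<in> N1"
    using untwisted_vanish[of ?k] by (simp only: mult_Suc_right add_2_eq_Suc Suc_eq_plus1_left ac_simps) simp
  obtain us1 us2 where us: "iw.spans us1 ?w N1"
    "iw.spans (map (\<lambda>u. u @ replicate (Suc (2 * m + 1)) (B 0)) us1 @ us2) 1 N1"
    "\<forall>y z. word_gf us1 y z = QG y z m" "\<forall>y z. word_gf us2 y z = PG y z (2 * m + 1)"
    using iw.high_split[OF iw.low_bound iw.high_bound untwisted_high[of ?k] v] by auto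
  have w: "iw.wact (replicate (Suc (2 * m + 1)) (B 0)) 1 = ?w" by (rule iw.wact_replicate)
  have w2: "?w = fa_scale ((- 1) ^ ?k) ((iact (A 0) ^^ ?k) 1)"
    using iw.B0_even[of ?k 1] by simp
  obtain d where d: "d \<noteq> 0" "(iact (A 0) ^^ ?k) 1 - fa_scale d (mon ?r) \<in> N1"
    using iw_power_e[of "A 0" ?k] by auto
  have e: "?w - fa_scale ((- 1) ^ ?k * d) (mon ?r) \<in> N1"
    using fa.subspace_scale[OF subspace_N1 d(2), of "(- 1) ^ ?k"] unfolding w2
    by (simp only: fa.scale_right_diff_distrib fa.scale_scale)
  have e0: "(- 1) ^ ?k * d \<noteq> 0" using d by simp
  have e': "iw.wact (replicate (Suc (2 * m + 1)) (B 0)) 1 - fa_scale ((- 1) ^ ?k * d) (mon ?r) \<in> N1"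
    unfolding w by (rule e)
  have low: "iw.low N1 ?w (of_nat ?k - of_nat (Suc (2 * m + 1)))"
    by (rule iw.high_top(1)[OF untwisted_high v])
  have pos: "untw_tr ` (range E \<union> range G) \<subseteq> ?S" by auto
  have S: "?S \<subseteq> range untw_tr"
  proof
    fix x assume "x \<in> ?S"
    then obtain y j where "x = (y, Suc j)" "y \<in> {osp_f, osp_gm}" by (auto simp: Suc_le_eq gr0_conv_Suc)
    then have "x = untw_tr (E j) \<or> x = untw_tr (G j)" by auto
    then show "x \<in> range untw_tr" by blast
  qed
  let ?us1 = "map (\<lambda>u. u @ ?r) (map (map untw_tr) us1)" and ?us2 = "map (map untw_tr) us2"
  have "split_words UNIV N {u * mon ?r | u. u \<in> fa.span (monomials ?S)} ?us1 ?us2"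
    unfolding split_words_def
  proof (intro conjI)
    show "fa.span (monomials UNIV) \<subseteq> fa.span (mon ` (set ?us1 \<union> set ?us2) \<union> N)"
      using spans_split_mon[OF us(2) e' e0 subset_UNIV] by (simp only: set_map)
    show "{u * mon ?r | u. u \<in> fa.span (monomials ?S)} \<subseteq> fa.span (mon ` set ?us1 \<union> N)"
      using spans_top[OF us(1) e e0 subset_UNIV S] by (simp only: set_map)
    show "\<forall>u\<in>set ?us1. mon u \<in> fa.span ({u * mon ?r | u. u \<in> fa.span (monomials ?S)} \<union> N)"
      using top_span[OF iw.low_positive_span[OF low] e e0 _ pos] by auto
  qed auto
  then show ?thesis
    unfolding gen_power
    by (rule basis_wordsI) (simp_all only: weight_gf_append_power untw_gf us Suc_eq_plus1 not_False_eq_True)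
qed

lemma twisted_vacuum:
  shows twisted_low: "iwahori_action.low fa_scale (iwahori_module.iact twisted_letters (twisted_weyl_relations k) tw_tr (\<lambda>_. 1))
      (cyclic_module.N1 twisted_letters (twisted_weyl_relations k)) 1 (- of_nat k)"
    and twisted_vanish: "(iwahori_module.iact twisted_letters (twisted_weyl_relations k) tw_tr (\<lambda>_. 1) (E 0) ^^ Suc k) 1
      \<in> cyclic_module.N1 twisted_letters (twisted_weyl_relations k)"
proof -
  interpret iwahori_module twisted_letters "twisted_weyl_relations k" tw_tr "\<lambda>_. 1" k
    by (rule iwahori_module_twisted)
  have "iact (H 0) 1 - fa_scale (- of_nat k) 1 = act (osp_h, 0) 1 - fa_scale (- of_nat k) 1"
    by (simp add: iact_def)
  also have "\<dots> \<in> N1" by (intro act_h_one) (simp add: twisted_letters_def)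
  moreover have "iact (A i) 1 = 0" "iact (B i) 1 = 0" "iact (H (Suc i)) 1 = 0" for i
    using act_one_zero tr_L[of "A i"] tr_L[of "B i"] tr_L[of "H (Suc i)"] by (simp_all add: iact_def)
  ultimately show "iw.low N1 1 (- of_nat k)"
    using submodule_iw[OF submodule_N1] zero_N1 by (simp add: iw.low_def)
  show "(iact (E 0) ^^ Suc k) 1 \<in> N1" by (rule iw_power_e_vanish) simp
qed

lemma twisted_words_nonpos:
  "basis_words twisted_letters (relation_ideal twisted_letters (twisted_weyl_relations k))
     (fa.span (monomials twisted_letters)) (\<lambda>x q. QG (q / x) (x ^ 2) k) (\<lambda>_ _. 0)"
proof -
  interpret iwahori_module twisted_letters "twisted_weyl_relations k" tw_tr "\<lambda>_. 1" k
    by (rule iwahori_module_twisted)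
  obtain us where us: "iw.spans us 1 N1" "\<forall>y z. word_gf us y z = QG y z k"
    using iw.low_bound[of k] twisted_low[of k] twisted_vanish[of k] unfolding iw.low_bound_def by blast
  have "split_words twisted_letters N (fa.span (monomials twisted_letters)) (map (map tw_tr) us) []"
    using spans_all_mon[OF us(1)] tr_L
    by (auto simp: split_words_def image_subset_iff intro!: fa.span_base mon_in_monomials)
  then show ?thesis
    by (rule basis_wordsI) (simp_all add: tw_gf us(2) weight_gf_def[of "[]"])
qed

lemma twisted_words_pos:
  "basis_words twisted_letters (relation_ideal twisted_letters (twisted_weyl_relations (Suc m)))
     {u * gen osp_e 0 ^ Suc m | u. u \<in> fa.span (monomials {(y, i). (y, i) \<in> twisted_letters \<and> i \<ge> 1})}
     (\<lambda>x q. x ^ (2 * Suc m) * PG (q / x) (x ^ 2) (Suc (2 * m))) (\<lambda>x q. QG (q / x) (x ^ 2) m)"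
proof -
  let ?k = "Suc m" and ?r = "replicate (Suc m) (osp_e, 0 :: nat)"
  let ?S = "{(y, i). (y, i) \<in> twisted_letters \<and> i \<ge> 1} :: current_letter set"
  interpret iwahori_module twisted_letters "twisted_weyl_relations ?k" tw_tr "\<lambda>_. 1" ?k
    by (rule iwahori_module_twisted)
  let ?w = "(iact (E 0) ^^ ?k) 1"
  obtain us1 us2 where us: "iw.spans us1 ?w N1"
    "iw.spans (map (\<lambda>u. u @ replicate ?k (E 0)) us1 @ us2) 1 N1"
    "\<forall>y z. word_gf us1 y z = PG y z (2 * m + 1)" "\<forall>y z. word_gf us2 y z = QG y z m"
    using iw.low_split[OF iw.high_bound iw.low_bound twisted_low[of ?k] twisted_vanish[of ?k]] by auto
  have w: "iw.wact (replicate ?k (E 0)) 1 = ?w" by (rule iw.wact_replicate)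
  obtain d where e0: "d \<noteq> 0" and e: "?w - fa_scale d (mon ?r) \<in> N1"
    using iw_power_e[of "E 0" ?k] by auto
  have e': "iw.wact (replicate ?k (E 0)) 1 - fa_scale d (mon ?r) \<in> N1"
    unfolding w by (rule e)
  have high: "iw.high N1 ?w (- of_nat ?k + 2 * of_nat ?k)"
    by (rule iw.low_top(1)[OF twisted_low twisted_vanish])
  have r: "set ?r \<subseteq> twisted_letters" by (auto simp: twisted_letters_def)
  have pos: "tw_tr ` (range A \<union> range B) \<subseteq> ?S" by (auto simp: twisted_letters_def)
  have S: "?S \<subseteq> range tw_tr"
  proof
    fix x assume "x \<in> ?S"
    then obtain y i where x: "x = (y, i)" "(y, i) \<in> twisted_letters" "i \<ge> 1" by auto
    obtain j where "i = 2 * j \<or> i = 2 * j + 1" by (meson evenE oddE)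
    with x have "x = tw_tr (E j) \<or> x = tw_tr (G j) \<or> x = tw_tr (H j) \<or> x = tw_tr (A (j - 1)) \<or> x = tw_tr (B j)"
      by (cases y) (auto simp: twisted_letters_def)
    then show "x \<in> range tw_tr" by (elim disjE) (simp_all only: rangeI)
  qed
  let ?us1 = "map (\<lambda>u. u @ ?r) (map (map tw_tr) us1)" and ?us2 = "map (map tw_tr) us2"
  have "split_words twisted_letters N {u * mon ?r | u. u \<in> fa.span (monomials ?S)} ?us1 ?us2"
    unfolding split_words_def
  proof (intro conjI)
    show "\<forall>u\<in>set ?us1 \<union> set ?us2. set u \<subseteq> twisted_letters"
      using tr_L r by fastforce
    show "fa.span (monomials twisted_letters) \<subseteq> fa.span (mon ` (set ?us1 \<union> set ?us2) \<union> N)"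
      using spans_split_mon[OF us(2) e' e0 r] by (simp only: set_map)
    show "{u * mon ?r | u. u \<in> fa.span (monomials ?S)} \<subseteq> fa.span (mon ` set ?us1 \<union> N)"
      using spans_top[OF us(1) e e0 r S] by (simp only: set_map)
    show "\<forall>u\<in>set ?us1. mon u \<in> fa.span ({u * mon ?r | u. u \<in> fa.span (monomials ?S)} \<union> N)"
      using top_span[OF iw.high_positive_span[OF high] e e0 r pos] by auto
  qed
  then show ?thesis
    unfolding gen_power
    by (rule basis_wordsI) (simp_all only: weight_gf_append_power tw_gf us Suc_eq_plus1 not_False_eq_True)
qed

section \<open>Tensor products of evaluation modules\<close>

datatype three = Lo | Mi | Hi

fun three_par :: "three \<Rightarrow> nat" where
  "three_par Mi = 1" | "three_par _ = 0"

fun three_wt :: "three \<Rightarrow> int" where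
  "three_wt Lo = - 1" | "three_wt Mi = 0" | "three_wt Hi = 1"

text \<open>The coefficient of \<open>b\<close> in \<open>y\<close> applied to \<open>c\<close>, in the three-dimensional representation.\<close>

fun three_mat :: "osp \<Rightarrow> three \<Rightarrow> three \<Rightarrow> complex" where
  "three_mat osp_e Hi Lo = 1"
| "three_mat osp_f Lo Hi = 1"
| "three_mat osp_h Hi Hi = 1"
| "three_mat osp_h Lo Lo = - 1"
| "three_mat osp_gp Mi Lo = 1"
| "three_mat osp_gp Hi Mi = 1"
| "three_mat osp_gm Mi Hi = 1"
| "three_mat osp_gm Lo Mi = - 1"
| "three_mat _ _ _ = 0"

text \<open>The action of \<open>y \<otimes> f\<close>, for a function \<open>f\<close>, on the tensor product of the evaluation
  representations at the points \<open>zs\<close>; a vector is given by its coordinates in the product basis.\<close>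

fun evact :: "osp \<Rightarrow> (complex \<Rightarrow> complex) \<Rightarrow> complex list \<Rightarrow> (three list \<Rightarrow> complex) \<Rightarrow> three list \<Rightarrow> complex" where
  "evact y f (z # zs) \<phi> (b # bs) =
     f z * (three_mat y b Lo * \<phi> (Lo # bs) + three_mat y b Mi * \<phi> (Mi # bs) + three_mat y b Hi * \<phi> (Hi # bs))
     + (- 1) ^ (osp_parity y * three_par b) * evact y f zs (\<lambda>cs. \<phi> (b # cs)) bs"
| "evact y f _ \<phi> _ = 0"

lemma evact_lin:
  "evact y f zs (\<lambda>l. a * \<phi> l + b * \<psi> l) bs = a * evact y f zs \<phi> bs + b * evact y f zs \<psi> bs"
proof (induction y f zs \<phi> bs arbitrary: \<psi> rule: evact.induct)
  case (1 y f z zs \<phi> c bs)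
  show ?case unfolding evact.simps 1[of "\<lambda>cs. \<psi> (c # cs)"] by (simp add: algebra_simps)
qed simp_all

lemma evact_fun_lin:
  "evact y (\<lambda>z. a * f z + b * g z) zs \<phi> bs = a * evact y f zs \<phi> bs + b * evact y g zs \<phi> bs"
  by (induction y f zs \<phi> bs rule: evact.induct) (simp_all add: algebra_simps)

lemma evact_cong:
  "(\<And>z. z \<in> set zs \<Longrightarrow> f z = g z) \<Longrightarrow> evact y f zs \<phi> bs = evact y g zs \<phi> bs"
  by (induction y f zs \<phi> bs rule: evact.induct) simp_all

lemma evact_zero: "evact y f zs (\<lambda>_. 0) bs = 0"
  using evact_lin[of y f zs 0 "\<lambda>_. 0" 0 "\<lambda>_. 0"] by simp

lemma evact_lin4:
  "evact y f zs (\<lambda>l. g * (p * \<phi> l + q * \<psi> l + r * \<chi> l) + s * \<omega> l) bs =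
    g * (p * evact y f zs \<phi> bs + q * evact y f zs \<psi> bs + r * evact y f zs \<chi> bs) + s * evact y f zs \<omega> bs"
  using evact_lin[of y f zs g "\<lambda>l. 1 * (p * \<phi> l + q * \<psi> l) + r * \<chi> l" s \<omega> bs]
    evact_lin[of y f zs 1 "\<lambda>l. p * \<phi> l + q * \<psi> l" r \<chi> bs]
    evact_lin[of y f zs p \<phi> q \<psi> bs]
  by simp

text \<open>The sign in \<open>evact\<close> is the Koszul sign of passing the first factor, so
  mixed terms on the first factor and on the rest cancel. On a single factor
  \<open>three_mat\<close> is a representation, and evaluation multiplies functions.\<close>

lemma evact_bracket:
  "evact x f zs (evact y g zs \<phi>) bs =
     (- 1) ^ (osp_parity x * osp_parity y) * evact y g zs (evact x f zs \<phi>) bs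
     + osp_coeff x y * evact (osp_letter x y) (\<lambda>z. f z * g z) zs \<phi> bs"
proof (induction zs arbitrary: \<phi> bs)
  case Nil
  then show ?case by simp
next
  case (Cons z zs)
  show ?case
  proof (cases bs)
    case Nil
    then show ?thesis by simp
  next
    case bs: (Cons b cs)
    show ?thesis
      unfolding bs evact.simps evact_lin4 Cons.IH
      by (cases x; cases y; cases b) (simp_all add: algebra_simps)
  qed
qed

definition delta :: "three list \<Rightarrow> three list \<Rightarrow> complex" where
  "delta l = (\<lambda>bs. if bs = l then 1 else 0)"

lemma delta_Cons: "(\<lambda>cs. delta (c # l) (b # cs)) = (if b = c then delta l else (\<lambda>_. 0))"
  by (auto simp: delta_def fun_eq_iff)

lemma evact_support:
  assumes "\<And>bs. \<phi> bs \<noteq> 0 \<Longrightarrow> length bs = length zs \<and> sum_list (map three_wt bs) = m"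
    and d: "\<And>b c. three_mat y b c \<noteq> 0 \<Longrightarrow> three_wt b = three_wt c + d"
    and "evact y f zs \<phi> bs \<noteq> 0"
  shows "length bs = length zs \<and> sum_list (map three_wt bs) = m + d"
  using assms(1,3)
proof (induction zs arbitrary: \<phi> bs m)
  case (Cons z zs)
  obtain b cs where bs: "bs = b # cs" using Cons.prems(2) by (cases bs) auto
  have "(\<exists>c. three_mat y b c \<noteq> 0 \<and> \<phi> (c # cs) \<noteq> 0) \<or> evact y f zs (\<lambda>cs. \<phi> (b # cs)) cs \<noteq> 0"
    using Cons.prems(2) unfolding bs evact.simps by (metis add.right_neutral mult_zero_left mult_zero_right)
  then show ?case
  proof
    assume "\<exists>c. three_mat y b c \<noteq> 0 \<and> \<phi> (c # cs) \<noteq> 0"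
    then obtain c where "three_mat y b c \<noteq> 0" "\<phi> (c # cs) \<noteq> 0" by blast
    then show ?thesis using Cons.prems(1)[of "c # cs"] d[of b c] bs by auto
  next
    assume "evact y f zs (\<lambda>cs. \<phi> (b # cs)) cs \<noteq> 0"
    moreover have "length ds = length zs \<and> sum_list (map three_wt ds) = m - three_wt b"
      if "\<phi> (b # ds) \<noteq> 0" for ds using Cons.prems(1)[OF that] by auto
    ultimately have "length cs = length zs \<and> sum_list (map three_wt cs) = (m - three_wt b) + d"
      by (rule Cons.IH[rotated])
    then show ?thesis by (simp add: bs)
  qed
qed simp

lemma three_wt_le: "sum_list (map three_wt bs) \<le> int (length bs)"
proof (induction bs)
  case (Cons b bs)
  then show ?case by (cases b) auto
qed simp

section \<open>The lowest vector and the defining relations\<close>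

definition lowest :: "complex list \<Rightarrow> three list \<Rightarrow> complex" where
  "lowest zs = delta (replicate (length zs) Lo)"

lemma evact_lowest_zero:
  assumes "y \<in> {osp_f, osp_gm}"
  shows "evact y f zs (lowest zs) = (\<lambda>_. 0)"
proof
  fix bs show "evact y f zs (lowest zs) bs = 0"
  proof (induction zs arbitrary: bs)
    case (Cons z zs)
    then show ?case using assms
      by (cases bs; cases "hd bs") (auto simp: lowest_def delta_Cons evact_zero delta_def)
  qed simp
qed

text \<open>For f(z) = z^i with i > 0 this is the defining relation that fails on the tensor
  product, whence the detour through leading terms. For f = 1 it gives the weight minus the number
  of factors.\<close>

lemma evact_lowest_h:
  "evact osp_h f zs (lowest zs) = (\<lambda>bs. - (\<Sum>z\<leftarrow>zs. f z) * lowest zs bs)"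
proof
  fix bs show "evact osp_h f zs (lowest zs) bs = - (\<Sum>z\<leftarrow>zs. f z) * lowest zs bs"
  proof (induction zs arbitrary: bs)
    case (Cons z zs)
    show ?case
    proof (cases bs)
      case Nil
      then show ?thesis by (simp add: lowest_def delta_def)
    next
      case bs: (Cons b cs)
      show ?thesis
      proof (cases "b = Lo")
        case True
        then have "lowest (z # zs) bs = lowest zs cs" "(\<lambda>ds. lowest (z # zs) (b # ds)) = lowest zs"
          by (auto simp: bs lowest_def delta_def fun_eq_iff)
        moreover have "lowest (z # zs) (Lo # cs) = lowest zs cs" by (auto simp: lowest_def delta_def)
        ultimately show ?thesis using Cons.IH[of cs] True by (simp add: bs algebra_simps)
      next
        case False
        then have "lowest (z # zs) bs = 0" "(\<lambda>ds. lowest (z # zs) (b # ds)) = (\<lambda>_. 0)"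
          by (auto simp: bs lowest_def delta_def fun_eq_iff)
        then show ?thesis using False by (cases b) (simp_all add: bs evact_zero)
      qed
    qed
  qed (simp add: lowest_def)
qed

text \<open>Each e raises the weight by 2, so k + 1 of them would lead from -k to k + 2, beyond the
  largest weight k.\<close>

lemma evact_e_power:
  assumes "length zs = k"
  shows "(evact osp_e f zs ^^ (k + 1)) (lowest zs) = (\<lambda>_. 0)"
proof -
  have *: "length bs = length zs \<and> sum_list (map three_wt bs) = 2 * int j - int k"
    if "(evact osp_e f zs ^^ j) (lowest zs) bs \<noteq> 0" for j bs
    using that
  proof (induction j arbitrary: bs)
    case 0
    then show ?case using assms
      by (auto simp: lowest_def delta_def sum_list_replicate split: if_splits)
  next
    case (Suc j)
    have "three_wt b = three_wt c + 2" if "three_mat osp_e b c \<noteq> 0" for b c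
      using that by (cases b; cases c) auto
    then have "length bs = length zs \<and> sum_list (map three_wt bs) = 2 * int j - int k + 2"
      using Suc by (intro evact_support[of "(evact osp_e f zs ^^ j) (lowest zs)"]) auto
    then show ?case by simp
  qed
  have "(evact osp_e f zs ^^ (k + 1)) (lowest zs) bs = 0" for bs
  proof (rule ccontr)
    assume "(evact osp_e f zs ^^ (k + 1)) (lowest zs) bs \<noteq> 0"
    from *[OF this] show False using three_wt_le[of bs] assms by simp
  qed
  then show ?thesis by blast
qed

definition fn_scale :: "complex \<Rightarrow> (three list \<Rightarrow> complex) \<Rightarrow> three list \<Rightarrow> complex" where
  "fn_scale c \<phi> = (\<lambda>l. c * \<phi> l)"

interpretation fn: complex_vector_space fn_scale
  by unfold_locales (auto simp: fn_scale_def fun_eq_iff algebra_simps)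

lemma evact_add: "evact y f zs (\<phi> + \<psi>) = evact y f zs \<phi> + evact y f zs \<psi>"
  using evact_lin[of y f zs 1 \<phi> 1 \<psi>] by (simp add: fun_eq_iff plus_fun_def)

lemma evact_scale: "evact y f zs (fn_scale c \<phi>) = fn_scale c (evact y f zs \<phi>)"
  using evact_lin[of y f zs c \<phi> 0 "\<lambda>_. 0"] by (simp add: fun_eq_iff fn_scale_def)

definition wact3 :: "complex list \<Rightarrow> current_letter list \<Rightarrow> (three list \<Rightarrow> complex) \<Rightarrow> three list \<Rightarrow> complex" where
  "wact3 zs u \<phi> = foldr (\<lambda>(y, i). evact y (\<lambda>z. z ^ i) zs) u \<phi>"

lemma wact3_simps [simp]: "wact3 zs [] \<phi> = \<phi>"
  "wact3 zs ((y, i) # u) \<phi> = evact y (\<lambda>z. z ^ i) zs (wact3 zs u \<phi>)"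
  "wact3 zs (u @ u') \<phi> = wact3 zs u (wact3 zs u' \<phi>)"
  by (simp_all add: wact3_def)

lemma wact3_add: "wact3 zs u (\<phi> + \<psi>) = wact3 zs u \<phi> + wact3 zs u \<psi>"
  and wact3_scale: "wact3 zs u (fn_scale c \<phi>) = fn_scale c (wact3 zs u \<phi>)"
  by (induction u) (auto simp: evact_add evact_scale)

lemma wact3_zero: "wact3 zs u 0 = 0"
  using wact3_scale[of zs u 0 0] by simp

text \<open>Lets the free algebra act on the lowest vector. This does not descend to the Weyl
  module, because h_i with i > 0 does not kill that vector in general.\<close>

definition ev :: "complex list \<Rightarrow> current_letter free_algebra \<Rightarrow> three list \<Rightarrow> complex" where
  "ev zs = fn.lift (\<lambda>w. wact3 zs (letters w) (lowest zs))"

lemma ev_mon: "ev zs (mon u) = wact3 zs u (lowest zs)"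
  and ev_add: "ev zs (p + q) = ev zs p + ev zs q"
  and ev_scale: "ev zs (fa_scale c p) = fn_scale c (ev zs p)"
  and ev_zero: "ev zs 0 = 0"
  by (simp_all add: ev_def fn.lift_single fn.lift_add fn.lift_scale fn.lift_zero)

lemma ev_diff: "ev zs (p - q) = ev zs p - ev zs q"
  using ev_add[of zs "p - q" q] by simp

lemma ev_mon_mult: "ev zs (mon u * p) = wact3 zs u (ev zs p)"
proof (induction p rule: free_algebra_induct)
  case (add c v p)
  then show ?case
    by (simp add: distrib_left ev_add fa_scale_mult_right ev_scale mon_mult ev_mon wact3_add wact3_scale
        del: plus_fun_apply)
qed (simp add: ev_zero wact3_zero del: zero_fun_apply)

lemma ev_relator: "ev zs (lie_relator x y * mon v) = 0"
proof -
  obtain a i b j where xy: "x = (a, i)" "y = (b, j)" by (cases x; cases y)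
  let ?\<phi> = "wact3 zs v (lowest zs)"
  have "evact a (\<lambda>z. z ^ i) zs (evact b (\<lambda>z. z ^ j) zs ?\<phi>) =
      fn_scale ((- 1) ^ (osp_parity a * osp_parity b)) (evact b (\<lambda>z. z ^ j) zs (evact a (\<lambda>z. z ^ i) zs ?\<phi>))
      + fn_scale (osp_coeff a b) (evact (osp_letter a b) (\<lambda>z. z ^ (i + j)) zs ?\<phi>)"
    by (rule ext) (subst evact_bracket, simp add: fn_scale_def power_add)
  then show ?thesis
    by (simp add: xy lie_relator_eq left_diff_distrib fa_scale_mult_left mon_mult ev_diff ev_scale ev_mon)
qed

section \<open>The lowest vector generates the tensor product\<close>

lemma evact_vanish: "(\<And>z. z \<in> set zs \<Longrightarrow> f z = 0) \<Longrightarrow> evact y f zs \<phi> bs = 0"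
  using evact_cong[of zs f "\<lambda>_. 0" y \<phi> bs] evact_fun_lin[of y 0 "\<lambda>_. 0" 0 "\<lambda>_. 0" zs \<phi> bs] by simp

text \<open>Only the factor at which f does not vanish contributes; \<open>s\<close> is the Koszul
  sign of the factors before it.\<close>

lemma evact_site:
  assumes "distinct zs" "j < length zs" "length l = length zs" "l ! j = Lo"
    "\<And>z. z \<in> set zs \<Longrightarrow> z \<noteq> zs ! j \<Longrightarrow> f z = 0"
    and y: "y = osp_e \<and> b = Hi \<or> y = osp_gp \<and> b = Mi"
  shows "\<exists>s. s \<noteq> 0 \<and> evact y f zs (delta l) = fn_scale (s * f (zs ! j)) (delta (l[j := b]))"
  using assms(1-5)
proof (induction zs arbitrary: l j)
  case (Cons z zs)
  obtain c l' where l: "l = c # l'" using Cons.prems(3) by (cases l) auto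
  show ?case
  proof (cases j)
    case 0
    have c: "c = Lo" using Cons.prems(4) l 0 by simp
    have v: "f w = 0" if "w \<in> set zs" for w
      using Cons.prems(1,5) 0 that by auto
    have "evact y f (z # zs) (delta l) bs = 1 * f z * delta (b # l') bs" for bs
    proof (cases bs)
      case (Cons b' cs)
      then show ?thesis using y evact_vanish[OF v]
        by (cases b') (auto simp: l c delta_def)
    qed (simp add: delta_def)
    then show ?thesis using 0 l by (intro exI[of _ 1]) (simp add: fn_scale_def fun_eq_iff)
  next
    case (Suc i)
    have "z \<noteq> zs ! i" using Cons.prems(1,2) Suc nth_mem[of i zs] by auto
    then have z: "f z = 0" by (intro Cons.prems(5)) (simp_all add: Suc)
    have "\<exists>s. s \<noteq> 0 \<and> evact y f zs (delta l') = fn_scale (s * f (zs ! i)) (delta (l'[i := b]))"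
      using Cons.prems l Suc by (intro Cons.IH) auto
    then obtain s where s: "s \<noteq> 0" "evact y f zs (delta l') = fn_scale (s * f (zs ! i)) (delta (l'[i := b]))"
      by blast
    have "evact y f (z # zs) (delta l) bs =
        ((- 1) ^ (osp_parity y * three_par c) * s) * f ((z # zs) ! j) * delta (l[j := b]) bs" for bs
    proof (cases bs)
      case (Cons b' cs)
      then show ?thesis
        by (simp add: l Suc z delta_Cons s evact_zero fn_scale_def) (simp add: delta_def)
    qed (simp add: delta_def l Suc)
    then show ?thesis using s(1)
      by (intro exI[of _ "(- 1) ^ (osp_parity y * three_par c) * s"]) (simp add: fn_scale_def fun_eq_iff)
  qed
qed simp

text \<open>Positive integers are nonzero and have distinct squares. Both matter in the twisted
  algebra, whose odd letters carry a factor z and which otherwise sees only z^2.\<close>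

definition points :: "nat \<Rightarrow> complex list" where
  "points k = map (\<lambda>i. of_nat (Suc i)) [0..<k]"

lemma points: "distinct (points k)" "length (points k) = k" "z \<in> set (points k) \<Longrightarrow> z \<noteq> 0"
  "z \<in> set (points k) \<Longrightarrow> w \<in> set (points k) \<Longrightarrow> z ^ 2 = w ^ 2 \<Longrightarrow> z = w"
proof -
  show "distinct (points k)" "length (points k) = k"
    by (auto simp: points_def distinct_map inj_on_def simp del: of_nat_Suc)
  show "z \<in> set (points k) \<Longrightarrow> z \<noteq> 0"
    by (auto simp: points_def simp del: of_nat_Suc)
  assume "z \<in> set (points k)" "w \<in> set (points k)" and sq: "z ^ 2 = w ^ 2"
  then obtain i j where ij: "z = of_nat (Suc i)" "w = of_nat (Suc j)" by (auto simp: points_def)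
  then have "(Suc i) ^ 2 = (Suc j) ^ 2"
    using sq by (metis of_nat_eq_iff of_nat_power)
  then show "z = w" using ij by (metis power2_eq_iff_nonneg zero_le)
qed

definition word_images :: "nat \<Rightarrow> current_letter set \<Rightarrow> (three list \<Rightarrow> complex) set" where
  "word_images k L = fn.span ((\<lambda>u. ev (points k) (mon u)) ` {u. set u \<subseteq> L})"

lemma evact_word_images:
  assumes "\<phi> \<in> word_images k L" "(y, i) \<in> L"
  shows "evact y (\<lambda>z. z ^ i) (points k) \<phi> \<in> word_images k L"
  using assms(1) unfolding word_images_def
proof (induction rule: fn.span_induct_alt)
  case base
  have "evact y (\<lambda>z. z ^ i) (points k) 0 = 0"
    using evact_scale[of y "\<lambda>z. z ^ i" "points k" 0 0] by simp
  then show ?case by (simp add: fn.span_zero del: zero_fun_apply)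
next
  case (step c s \<psi>)
  then obtain u where u: "s = ev (points k) (mon u)" "set u \<subseteq> L" by blast
  have "evact y (\<lambda>z. z ^ i) (points k) s = ev (points k) (mon ((y, i) # u))"
    by (simp add: u ev_mon)
  moreover have "set ((y, i) # u) \<subseteq> L" using u assms(2) by simp
  ultimately have "evact y (\<lambda>z. z ^ i) (points k) s \<in> fn.span ((\<lambda>u. ev (points k) (mon u)) ` {u. set u \<subseteq> L})"
    by (intro fn.span_base) blast
  then show ?case using step by (simp add: evact_add evact_scale fn.span_add fn.span_scale del: plus_fun_apply)
qed

lemma evact_poly_word_images:
  assumes \<phi>: "\<phi> \<in> word_images k twisted_letters"
  shows "evact y (\<lambda>z. z ^ osp_parity y * poly p (z ^ 2)) (points k) \<phi> \<in> word_images k twisted_letters"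
proof -
  have L: "(y, osp_parity y + 2 * i) \<in> twisted_letters" for i
    by (cases y) (auto simp: twisted_letters_def)
  have "evact y (\<lambda>z. \<Sum>i<n. c i * z ^ (osp_parity y + 2 * i)) (points k) \<phi> \<in> word_images k twisted_letters"
    for n and c :: "nat \<Rightarrow> complex"
  proof (induction n)
    case 0
    have "evact y (\<lambda>_. 0) (points k) \<phi> = 0" by (rule ext) (simp add: evact_vanish)
    then show ?case by (simp add: word_images_def fn.span_zero del: zero_fun_apply)
  next
    case (Suc n)
    have "evact y (\<lambda>z. \<Sum>i<Suc n. c i * z ^ (osp_parity y + 2 * i)) (points k) \<phi> =
        evact y (\<lambda>z. \<Sum>i<n. c i * z ^ (osp_parity y + 2 * i)) (points k) \<phi>
        + fn_scale (c n) (evact y (\<lambda>z. z ^ (osp_parity y + 2 * n)) (points k) \<phi>)"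
      using evact_fun_lin[of y 1 "\<lambda>z. \<Sum>i<n. c i * z ^ (osp_parity y + 2 * i)" "c n" "\<lambda>z. z ^ (osp_parity y + 2 * n)" "points k" \<phi>]
      by (simp add: fun_eq_iff fn_scale_def)
    then show ?case
      using Suc evact_word_images[OF \<phi> L, of n] unfolding word_images_def
      by (simp add: fn.span_add fn.span_scale del: plus_fun_apply)
  qed
  from this[of "coeff p" "Suc (degree p)"] show ?thesis
    by (simp add: poly_altdef sum_distrib_left power_add lessThan_Suc_atMost mult_ac flip: power_mult)
qed

text \<open>Interpolation at the squares of the evaluation points isolates the action on a single tensor
  factor, so the lowest vector generates the whole tensor product.\<close>

lemma delta_word_images:
  assumes "length l = k"
  shows "delta l \<in> word_images k twisted_letters"
  using assms
proof (induction "card {j. j < k \<and> l ! j \<noteq> Lo}" arbitrary: l)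
  case 0
  then have "l ! j = Lo" if "j < k" for j using that by auto
  then have "l = replicate k Lo" using 0 by (intro nth_equalityI) auto
  then have "delta l = ev (points k) (mon [])" by (simp add: ev_mon lowest_def points)
  then show ?case unfolding word_images_def by (intro fn.span_base) auto
next
  case (Suc n)
  let ?zs = "points k"
  have "{j. j < k \<and> l ! j \<noteq> Lo} \<noteq> {}" using Suc(2) by (metis card.empty nat.distinct(1))
  then obtain j where j: "j < k" "l ! j \<noteq> Lo" by blast
  let ?l = "l[j := Lo]"
  have "{i. i < k \<and> ?l ! i \<noteq> Lo} = {i. i < k \<and> l ! i \<noteq> Lo} - {j}"
    using Suc(3) j(1) by (auto simp: nth_list_update)
  then have "card {i. i < k \<and> ?l ! i \<noteq> Lo} = n" using Suc(2) j by simp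
  then have IH: "delta ?l \<in> word_images k twisted_letters" using Suc by simp
  \<comment> \<open>An unnormalized Lagrange polynomial in z^2, isolating the site \<open>j\<close>.
    The letter \<open>y\<close> is the one that carries \<open>Lo\<close> at this site back to
    \<open>l ! j\<close>.\<close>
  define p where "p = (\<Prod>w\<in>set ?zs - {?zs ! j}. [: - (w ^ 2), 1 :])"
  define y where "y = (if l ! j = Hi then osp_e else osp_gp)"
  define f where "f = (\<lambda>z. z ^ osp_parity y * poly p (z ^ 2))"
  have y: "y = osp_e \<and> l ! j = Hi \<or> y = osp_gp \<and> l ! j = Mi"
    using j by (cases "l ! j") (auto simp: y_def)
  have f0: "f z = 0" if "z \<in> set ?zs" "z \<noteq> ?zs ! j" for z
    using that by (auto simp: f_def p_def poly_prod)
  have zj: "?zs ! j \<in> set ?zs" using j points(2)[of k] by simp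
  have fj: "f (?zs ! j) \<noteq> 0"
    using points(3)[OF zj] points(4)[OF zj] by (auto simp: f_def p_def poly_prod)
  obtain s where s: "s \<noteq> 0" "evact y f ?zs (delta ?l) = fn_scale (s * f (?zs ! j)) (delta (?l[j := l ! j]))"
    using evact_site[OF points(1), of j k ?l f y "l ! j"] y f0 j Suc(3) by (auto simp: points(2))
  have "fn_scale (s * f (?zs ! j)) (delta l) \<in> word_images k twisted_letters"
    using evact_poly_word_images[OF IH, of y p] s(2) by (simp add: f_def[symmetric] list_update_id)
  from fn.span_scale[OF this[unfolded word_images_def], of "inverse (s * f (?zs ! j))"]
  have "fn_scale (inverse (s * f (?zs ! j))) (fn_scale (s * f (?zs ! j)) (delta l))
      \<in> word_images k twisted_letters" unfolding word_images_def .
  moreover have "inverse (s * f (?zs ! j)) * (s * f (?zs ! j)) = 1"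
    using s(1) fj by (intro left_inverse) simp
  ultimately show ?case by (simp only: fn.scale_scale fn.scale_one)
qed

lemma sum_apply: "(\<Sum>m\<in>S. F m) l = (\<Sum>m\<in>S. F m l)"
  for F :: "'a \<Rightarrow> 'b \<Rightarrow> complex"
  by (induction S rule: infinite_finite_induct) simp_all

lemma card_ge_of_span_deltas:
  assumes "finite T" "\<And>l. length l = k \<Longrightarrow> delta l \<in> fn.span T"
  shows "3 ^ k \<le> card T"
proof -
  let ?A = "{l :: three list. length l = k}"
  have UN: "(UNIV :: three set) = {Lo, Mi, Hi}"
    using three.exhaust by auto
  have fin3: "finite (UNIV :: three set)" and c3: "card (UNIV :: three set) = 3"
    unfolding UN by auto
  have fin: "finite ?A" and card: "card ?A = 3 ^ k"
    using finite_lists_length_eq[OF fin3, of k] card_lists_length_eq[OF fin3, of k] c3 by auto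
  have inj: "inj_on delta ?A"
    by (auto simp: inj_on_def delta_def fun_eq_iff split: if_splits)
  have "fn.independent (delta ` ?A)"
  proof (rule fn.independent_if_scalars_zero)
    show "finite (delta ` ?A)" using fin by simp
    fix g \<phi> assume sum: "(\<Sum>x\<in>delta ` ?A. fn_scale (g x) x) = 0" and "\<phi> \<in> delta ` ?A"
    then obtain l where l: "\<phi> = delta l" "l \<in> ?A" by blast
    have "(\<Sum>x\<in>delta ` ?A. fn_scale (g x) x) = (\<Sum>m\<in>?A. fn_scale (g (delta m)) (delta m))"
      by (rule sum.reindex[OF inj, unfolded comp_def])
    then have "0 = (\<Sum>m\<in>?A. fn_scale (g (delta m)) (delta m)) l" using sum by simp
    also have "\<dots> = (\<Sum>m\<in>?A. g (delta m) * delta m l)"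
      by (simp add: sum_apply fn_scale_def)
    also have "\<dots> = (\<Sum>m\<in>?A. if m = l then g (delta m) else 0)"
      by (intro sum.cong) (auto simp: delta_def)
    also have "\<dots> = g \<phi>" using fin l by simp
    finally show "g \<phi> = 0" by simp
  qed
  then have "card (delta ` ?A) \<le> card T"
    using assms by (intro conjunct2[OF fn.independent_span_bound]) auto
  then show ?thesis using card card_image[OF inj] by simp
qed

section \<open>Graded characters\<close>

definition homogeneous :: "nat \<Rightarrow> current_letter free_algebra set" where
  "homogeneous d = fa.span (mon ` {u. word_degree u = d})"

definition degree_part :: "nat \<Rightarrow> current_letter free_algebra \<Rightarrow> current_letter free_algebra" where
  "degree_part s = fac.lift (\<lambda>w. if word_degree (letters w) = s then mon (letters w) else 0)"

lemma degree_part_mon: "degree_part s (mon u) = (if word_degree u = s then mon u else 0)"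
  and degree_part_add: "degree_part s (p + q) = degree_part s p + degree_part s q"
  and degree_part_scale: "degree_part s (fa_scale c p) = fa_scale c (degree_part s p)"
  and degree_part_zero: "degree_part s 0 = 0"
  by (simp_all add: degree_part_def fac.lift_single fac.lift_add fac.lift_scale fac.lift_zero)

lemma degree_part_diff: "degree_part s (p - q) = degree_part s p - degree_part s q"
  using degree_part_add[of s "p - q" q] by simp

lemma degree_part_sum: "degree_part s (\<Sum>u\<in>W. f u) = (\<Sum>u\<in>W. degree_part s (f u))"
  by (induction W rule: infinite_finite_induct) (simp_all add: degree_part_zero degree_part_add)

lemma degree_part_homogeneous:
  assumes "p \<in> homogeneous d"
  shows "degree_part s p = (if s = d then p else 0)"
  using assms unfolding homogeneous_def
  by (induction rule: fa.span_induct_alt)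
    (auto simp: degree_part_zero degree_part_add degree_part_scale degree_part_mon)

lemma word_degree_simps [simp]: "word_degree [] = 0" "word_degree (x # u) = snd x + word_degree u"
  "word_degree (u @ v) = word_degree u + word_degree v"
  by (simp_all add: word_degree_def)

lemma homogeneous_mon: "word_degree u = d \<Longrightarrow> mon u \<in> homogeneous d"
  by (auto simp: homogeneous_def intro: fa.span_base)

lemma homogeneous_mon_mult:
  assumes "p \<in> homogeneous d"
  shows "mon u * p \<in> homogeneous (word_degree u + d)"
  using assms unfolding homogeneous_def
  by (rule fa_span_mult_left) (auto simp: mon_mult intro!: fa.span_base)

lemma homogeneous_relator: "lie_relator x y * mon v \<in> homogeneous (snd x + snd y + word_degree v)"
proof -
  obtain a i b j where xy: "x = (a, i)" "y = (b, j)" by (cases x; cases y)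
  have "lie_relator x y * mon v = mon ((a, i) # (b, j) # v)
      - fa_scale ((- 1) ^ (osp_parity a * osp_parity b)) (mon ((b, j) # (a, i) # v))
      - fa_scale (osp_coeff a b) (mon ((osp_letter a b, i + j) # v))"
    by (simp add: xy lie_relator_eq left_diff_distrib fa_scale_mult_left mon_mult)
  also have "\<dots> \<in> homogeneous (snd x + snd y + word_degree v)"
    unfolding homogeneous_def
    by (intro fa.span_diff fa.span_scale homogeneous_mon[unfolded homogeneous_def]) (simp_all add: xy)
  finally show ?thesis .
qed

lemma t_homogeneous_subset: "t_homogeneous s \<subseteq> homogeneous s"
proof
  fix p assume p: "p \<in> t_homogeneous s"
  have "p = fac.lift (\<lambda>w. mon (letters w)) p"
    by (rule poly_mapping_eqI)
       (simp add: fac.lift_def lookup_sum lookup_single in_keys_iff when_def fa_scale_single)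
  also have "\<dots> \<in> homogeneous s"
    unfolding fac.lift_def homogeneous_def
    using p by (intro fa.span_sum fa.span_scale homogeneous_mon[unfolded homogeneous_def])
      (auto simp: t_homogeneous_def word_degree_def)
  finally show "p \<in> homogeneous s" .
qed

lemma mon_t_homogeneous: "word_degree u = s \<Longrightarrow> mon u \<in> t_homogeneous s"
  by (auto simp: t_homogeneous_def word_degree_def)

lemma inj_mon: "inj mon"
proof (rule injI)
  fix u v :: "'a list" assume "mon u = mon v"
  then have "Poly_Mapping.keys (mon u) = Poly_Mapping.keys (mon v)" by simp
  then show "u = v" by simp
qed

lemma (in complex_vector_space) span_finite_Un_subspace:
  assumes "finite W" "subspace M" "p \<in> span (f ` W \<union> M)"
  shows "\<exists>c. p - (\<Sum>u\<in>W. c u *s f u) \<in> M"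
  using assms(3)
proof (induction rule: span_induct_alt)
  case base
  then show ?case using assms(2) by (intro exI[of _ "\<lambda>_. 0"]) (simp add: subspace_0)
next
  case (step d s q)
  then obtain c where c: "q - (\<Sum>u\<in>W. c u *s f u) \<in> M" by blast
  show ?case
  proof (cases "s \<in> M")
    case True
    then have "d *s s + (q - (\<Sum>u\<in>W. c u *s f u)) \<in> M"
      using c assms(2) by (intro subspace_add subspace_scale)
    then show ?thesis by (auto simp: add_diff_eq)
  next
    case False
    then obtain a where a: "a \<in> W" "s = f a" using step(1) by auto
    have "(\<Sum>u\<in>W. (if u = a then d + c u else c u) *s f u) =
        (\<Sum>u\<in>W. (if u = a then d else 0) *s f u) + (\<Sum>u\<in>W. c u *s f u)"
      by (simp add: scale_left_distrib flip: sum.distrib) (intro sum.cong, auto simp: scale_left_distrib)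
    also have "(\<Sum>u\<in>W. (if u = a then d else 0) *s f u) = (\<Sum>u\<in>W. if u = a then d *s f u else 0)"
      by (intro sum.cong) auto
    also have "\<dots> = d *s s" using a assms(1) by simp
    finally show ?thesis using c
      by (intro exI[of _ "\<lambda>u. if u = a then d + c u else c u"]) simp
  qed
qed

lemma length_eq_weight_gf: "of_nat (length us) = weight_gf us 1 1"
  by (induction us) (simp_all add: weight_gf_def)

text \<open>The relation holds on the tensor product up to lower degree: the error is a multiple of
  the lowest vector, which has degree 0.\<close>

definition deformable :: "nat \<Rightarrow> current_letter free_algebra \<Rightarrow> bool" where
  "deformable k r \<longleftrightarrow> (\<exists>d. r \<in> homogeneous d \<and> (ev (points k) r = 0 \<or>
     d > 0 \<and> (\<exists>a. ev (points k) r = fn_scale a (lowest (points k)))))"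

section \<open>Dimension at least 3^k by degeneration\<close>

locale weyl_presentation = cyclic_module +
  fixes k :: nat
  assumes h_in_L: "(osp_h, 0) \<in> L" and weight_rel: "gen osp_h 0 + of_nat k \<in> R"
    and twisted_subset: "twisted_letters \<subseteq> L"
    and deform: "r \<in> R \<Longrightarrow> deformable k r"
begin

text \<open>Relators evaluate to zero because the tensor product is a representation; for u * r the
  error is a multiple of the value of the word u, whose degree is smaller.\<close>

lemma generator_cases:
  assumes "g \<in> ideal_generators L R"
  shows "\<exists>d u. set u \<subseteq> L \<and> g \<in> homogeneous d \<and> (ev (points k) g = 0 \<or>
      word_degree u < d \<and> (\<exists>a. ev (points k) g = fn_scale a (ev (points k) (mon u))))"
  using assms
proof
  assume "g \<in> {u * lie_relator x y * v |u x y v. u \<in> monomials L \<and> v \<in> monomials L \<and> x \<in> L \<and> y \<in> L}"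
  then obtain u x y v where g: "g = mon u * (lie_relator x y * mon v)" "set u \<subseteq> L"
    by (auto simp: monomials_def mult.assoc)
  have "ev (points k) g = 0" by (simp only: g ev_mon_mult ev_relator wact3_zero)
  then show ?thesis using homogeneous_mon_mult[OF homogeneous_relator, of u x y v] g by blast
next
  assume "g \<in> {u * r |u r. u \<in> monomials L \<and> r \<in> R}"
  then obtain u r where g: "g = mon u * r" "set u \<subseteq> L" "r \<in> R" by (auto simp: monomials_def)
  obtain d where d: "r \<in> homogeneous d" "ev (points k) r = 0 \<or>
      d > 0 \<and> (\<exists>a. ev (points k) r = fn_scale a (lowest (points k)))" using deform[OF g(3)] unfolding deformable_def by blast
  have "g \<in> homogeneous (word_degree u + d)" unfolding g by (rule homogeneous_mon_mult[OF d(1)])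
  moreover have "ev (points k) g = 0 \<or> word_degree u < word_degree u + d \<and>
      (\<exists>a. ev (points k) g = fn_scale a (ev (points k) (mon u)))"
    using d(2)
  proof
    assume "ev (points k) r = 0"
    then have "ev (points k) g = 0" by (simp only: g ev_mon_mult wact3_zero)
    then show ?thesis ..
  next
    assume "d > 0 \<and> (\<exists>a. ev (points k) r = fn_scale a (lowest (points k)))"
    then show ?thesis by (auto simp: g ev_mon_mult ev_mon wact3_scale)
  qed
  ultimately show ?thesis using g(2) by blast
qed

lemma degree_part_N: "p \<in> N \<Longrightarrow> degree_part s p \<in> N"
  unfolding relation_ideal_def
proof (induction rule: fa.span_induct_alt)
  case base
  then show ?case by (simp add: degree_part_zero fa.span_zero)
next
  case (step c g p)
  obtain d where "g \<in> homogeneous d" using generator_cases[OF step(1)] by blast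
  then have "degree_part s g = (if s = d then g else 0)" by (rule degree_part_homogeneous)
  then have "degree_part s g \<in> fa.span (ideal_generators L R)"
    using fa.span_base[OF step(1)] fa.span_zero by (cases "s = d") simp_all
  then show ?case unfolding degree_part_add degree_part_scale
    using step(2) by (intro fa.span_add fa.span_scale)
qed

text \<open>The tensor product satisfies the defining relations up to terms of lower degree, so the
  leading terms of a spanning set of words suffice to span it.\<close>

lemma spanning_words_evaluate:
  assumes W: "\<And>u. u \<in> W \<Longrightarrow> set u \<subseteq> L" and span: "fa.span (monomials L) \<subseteq> fa.span (mon ` W \<union> N)"
    and u: "set u \<subseteq> L"
  shows "ev (points k) (mon u) \<in> fn.span ((\<lambda>u. ev (points k) (mon u)) ` W)"
  using u
proof (induction "word_degree u" arbitrary: u rule: less_induct)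
  case less
  let ?X = "fn.span ((\<lambda>u. ev (points k) (mon u)) ` W)"
  let ?s = "word_degree u"
  \<comment> \<open>A component of an element of \<open>N\<close> need not evaluate to zero, but it
    evaluates into images of words of smaller degree, which the induction hypothesis covers.\<close>
  have gN: "ev (points k) (degree_part ?s p) \<in> ?X" if "p \<in> N" for p
    using that unfolding relation_ideal_def
  proof (induction rule: fa.span_induct_alt)
    case base
    show ?case unfolding degree_part_zero ev_zero by (rule fn.span_zero)
  next
    case (step c g p)
    obtain d v where v: "set v \<subseteq> L" "g \<in> homogeneous d" "ev (points k) g = 0 \<or>
        word_degree v < d \<and> (\<exists>a. ev (points k) g = fn_scale a (ev (points k) (mon v)))"
      using generator_cases[OF step(1)] by blast
    have dp: "degree_part ?s g = (if ?s = d then g else 0)" by (rule degree_part_homogeneous[OF v(2)])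
    have "ev (points k) (degree_part ?s g) \<in> ?X"
    proof (cases "?s = d \<and> ev (points k) g \<noteq> 0")
      case True
      then obtain a where "word_degree v < ?s" "ev (points k) g = fn_scale a (ev (points k) (mon v))"
        using v(3) by blast
      then show ?thesis using less(1)[of v] v(1) True dp by (simp add: fn.span_scale)
    next
      case False
      then have "ev (points k) (degree_part ?s g) = 0"
        unfolding dp using ev_zero by (cases "?s = d") (simp_all only: if_True if_False simp_thms)
      then show ?thesis by (simp only: fn.span_zero)
    qed
    then show ?case
      unfolding degree_part_add degree_part_scale ev_add ev_scale
      using step by (intro fn.span_add fn.span_scale)
  qed
  have "ev (points k) (degree_part ?s p) \<in> ?X" if "p \<in> fa.span (mon ` W \<union> N)" for p
    using that
  proof (induction rule: fa.span_induct_alt)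
    case base
    show ?case unfolding degree_part_zero ev_zero by (rule fn.span_zero)
  next
    case (step c g p)
    have "ev (points k) (degree_part ?s g) \<in> ?X"
    proof (cases "g \<in> N")
      case True
      then show ?thesis by (rule gN)
    next
      case False
      then obtain v where "g = mon v" "v \<in> W" using step(1) by auto
      then show ?thesis unfolding degree_part_mon
        using fn.span_zero by (auto simp only: degree_part_mon ev_zero intro: fn.span_base split: if_splits)
    qed
    then show ?case
      unfolding degree_part_add degree_part_scale ev_add ev_scale
      using step by (intro fn.span_add fn.span_scale)
  qed
  from this[of "mon u"] show ?case
    using span mono_in_span[OF less(2)] by (auto simp: degree_part_mon)
qed

lemma spanning_words_card:
  assumes "finite W" "\<And>u. u \<in> W \<Longrightarrow> set u \<subseteq> L" "fa.span (monomials L) \<subseteq> fa.span (mon ` W \<union> N)"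
  shows "3 ^ k \<le> card W"
proof -
  let ?T = "(\<lambda>u. ev (points k) (mon u)) ` W"
  have "word_images k twisted_letters \<subseteq> fn.span ?T"
    unfolding word_images_def
    using spanning_words_evaluate[OF assms(2,3)] twisted_subset by (intro fn.span_minimal) auto
  then have "3 ^ k \<le> card ?T"
    using delta_word_images assms(1) by (intro card_ge_of_span_deltas) auto
  also have "\<dots> \<le> card W" using assms(1) by (rule card_image_le)
  finally show ?thesis .
qed

text \<open>A relation with a nonzero coefficient would allow one word to be dropped, leaving fewer
  than 3^k spanning words.\<close>

lemma spanning_words_independent:
  assumes W: "finite W" "\<And>u. u \<in> W \<Longrightarrow> set u \<subseteq> L" "fa.span (monomials L) \<subseteq> fa.span (mon ` W \<union> N)"
    and card: "card W \<le> 3 ^ k"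
    and c: "(\<Sum>u\<in>W. fa_scale (c u) (mon u)) \<in> N" and j: "j \<in> W"
  shows "c j = 0"
proof (rule ccontr)
  assume cj: "c j \<noteq> 0"
  let ?S = "fa.span (mon ` (W - {j}) \<union> N)"
  have "(\<Sum>u\<in>W. fa_scale (c u) (mon u)) - (\<Sum>u\<in>W - {j}. fa_scale (c u) (mon u)) \<in> ?S"
  proof (rule fa.span_diff)
    show "(\<Sum>u\<in>W. fa_scale (c u) (mon u)) \<in> ?S" using c by (intro fa.span_base) simp
    show "(\<Sum>u\<in>W - {j}. fa_scale (c u) (mon u)) \<in> ?S"
      by (intro fa.span_sum fa.span_scale fa.span_base) auto
  qed
  moreover have "(\<Sum>u\<in>W. fa_scale (c u) (mon u)) = fa_scale (c j) (mon j) + (\<Sum>u\<in>W - {j}. fa_scale (c u) (mon u))"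
    using W(1) j by (rule sum.remove)
  ultimately have "fa_scale (c j) (mon j) \<in> ?S" by simp
  from fa.span_scale[OF this, of "inverse (c j)"] have "mon j \<in> ?S" using cj by simp
  then have "mon ` W \<union> N \<subseteq> ?S" by (auto intro: fa.span_base)
  then have "fa.span (mon ` W \<union> N) \<subseteq> ?S" by (intro fa.span_minimal) simp_all
  then have "3 ^ k \<le> card (W - {j})" using W by (intro spanning_words_card) auto
  moreover have "card (W - {j}) < card W" using W(1) j by (intro card_Diff1_less) auto
  ultimately show False using card by linarith
qed

section \<open>Characters read off a basis of words\<close>

lemma weight_mon:
  assumes "set u \<subseteq> L"
  shows "gen osp_h 0 * mon u - fa_scale (of_int (word_weight u - int k)) (mon u) \<in> N"
  using assms
proof (induction u)
  case Nil
  have "1 * (gen osp_h 0 + of_nat k) \<in> N"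
    using weight_rel mon_in_monomials[of "[]" L]
    by (intro relation_ideal_relation fa.span_base) (simp_all add: mon_Nil)
  then show ?case by (simp add: mon_Nil word_weight_def fa_scale_def single_uminus)
next
  case (Cons x u)
  obtain y i where x: "x = (y, i)" by (cases x)
  have u: "set u \<subseteq> L" and xL: "x \<in> L" using Cons.prems by auto
  have c: "osp_coeff osp_h y = of_int (osp_weight y)" "y \<noteq> osp_h \<Longrightarrow> osp_letter osp_h y = y"
    by (cases y; simp)+
  have letter: "osp_letter osp_h y = y" by (cases y) simp_all
  have 1: "lie_relator (osp_h, 0) x * mon u \<in> N"
    using h_in_L xL u by (intro relation_ideal_relator fa.span_base mon_in_monomials)
  have 2: "mon [x] * (gen osp_h 0 * mon u - fa_scale (of_int (word_weight u - int k)) (mon u)) \<in> N"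
    using Cons.IH[OF u] xL by (intro relation_ideal_mult) simp_all
  have "lie_relator (osp_h, 0) x * mon u
      + mon [x] * (gen osp_h 0 * mon u - fa_scale (of_int (word_weight u - int k)) (mon u)) \<in> N"
    by (rule fa.subspace_add[OF subspace_relation_ideal 1 2])
  also have "lie_relator (osp_h, 0) x * mon u
      + mon [x] * (gen osp_h 0 * mon u - fa_scale (of_int (word_weight u - int k)) (mon u))
      = gen osp_h 0 * mon (x # u) - fa_scale (of_int (word_weight (x # u) - int k)) (mon (x # u))"
    by (simp add: x lie_relator_eq c letter left_diff_distrib right_diff_distrib fa_scale_mult_left fa_scale_mult_right
        mon_mult word_weight_def fa.scale_left_distrib fa.scale_left_diff_distrib algebra_simps)
  finally show ?case .
qed

text \<open>The hypothesis at x = q = 1 says that there are 3^k words in all. The lower bound then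
  makes them distinct and independent modulo \<open>N\<close>, so \<open>us1\<close> is a basis of
  homogeneous weight vectors of the subquotient. Division by x^k restores the weight -k of the
  vacuum.\<close>

lemma graded_char_split_words:
  assumes sw: "split_words L N V us1 us2" and gf: "weight_gf us1 1 1 + weight_gf us2 1 1 = 3 ^ k"
  shows "finite_weight_module (V, N)"
    and "x \<noteq> 0 \<Longrightarrow> graded_char (V, N) x q = weight_gf us1 x q / x ^ k"
proof -
  let ?W = "set us1 \<union> set us2"
  have words: "\<And>u. u \<in> ?W \<Longrightarrow> set u \<subseteq> L"
    and span: "fa.span (monomials L) \<subseteq> fa.span (mon ` ?W \<union> N)"
    and sub: "\<And>u. u \<in> set us1 \<Longrightarrow> mon u \<in> fa.span (V \<union> N)"
    and V: "V \<subseteq> fa.span (mon ` set us1 \<union> N)"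
    using sw unfolding split_words_def by blast+
  have "(of_nat (length us1 + length us2) :: complex) = of_nat (3 ^ k)"
    using gf by (simp add: length_eq_weight_gf)
  then have len: "length us1 + length us2 = 3 ^ k" by (simp only: of_nat_eq_iff)
  have "card ?W = card (set (us1 @ us2))" by simp
  then have cW: "card ?W \<le> 3 ^ k"
    using card_length[of "us1 @ us2"] len by simp
  moreover have "3 ^ k \<le> card ?W"
    by (rule spanning_words_card[OF _ words span]) simp_all
  ultimately have "card (set (us1 @ us2)) = length (us1 @ us2)" using len by simp
  then have "distinct (us1 @ us2)" by (rule card_distinct)
  then have dist: "distinct us1" by simp
  have indep: "c u = 0" if "(\<Sum>u\<in>set us1. fa_scale (c u) (mon u)) \<in> N" "u \<in> set us1" for c u
  proof -
    let ?c = "\<lambda>u. if u \<in> set us1 then c u else 0"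
    have "(\<Sum>u\<in>?W. fa_scale (?c u) (mon u)) = (\<Sum>u\<in>set us1. fa_scale (c u) (mon u))"
      by (rule sum.mono_neutral_cong_right) auto
    then have "?c u = 0"
      using that by (intro spanning_words_independent[OF _ words span cW]) auto
    then show ?thesis using that(2) by simp
  qed
  have spN: "fa.subspace N" by (rule subspace_relation_ideal)
  have hN: "gen osp_h 0 * p \<in> N" if "p \<in> N" for p
    using relation_ideal_mult[of "[(osp_h, 0)]" L p R] h_in_L that by simp
  define g where "g u = (word_degree u, word_weight u - int k)" for u
  let ?B = "\<lambda>s m. {u \<in> set us1. g u = (s, m)}"
  have VN: "p \<in> fa.span (mon ` set us1 \<union> N)" if "p \<in> fa.span (V \<union> N)" for p
  proof -
    have "fa.span (V \<union> N) \<subseteq> fa.span (mon ` set us1 \<union> N)"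
      using V by (intro fa.span_minimal) (auto intro: fa.span_base)
    then show ?thesis using that by blast
  qed
  have B_sub: "mon u \<in> weight_space (V, N) s m" if "u \<in> ?B s m" for u s m
  proof -
    have u: "u \<in> set us1" "word_degree u = s" "m = word_weight u - int k" using that by (auto simp: g_def)
    have "mon u - mon u \<in> N" using spN by (simp add: fa.subspace_0)
    then have "\<exists>p'\<in>t_homogeneous s. mon u - p' \<in> N" using mon_t_homogeneous[OF u(2)] by blast
    moreover have "gen osp_h 0 * mon u - fa_scale (of_int m) (mon u) \<in> N"
      using weight_mon[of u] words u by blast
    ultimately show ?thesis using sub[OF u(1)] by (simp add: weight_space_def)
  qed
  have N_sub: "N \<subseteq> weight_space (V, N) s m" for s m
  proof
    fix p assume p: "p \<in> N"
    have "\<exists>p'\<in>t_homogeneous s. p - p' \<in> N"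
      using p by (intro bexI[of _ 0]) (simp_all add: t_homogeneous_def)
    moreover have "gen osp_h 0 * p - fa_scale (of_int m) p \<in> N"
      using hN[OF p] p by (intro fa.subspace_diff[OF spN] fa.subspace_scale[OF spN])
    ultimately show "p \<in> weight_space (V, N) s m"
      using p by (auto simp: weight_space_def intro: fa.span_base)
  qed
  have sub_B: "weight_space (V, N) s m \<subseteq> fa.span (mon ` ?B s m \<union> N)" for s m
  proof
    fix p assume "p \<in> weight_space (V, N) s m"
    then obtain p' where p: "p \<in> fa.span (V \<union> N)" "p' \<in> t_homogeneous s" "p - p' \<in> N"
      "gen osp_h 0 * p - fa_scale (of_int m) p \<in> N" by (auto simp: weight_space_def)
    obtain c where c: "p - (\<Sum>u\<in>set us1. fa_scale (c u) (mon u)) \<in> N"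
      using fac.span_finite_Un_subspace[OF _ spN VN[OF p(1)]] by auto
    let ?S = "\<Sum>u\<in>set us1. fa_scale (c u) (mon u)"
    \<comment> \<open>A word of the wrong degree is excluded by comparing components of that degree,
      one of the wrong weight by applying h_0 - m, which multiplies its coefficient by a nonzero
      number.\<close>
    have zero: "c u = 0" if u: "u \<in> set us1" "g u \<noteq> (s, m)" for u
    proof (cases "word_degree u = s")
      case False
      let ?d = "word_degree u"
      have "(p - ?S) - (p - p') \<in> N" using c p(3) by (rule fa.subspace_diff[OF spN])
      then have "degree_part ?d (p' - ?S) \<in> N" by (intro degree_part_N) simp
      moreover have "degree_part ?d p' = 0"
        using degree_part_homogeneous[of p' s ?d] t_homogeneous_subset p(2) False by auto
      moreover have "degree_part ?d ?S = (\<Sum>v\<in>set us1. fa_scale (if word_degree v = ?d then c v else 0) (mon v))"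
        unfolding degree_part_sum by (intro sum.cong) (auto simp: degree_part_scale degree_part_mon)
      ultimately have "0 - (\<Sum>v\<in>set us1. fa_scale (if word_degree v = ?d then c v else 0) (mon v)) \<in> N"
        by (simp add: degree_part_diff)
      then have "(\<Sum>v\<in>set us1. fa_scale (if word_degree v = ?d then c v else 0) (mon v)) \<in> N"
        using fa.subspace_neg[OF spN] by fastforce
      from indep[OF this u(1)] show ?thesis by simp
    next
      case True
      then have m: "word_weight u - int k \<noteq> m" using u(2) by (simp add: g_def)
      let ?wt = "\<lambda>v. of_int (word_weight v - int k) :: complex"
      have 1: "(gen osp_h 0 * p - fa_scale (of_int m) p)
          - (gen osp_h 0 * (p - ?S) - fa_scale (of_int m) (p - ?S)) \<in> N"
        by (rule fa.subspace_diff[OF spN p(4) fa.subspace_diff[OF spN hN[OF c] fa.subspace_scale[OF spN c]]])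
      have 2: "(\<Sum>v\<in>set us1. fa_scale (c v) (gen osp_h 0 * mon v - fa_scale (?wt v) (mon v))) \<in> N"
        using weight_mon words by (intro fa.subspace_sum[OF spN] fa.subspace_scale[OF spN]) blast
      have "(gen osp_h 0 * p - fa_scale (of_int m) p)
          - (gen osp_h 0 * (p - ?S) - fa_scale (of_int m) (p - ?S))
          - (\<Sum>v\<in>set us1. fa_scale (c v) (gen osp_h 0 * mon v - fa_scale (?wt v) (mon v)))
        = (\<Sum>v\<in>set us1. fa_scale (c v * (?wt v - of_int m)) (mon v))"
      proof -
        have "(gen osp_h 0 * p - fa_scale (of_int m) p)
          - (gen osp_h 0 * (p - ?S) - fa_scale (of_int m) (p - ?S)) = gen osp_h 0 * ?S - fa_scale (of_int m) ?S"
          by (simp add: right_diff_distrib fa.scale_right_diff_distrib)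
        also have "\<dots> = (\<Sum>v\<in>set us1. gen osp_h 0 * fa_scale (c v) (mon v) - fa_scale (of_int m) (fa_scale (c v) (mon v)))"
          by (simp add: sum_distrib_left fa.scale_sum_right sum_subtractf)
        finally show ?thesis
          by (simp only: sum_subtractf[symmetric])
            (intro sum.cong refl, simp add: fa_scale_mult_right fa.scale_right_diff_distrib fa.scale_left_diff_distrib
              right_diff_distrib mult.commute)
      qed
      then have "(\<Sum>v\<in>set us1. fa_scale (c v * (?wt v - of_int m)) (mon v)) \<in> N"
        using fa.subspace_diff[OF spN 1 2] by simp
      from indep[OF this u(1)] have "c u * (?wt u - of_int m) = 0" .
      moreover have "?wt u - of_int m \<noteq> 0" using m by (simp only: right_minus_eq of_int_eq_iff not_False_eq_True)
      ultimately show ?thesis by simp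
    qed
    have "?S = (\<Sum>u\<in>?B s m. fa_scale (c u) (mon u))"
      using zero by (intro sum.mono_neutral_right) auto
    also have "\<dots> \<in> fa.span (mon ` ?B s m \<union> N)"
      by (intro fa.span_sum fa.span_scale fa.span_base) auto
    finally have "(p - ?S) + ?S \<in> fa.span (mon ` ?B s m \<union> N)"
      using c by (intro fa.span_add) (auto intro: fa.span_base)
    then show "p \<in> fa.span (mon ` ?B s m \<union> N)" by simp
  qed
  have mult: "weight_mult (V, N) s m = card (?B s m)" for s m
    unfolding weight_mult_def quotient_dim_def snd_conv
  proof (rule Least_equality)
    show "\<exists>B. B \<subseteq> weight_space (V, N) s m \<and> finite B \<and> card B = card (?B s m) \<and>
        weight_space (V, N) s m \<subseteq> fa.span (B \<union> N)"
      using B_sub sub_B[of s m] card_image[OF inj_on_subset[OF inj_mon subset_UNIV], of "?B s m"]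
      by (intro exI[of _ "mon ` ?B s m"]) auto
  next
    fix n assume "\<exists>B. B \<subseteq> weight_space (V, N) s m \<and> finite B \<and> card B = n \<and>
        weight_space (V, N) s m \<subseteq> fa.span (B \<union> N)"
    then obtain B where B: "finite B" "card B = n" "weight_space (V, N) s m \<subseteq> fa.span (B \<union> N)" by blast
    \<comment> \<open>The projection along \<open>N\<close> turns independence modulo
      \<open>N\<close> into plain independence, so that the exchange bound for spanning sets
      applies.\<close>
    obtain \<pi> where \<pi>: "\<And>u v. \<pi> (u + v) = \<pi> u + \<pi> v" "\<And>c v. \<pi> (fa_scale c v) = fa_scale c (\<pi> v)"
      "\<And>v. \<pi> v - v \<in> N" "\<And>v. v \<in> N \<Longrightarrow> \<pi> v = 0"
      using fac.projection_exists[OF spN] by blast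
    have \<pi>0: "\<pi> 0 = 0" using \<pi>(4) spN by (simp add: fa.subspace_0)
    have comb: "c u = 0" if S: "(\<Sum>u\<in>?B s m. fa_scale (c u) (\<pi> (mon u))) = 0" and u: "u \<in> ?B s m" for c u
    proof -
      let ?c = "\<lambda>u. if g u = (s, m) then c u else 0"
      have "(\<Sum>u\<in>?B s m. fa_scale (c u) (\<pi> (mon u) - mon u)) \<in> N"
        using \<pi>(3) by (intro fa.subspace_sum[OF spN] fa.subspace_scale[OF spN])
      then have "0 - (\<Sum>u\<in>?B s m. fa_scale (c u) (mon u)) \<in> N"
        by (simp only: fa.scale_right_diff_distrib sum_subtractf S)
      then have "(\<Sum>u\<in>?B s m. fa_scale (c u) (mon u)) \<in> N"
        using fa.subspace_neg[OF spN] by fastforce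
      moreover have "(\<Sum>u\<in>set us1. fa_scale (?c u) (mon u)) = (\<Sum>u\<in>?B s m. fa_scale (c u) (mon u))"
        by (rule sum.mono_neutral_cong_right) auto
      ultimately have "?c u = 0" using u by (intro indep) auto
      then show ?thesis using u by simp
    qed
    have inj: "inj_on (\<pi> \<circ> mon) (?B s m)"
    proof (rule inj_onI, rule ccontr)
      fix u v assume uv: "u \<in> ?B s m" "v \<in> ?B s m" "(\<pi> \<circ> mon) u = (\<pi> \<circ> mon) v" "u \<noteq> v"
      let ?c = "\<lambda>w. if w = u then 1 else if w = v then - 1 else 0 :: complex"
      have "(\<Sum>w\<in>?B s m. fa_scale (?c w) (\<pi> (mon w))) = (\<Sum>w\<in>{u, v}. fa_scale (?c w) (\<pi> (mon w)))"
        using uv by (intro sum.mono_neutral_right) auto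
      also have "\<dots> = 0" using uv(3,4) by (simp add: fa.scale_minus_left)
      finally have "?c u = 0" using uv(1) by (rule comb)
      then show False by simp
    qed
    have "fa.independent ((\<pi> \<circ> mon) ` ?B s m)"
    proof (rule fa.independent_if_scalars_zero)
      fix f x assume 0: "(\<Sum>x\<in>(\<pi> \<circ> mon) ` ?B s m. fa_scale (f x) x) = 0" and x: "x \<in> (\<pi> \<circ> mon) ` ?B s m"
      have "(\<Sum>u\<in>?B s m. fa_scale (f (\<pi> (mon u))) (\<pi> (mon u))) = 0"
        using 0 unfolding sum.reindex[OF inj] by (simp only: comp_def)
      from comb[OF this] show "f x = 0" using x by auto
    qed simp
    moreover have "(\<pi> \<circ> mon) ` ?B s m \<subseteq> fa.span (\<pi> ` B)"
    proof clarify
      fix u assume u: "u \<in> set us1" "g u = (s, m)"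
      then have "mon u \<in> fa.span (B \<union> N)" using B(3) B_sub by blast
      then have "\<pi> (mon u) \<in> fa.span (\<pi> ` B)"
      proof (induction rule: fa.span_induct_alt)
        case base
        then show ?case by (simp add: \<pi>0 fa.span_zero)
      next
        case (step c b p)
        have "\<pi> b \<in> fa.span (\<pi> ` B)"
          using step(1) \<pi>(4)[of b] by (auto intro: fa.span_base fa.span_zero)
        then show ?case unfolding \<pi> using step(2) by (intro fa.span_add fa.span_scale)
      qed
      then show "(\<pi> \<circ> mon) u \<in> fa.span (\<pi> ` B)" by simp
    qed
    ultimately have "card ((\<pi> \<circ> mon) ` ?B s m) \<le> card (\<pi> ` B)"
      using B(1) by (intro conjunct2[OF fa.independent_span_bound]) auto
    also have "\<dots> \<le> n" using card_image_le[OF B(1), of \<pi>] B(2) by simp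
    finally show "card (?B s m) \<le> n" unfolding card_image[OF inj] .
  qed
  show "finite_weight_module (V, N)"
    unfolding finite_weight_module_def prod.case
  proof (intro conjI)
    show "\<exists>B. finite B \<and> V \<subseteq> fa.span (B \<union> N)"
      using V by (intro exI[of _ "mon ` set us1"]) simp
    have "mon ` set us1 \<union> N \<subseteq> (\<Union>s m. weight_space (V, N) s m)"
    proof
      fix p assume "p \<in> mon ` set us1 \<union> N"
      then consider u where "u \<in> set us1" "p = mon u" | "p \<in> N" by auto
      then show "p \<in> (\<Union>s m. weight_space (V, N) s m)"
      proof cases
        case 1
        then have "p \<in> weight_space (V, N) (word_degree u) (word_weight u - int k)"
          using B_sub[of u] by (simp add: g_def)
        then show ?thesis by blast
      next
        case 2
        then show ?thesis using N_sub by blast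
      qed
    qed
    then show "V \<subseteq> fa.span (\<Union>s m. weight_space (V, N) s m)"
      using V fa.span_mono by blast
  qed
  assume x: "x \<noteq> 0"
  let ?f = "\<lambda>(s, m). q ^ s * x powi m"
  have nz: "{(s, m). weight_mult (V, N) s m \<noteq> 0} = g ` set us1"
    by (auto simp: mult image_iff) metis
  have "graded_char (V, N) x q = (\<Sum>y\<in>g ` set us1. of_nat (card {u \<in> set us1. g u = y}) * ?f y)"
    unfolding graded_char_def nz by (intro sum.cong) (auto simp: mult)
  also have "\<dots> = (\<Sum>y\<in>g ` set us1. \<Sum>u\<in>{u \<in> set us1. g u = y}. ?f (g u))"
    by (intro sum.cong) auto
  also have "\<dots> = (\<Sum>u\<in>set us1. ?f (g u))"
    by (rule sum.image_gen[symmetric]) simp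
  also have "\<dots> = (\<Sum>u\<in>set us1. q ^ word_degree u * x powi word_weight u / x ^ k)"
    using x by (intro sum.cong) (simp_all add: g_def power_int_diff)
  also have "\<dots> = weight_gf us1 x q / x ^ k"
    using dist by (simp add: weight_gf_def sum_list_distinct_conv_sum_set sum_divide_distrib)
  finally show "graded_char (V, N) x q = weight_gf us1 x q / x ^ k" .
qed

lemma graded_char_basis_words:
  assumes "basis_words L N V f1 f2" and "f1 1 1 + f2 1 1 = 3 ^ k"
  shows "finite_weight_module (V, N)" and "x \<noteq> 0 \<Longrightarrow> graded_char (V, N) x q = f1 x q / x ^ k"
proof -
  obtain us1 us2 where us: "split_words L N V us1 us2"
    "\<And>x q. x \<noteq> 0 \<Longrightarrow> weight_gf us1 x q = f1 x q" "\<And>x q. x \<noteq> 0 \<Longrightarrow> weight_gf us2 x q = f2 x q"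
    using assms(1) unfolding basis_words_def by blast
  have gf: "weight_gf us1 1 1 + weight_gf us2 1 1 = 3 ^ k" using us(2,3) assms(2) by simp
  show "finite_weight_module (V, N)" by (rule graded_char_split_words(1)[OF us(1) gf])
  show "x \<noteq> 0 \<Longrightarrow> graded_char (V, N) x q = f1 x q / x ^ k"
    using graded_char_split_words(2)[OF us(1) gf] us(2) by simp
qed

end

section \<open>The untwisted and the twisted Weyl modules\<close>

lemma homogeneous_gen: "gen y i \<in> homogeneous i"
  by (rule homogeneous_mon) simp

lemma homogeneous_zero: "gen osp_h 0 + of_nat m \<in> homogeneous 0" "gen osp_e 0 ^ m \<in> homogeneous 0"
proof -
  have "(of_nat m :: current_letter free_algebra) = fa_scale (of_nat m) (mon [])"
    by (simp add: fa_scale_def mon_Nil)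
  then show "gen osp_h 0 + of_nat m \<in> homogeneous 0"
    using homogeneous_mon[of "[(osp_h, 0)]" 0] homogeneous_mon[of "[]" 0]
    by (simp add: homogeneous_def fa.span_add fa.span_scale)
  show "gen osp_e 0 ^ m \<in> homogeneous 0"
    unfolding gen_power by (rule homogeneous_mon) (simp add: word_degree_def sum_list_replicate)
qed

lemma ev_relations:
  "ev (points k) (gen osp_f i) = 0" "ev (points k) (gen osp_gm i) = 0"
  "ev (points k) (gen osp_e 0 ^ (k + 1)) = 0" "ev (points k) (gen osp_h 0 + of_nat k) = 0"
  "\<exists>a. ev (points k) (gen osp_h i) = fn_scale a (lowest (points k))"
proof -
  show "ev (points k) (gen osp_f i) = 0" "ev (points k) (gen osp_gm i) = 0"
    using evact_lowest_zero[of osp_f] evact_lowest_zero[of osp_gm] by (simp_all add: ev_mon zero_fun_def)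
  have *: "wact3 zs (replicate j (osp_e, 0)) \<phi> = (evact osp_e (\<lambda>z. z ^ 0) zs ^^ j) \<phi>" for zs j \<phi>
    by (induction j) simp_all
  have "ev (points k) (gen osp_e 0 ^ (k + 1)) =
      (evact osp_e (\<lambda>z. z ^ 0) (points k) ^^ (k + 1)) (lowest (points k))"
    by (simp only: gen_power ev_mon *)
  also have "\<dots> = (\<lambda>_. 0)" by (rule evact_e_power) (rule points)
  finally show "ev (points k) (gen osp_e 0 ^ (k + 1)) = 0" by (simp only: zero_fun_def)
  show "\<exists>a. ev (points k) (gen osp_h i) = fn_scale a (lowest (points k))"
    by (rule exI[of _ "- (\<Sum>z\<leftarrow>points k. z ^ i)"]) (simp add: ev_mon evact_lowest_h fn_scale_def)
  have "(of_nat k :: current_letter free_algebra) = fa_scale (of_nat k) (mon [])"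
    by (simp add: fa_scale_def mon_Nil)
  then have "ev (points k) (gen osp_h 0 + of_nat k) =
      evact osp_h (\<lambda>z. z ^ 0) (points k) (lowest (points k)) + fn_scale (of_nat k) (lowest (points k))"
    by (simp only: ev_add ev_scale ev_mon wact3_simps)
  then show "ev (points k) (gen osp_h 0 + of_nat k) = 0"
    by (simp add: evact_lowest_h fn_scale_def fun_eq_iff points sum_list_triv)
qed

lemma deformable_relations:
  "y \<in> {osp_f, osp_gm} \<Longrightarrow> deformable k (gen y i)"
  "i > 0 \<Longrightarrow> deformable k (gen osp_h i)"
  "deformable k (gen osp_h 0 + of_nat k)"
  "deformable k (gen osp_e 0 ^ (k + 1))"
proof -
  show "deformable k (gen y i)" if "y \<in> {osp_f, osp_gm}"
    using that ev_relations(1,2)[of k i] homogeneous_gen[of y i] unfolding deformable_def by auto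
  show "deformable k (gen osp_h i)" if "i > 0"
    using that ev_relations(5)[of k i] homogeneous_gen[of osp_h i] unfolding deformable_def by blast
  show "deformable k (gen osp_h 0 + of_nat k)"
    unfolding deformable_def by (intro exI[of _ 0] conjI disjI1 homogeneous_zero ev_relations)
  show "deformable k (gen osp_e 0 ^ (k + 1))"
    unfolding deformable_def by (intro exI[of _ 0] conjI disjI1 homogeneous_zero ev_relations)
qed

lemma weyl_presentation_untwisted: "weyl_presentation UNIV (weyl_relations k) k"
proof -
  interpret cyclic_module UNIV "weyl_relations k" by (rule cyclic_module_untwisted)
  show ?thesis
  proof unfold_locales
    fix r assume "r \<in> weyl_relations k"
    then consider y i where "r = gen y i" "y \<in> {osp_f, osp_gm}" | i where "r = gen osp_h i" "i > 0"
      | "r = gen osp_h 0 + of_nat k" | "r = gen osp_e 0 ^ (k + 1)"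
      unfolding weyl_relations_def by auto
    then show "deformable k r"
      by cases (auto simp only: intro: deformable_relations)
  qed (auto simp: weyl_relations_def)
qed

lemma weyl_presentation_twisted: "weyl_presentation twisted_letters (twisted_weyl_relations k) k"
proof -
  interpret cyclic_module twisted_letters "twisted_weyl_relations k" by (rule cyclic_module_twisted)
  show ?thesis
  proof unfold_locales
    fix r assume "r \<in> twisted_weyl_relations k"
    then consider y i where "r = gen y i" "y \<in> {osp_f, osp_gm}" | i where "r = gen osp_h i" "i > 0"
      | "r = gen osp_h 0 + of_nat k" | "r = gen osp_e 0 ^ (k + 1)"
      unfolding twisted_weyl_relations_def by auto
    then show "deformable k r"
      by cases (auto simp only: intro: deformable_relations)
  qed (auto simp: twisted_weyl_relations_def twisted_letters_def)
qed

text \<open>The total dimensions. Submodule and quotient have dimensions 3^m and 2 * 3^m in one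
  order or the other, and together exactly 3^(m+1).\<close>

lemma PG_one: "PG 1 1 (2 * m) = 3 ^ m \<and> QG 1 1 m = 3 ^ m \<and> PG 1 1 (Suc (2 * m)) = 2 * 3 ^ m"
  by (induction m) simp_all

lemma weyl_nonpos:
  "finite_weight_module (weyl (- int k))"
  "x \<noteq> 0 \<Longrightarrow> graded_char (weyl (- int k)) x q = PG x (q / x ^ 2) (2 * k) / x ^ k"
proof -
  interpret weyl_presentation UNIV "weyl_relations k" k by (rule weyl_presentation_untwisted)
  have "weyl (- int k) = (fa.span (monomials UNIV), N)" by (simp add: weyl_def)
  then show "finite_weight_module (weyl (- int k))"
    "x \<noteq> 0 \<Longrightarrow> graded_char (weyl (- int k)) x q = PG x (q / x ^ 2) (2 * k) / x ^ k"
    using graded_char_basis_words[OF untwisted_words_nonpos[of k]] PG_one[of k] by simp_all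
qed

lemma weyl_pos:
  "finite_weight_module (weyl (int (Suc m)))"
  "x \<noteq> 0 \<Longrightarrow> graded_char (weyl (int (Suc m))) x q = x ^ Suc m * QG x (q / x ^ 2) m"
proof -
  interpret weyl_presentation UNIV "weyl_relations (Suc m)" "Suc m" by (rule weyl_presentation_untwisted)
  let ?V = "{u * gen osp_e 0 ^ Suc m | u. u \<in> fa.span (monomials {(y, i). y \<in> {osp_f, osp_gm} \<and> i \<ge> 1})}"
  have W: "weyl (int (Suc m)) = (?V, N)" by (simp add: weyl_def nat_add_distrib del: power_Suc)
  have one: "1 ^ (2 * Suc m) * QG 1 (1 / 1 ^ 2) m + PG 1 (1 / 1 ^ 2) (Suc (2 * m)) = 3 ^ Suc m"
    using PG_one[of m] by (simp del: PG.simps)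
  show "finite_weight_module (weyl (int (Suc m)))"
    unfolding W by (rule graded_char_basis_words(1)[OF untwisted_words_pos one])
  show "graded_char (weyl (int (Suc m))) x q = x ^ Suc m * QG x (q / x ^ 2) m" if "x \<noteq> 0"
    unfolding W graded_char_basis_words(2)[OF untwisted_words_pos one that] mult_2 power_add
    using that by (simp del: power_Suc PG.simps)
qed

lemma twisted_weyl_nonpos:
  "finite_weight_module (twisted_weyl (- int k))"
  "x \<noteq> 0 \<Longrightarrow> graded_char (twisted_weyl (- int k)) x q = QG (q / x) (x ^ 2) k / x ^ k"
proof -
  interpret weyl_presentation twisted_letters "twisted_weyl_relations k" k by (rule weyl_presentation_twisted)
  have "twisted_weyl (- int k) = (fa.span (monomials twisted_letters), N)" by (simp add: twisted_weyl_def)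
  then show "finite_weight_module (twisted_weyl (- int k))"
    "x \<noteq> 0 \<Longrightarrow> graded_char (twisted_weyl (- int k)) x q = QG (q / x) (x ^ 2) k / x ^ k"
    using graded_char_basis_words[OF twisted_words_nonpos[of k]] PG_one[of k] by simp_all
qed

lemma twisted_weyl_pos:
  "finite_weight_module (twisted_weyl (int (Suc m)))"
  "x \<noteq> 0 \<Longrightarrow> graded_char (twisted_weyl (int (Suc m))) x q = x ^ Suc m * PG (q / x) (x ^ 2) (Suc (2 * m))"
proof -
  interpret weyl_presentation twisted_letters "twisted_weyl_relations (Suc m)" "Suc m"
    by (rule weyl_presentation_twisted)
  let ?V = "{u * gen osp_e 0 ^ Suc m | u. u \<in> fa.span (monomials {(y, i). (y, i) \<in> twisted_letters \<and> i \<ge> 1})}"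
  have W: "twisted_weyl (int (Suc m)) = (?V, N)" by (simp add: twisted_weyl_def nat_add_distrib del: power_Suc)
  have one: "1 ^ (2 * Suc m) * PG (1 / 1) (1 ^ 2) (Suc (2 * m)) + QG (1 / 1) (1 ^ 2) m = 3 ^ Suc m"
    using PG_one[of m] by (simp del: PG.simps)
  show "finite_weight_module (twisted_weyl (int (Suc m)))"
    unfolding W by (rule graded_char_basis_words(1)[OF twisted_words_pos one])
  show "graded_char (twisted_weyl (int (Suc m))) x q = x ^ Suc m * PG (q / x) (x ^ 2) (Suc (2 * m))" if "x \<noteq> 0"
    unfolding W graded_char_basis_words(2)[OF twisted_words_pos one that] mult_2 power_add
    using that by (simp del: power_Suc PG.simps)
qed

section \<open>The Ram--Yip formula at t = 0\<close>

text \<open>The state of a walk is described by the number \<open>k\<close> of remaining steps and the current alcove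
  \<open>a\<close>: since the last step has label \<open>s\<^sub>0\<close>, the next step has label \<open>s\<^sub>1\<close> iff \<open>k\<close> is even, and it
  is directed to the left iff \<open>a\<close> and \<open>k\<close> have the same parity. The weight of a folding uses
  \<open>\<xi> = q\<^sup>k v\<^sup>2\<close>.\<close>

definition leftward :: "nat \<Rightarrow> int \<Rightarrow> bool" where
  "leftward k a \<longleftrightarrow> (even a \<longleftrightarrow> even k)"

text \<open>The next function is the contribution of a folding, without the factor
  \<open>v\<^sup>-\<^sup>1 (1 - v\<^sup>2)\<close>; the first argument selects the dagger version.\<close>

definition fold_weight :: "bool \<Rightarrow> nat \<Rightarrow> bool \<Rightarrow> complex \<Rightarrow> complex" where
  "fold_weight dag k pos \<xi> =
     (if even k then (if pos then 1 else \<xi>) / (1 - \<xi>)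
      else if dag then (if pos then 1 else \<xi> ^ 2) / (1 - \<xi> ^ 2)
      else \<xi> / (1 - \<xi> ^ 2))"

definition cross :: "nat \<Rightarrow> int \<Rightarrow> int" where
  "cross k a = (if leftward k a then a - 1 else a + 1)"

text \<open>The total contribution of all ways to complete a walk from alcove \<open>a\<close> in
  \<open>k\<close> steps. Counting remaining steps makes the parameter of a folding depend on k
  alone, since xi_j = q^(l+1-j) v^2.\<close>

fun walk_sum :: "bool \<Rightarrow> complex \<Rightarrow> complex \<Rightarrow> complex \<Rightarrow> nat \<Rightarrow> int \<Rightarrow> complex" where
  "walk_sum dag x q v 0 a = v powi alcove_d a * x powi alcove_wt a"
| "walk_sum dag x q v (Suc k) a = walk_sum dag x q v k (cross (Suc k) a)
     + (1 - v ^ 2) / v * fold_weight dag (Suc k) (leftward (Suc k) a) (q ^ Suc k * v ^ 2)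
       * walk_sum dag x q v k a"

fun walk_lim :: "bool \<Rightarrow> complex \<Rightarrow> complex \<Rightarrow> nat \<Rightarrow> int \<Rightarrow> complex" where
  "walk_lim dag x q 0 a = x powi alcove_wt a"
| "walk_lim dag x q (Suc k) a = walk_lim dag x q k (cross (Suc k) a)
     + (if leftward (Suc k) a then (if dag \<or> odd k then 1 else 0)
        else if dag \<and> even k then 0 else q ^ Suc k)
       * walk_lim dag x q k a"

text \<open>For k = 0 the factor cancels v^d of the final alcove; for the complete walk, starting at
  alcove 0, it is v to the power \<open>macdonald_eps n\<close>.\<close>

definition normalized_walk_sum ::
    "bool \<Rightarrow> complex \<Rightarrow> complex \<Rightarrow> complex \<Rightarrow> nat \<Rightarrow> int \<Rightarrow> complex" where
  "normalized_walk_sum dag x q v k a =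
     (if leftward k a then 1 else inverse v) * walk_sum dag x q v k a"

text \<open>Crossing changes the parity of the alcove along with that of k and keeps the direction;
  folding changes only that of k and reverses it.\<close>

lemma leftward_cross: "leftward k (cross (Suc k) a) \<longleftrightarrow> leftward (Suc k) a"
  and leftward_stay: "leftward k a \<longleftrightarrow> \<not> leftward (Suc k) a"
  by (auto simp: leftward_def cross_def)

text \<open>After normalization only \<open>t = v\<^sup>2\<close> occurs: a folding reverses the direction, so the
  factors \<open>v\<^sup>-\<^sup>1\<close> of the foldings are absorbed in pairs.\<close>

definition fold_factor :: "bool \<Rightarrow> complex \<Rightarrow> complex \<Rightarrow> nat \<Rightarrow> bool \<Rightarrow> complex" where
  "fold_factor dag q t k pos =
     (1 - t) * (if even k then (if pos then 1 else q ^ k) / (1 - q ^ k * t)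
      else if dag then (if pos then 1 else q ^ k * q ^ k * t) / (1 - (q ^ k * t) ^ 2)
      else (if pos then q ^ k * t else q ^ k) / (1 - (q ^ k * t) ^ 2))"

text \<open>A leftward folding turns rightward, and its v^(-1) is the one in the normalization of
  the new state. A rightward folding leaves v^(-2), which is cancelled because the weight of a
  negative folding is divisible by xi.\<close>

lemma normalized_walk_sum_Suc:
  assumes "v \<noteq> 0"
  shows "normalized_walk_sum dag x q v (Suc k) a =
      normalized_walk_sum dag x q v k (cross (Suc k) a)
      + fold_factor dag q (v ^ 2) (Suc k) (leftward (Suc k) a) * normalized_walk_sum dag x q v k a"
proof -
  let ?K = "fold_weight dag (Suc k) (leftward (Suc k) a) (q ^ Suc k * v ^ 2)"
  define S1 S2 where "S1 = walk_sum dag x q v k (cross (Suc k) a)" and "S2 = walk_sum dag x q v k a"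
  have S: "walk_sum dag x q v (Suc k) a = S1 + (1 - v ^ 2) / v * ?K * S2"
    by (simp add: S1_def S2_def)
  show ?thesis
  proof (cases "leftward (Suc k) a")
    case True
    then have l: "\<not> leftward k a" "leftward k (cross (Suc k) a)"
      using leftward_stay[of k a] by (simp_all add: leftward_cross)
    have "fold_factor dag q (v ^ 2) (Suc k) (leftward (Suc k) a) = (1 - v ^ 2) * ?K"
      using True by (simp add: fold_factor_def fold_weight_def)
    then show ?thesis
      unfolding normalized_walk_sum_def S S1_def[symmetric] S2_def[symmetric]
      using True l by (simp only: if_True if_False) (simp add: divide_inverse mult_ac)
  next
    case False
    then have l: "leftward k a" "\<not> leftward k (cross (Suc k) a)"
      using leftward_stay[of k a] by (simp_all add: leftward_cross)
    have "v * v * fold_factor dag q (v ^ 2) (Suc k) (leftward (Suc k) a) = (1 - v ^ 2) * ?K"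
      using False by (simp add: fold_factor_def fold_weight_def power2_eq_square)
    then have F: "(1 - v ^ 2) / v * ?K / v = fold_factor dag q (v ^ 2) (Suc k) (leftward (Suc k) a)"
      using assms by (simp add: field_simps)
    then have W: "fold_factor dag q (v ^ 2) (Suc k) (leftward (Suc k) a) * S2 =
        inverse v * ((1 - v ^ 2) / v * ?K * S2)"
      unfolding F[symmetric] by (simp only: divide_inverse mult_ac)
    show ?thesis
      unfolding normalized_walk_sum_def S S1_def[symmetric] S2_def[symmetric] if_not_P[OF False] if_not_P[OF l(2)] if_P[OF l(1)] mult_1
      by (simp only: W distrib_left)
  qed
qed

lemma normalized_walk_sum_0: "v \<noteq> 0 \<Longrightarrow> normalized_walk_sum dag x q v 0 a = x powi alcove_wt a"
  by (simp add: normalized_walk_sum_def leftward_def alcove_d_def)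

lemma fold_factor_tendsto:
  "((\<lambda>t. fold_factor dag q t k pos) \<longlongrightarrow>
     (if pos then (if dag \<or> even k then 1 else 0) else if dag \<and> odd k then 0 else q ^ k)) (at 0)"
proof -
  have c1: "isCont (\<lambda>t. (1 - t) * (a / (1 - b * t))) 0"
    and c2: "isCont (\<lambda>t. (1 - t) * (a / (1 - (b * t) ^ 2))) 0"
    and c3: "isCont (\<lambda>t. (1 - t) * (a * t / (1 - (b * t) ^ 2))) 0" for a b :: complex
    by (intro continuous_intros; simp)+
  have "isCont (\<lambda>t. fold_factor dag q t k pos) 0"
    using c1 c2 c3[of "q ^ k" "q ^ k"] c3[of "q ^ k * q ^ k" "q ^ k"] unfolding fold_factor_def
    by (cases "even k"; cases dag; cases pos) (simp_all only: if_True if_False simp_thms)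
  moreover have "fold_factor dag q 0 k pos =
      (if pos then (if dag \<or> even k then 1 else 0) else if dag \<and> odd k then 0 else q ^ k)"
    unfolding fold_factor_def by (simp add: zero_power2)
  ultimately show ?thesis by (simp only: isCont_def)
qed

lemma normalized_walk_sum_tendsto:
  "((\<lambda>t. normalized_walk_sum dag x q (csqrt t) k a) \<longlongrightarrow> walk_lim dag x q k a) (at 0)"
proof (induction k arbitrary: a)
  case 0
  have "\<forall>\<^sub>F t in at 0. x powi alcove_wt a = normalized_walk_sum dag x q (csqrt t) 0 a"
    using eventually_neq_at_within[of 0 0 UNIV]
    by (rule eventually_mono) (simp add: normalized_walk_sum_0)
  then show ?case by (auto intro: Lim_transform_eventually)
next
  case (Suc k)
  let ?f = "\<lambda>t. normalized_walk_sum dag x q (csqrt t) k (cross (Suc k) a)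
      + fold_factor dag q t (Suc k) (leftward (Suc k) a) * normalized_walk_sum dag x q (csqrt t) k a"
  have "(?f \<longlongrightarrow> walk_lim dag x q (Suc k) a) (at 0)"
    unfolding walk_lim.simps
    using fold_factor_tendsto[of dag q "Suc k" "leftward (Suc k) a"]
    by (intro tendsto_add tendsto_mult Suc) (simp only: even_Suc not_not)
  moreover have "\<forall>\<^sub>F t in at 0. ?f t = normalized_walk_sum dag x q (csqrt t) (Suc k) a"
    using eventually_neq_at_within[of 0 0 UNIV]
    by (rule eventually_mono) (simp add: normalized_walk_sum_Suc)
  ultimately show ?case by (rule Lim_transform_eventually)
qed

section \<open>Solution of the recursion at t = 0\<close>

lemma alcove_wt_shift: "x \<noteq> 0 \<Longrightarrow> x powi alcove_wt (2 * c) = x powi c"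
  "x \<noteq> 0 \<Longrightarrow> x powi alcove_wt (2 * c - 1) = x powi c"
  by (simp_all add: alcove_wt_def)

lemma cross_simps:
  "cross (Suc (2 * m)) (2 * c - 1) = 2 * (c - 1)"
  "cross (Suc (2 * m)) (2 * c) = 2 * (c + 1) - 1"
  "cross (Suc (Suc (2 * m))) (2 * c) = 2 * c - 1"
  "cross (Suc (Suc (2 * m))) (2 * c - 1) = 2 * c"
  by (simp_all add: cross_def leftward_def)

lemma leftward_simps:
  "leftward (Suc (2 * m)) (2 * c - 1)"
  "\<not> leftward (Suc (2 * m)) (2 * c)"
  "leftward (Suc (Suc (2 * m))) (2 * c)"
  "\<not> leftward (Suc (Suc (2 * m))) (2 * c - 1)"
  by (simp_all add: leftward_def)

lemma walk_lim_odd: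
  "walk_lim dag x q (Suc (2 * m)) (2 * c - 1) =
    walk_lim dag x q (2 * m) (2 * (c - 1)) + (if dag then walk_lim dag x q (2 * m) (2 * c - 1) else 0)"
  "walk_lim dag x q (Suc (2 * m)) (2 * c) =
    walk_lim dag x q (2 * m) (2 * (c + 1) - 1)
    + (if dag then 0 else q ^ Suc (2 * m) * walk_lim dag x q (2 * m) (2 * c))"
  unfolding walk_lim.simps cross_simps using leftward_simps by simp_all

lemma walk_lim_even:
  "walk_lim dag x q (Suc (Suc (2 * m))) (2 * c) =
    walk_lim dag x q (Suc (2 * m)) (2 * c - 1) + walk_lim dag x q (Suc (2 * m)) (2 * c)"
  "walk_lim dag x q (Suc (Suc (2 * m))) (2 * c - 1) =
    walk_lim dag x q (Suc (2 * m)) (2 * c)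
    + q ^ Suc (Suc (2 * m)) * walk_lim dag x q (Suc (2 * m)) (2 * c - 1)"
  unfolding walk_lim.simps(2)[of _ _ _ "Suc (2 * m)"] cross_simps using leftward_simps by simp_all

text \<open>Leftward states carry P and rightward states Q. Crossing a wall corresponds to the
  quotient and folding to the submodule in the recursion of the modules; where the folding
  coefficient vanishes, the index of Q does not change. Alcoves 2c and 2c - 1 share the weight c, so
  c enters only through x^c.\<close>

lemma walk_lim_dagger:
  fixes x q :: complex
  assumes x: "x \<noteq> 0"
  defines "P \<equiv> PG x (q ^ 2 / x ^ 2)" and "Q \<equiv> QG x (q ^ 2 / x ^ 2)"
  shows "walk_lim True x q (2 * m) (2 * c) = x powi c / x ^ m * P (2 * m) \<and>
    walk_lim True x q (2 * m) (2 * c - 1) = x powi c * x ^ m * Q m \<and>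
    walk_lim True x q (Suc (2 * m)) (2 * c - 1) = x powi c / x ^ Suc m * P (Suc (2 * m)) \<and>
    walk_lim True x q (Suc (2 * m)) (2 * c) = x powi c * x ^ Suc m * Q m"
proof -
  have X: "x powi (a + 1) = x powi a * x" "x powi (a - 1) = x powi a / x" for a
    using x by (simp_all add: power_int_add power_int_diff)
  have PS: "P (Suc k) = x ^ Suc k * Q (k div 2) + P k"
    and QS: "Q (Suc k) = (q ^ 2 / x ^ 2) ^ Suc k * P (Suc (2 * k)) + Q k"
    and init: "P 0 = 1" "Q 0 = 1" for k
    by (simp_all add: P_def Q_def)
  have odd: "walk_lim True x q (Suc (2 * m)) (2 * c - 1) = x powi c / x ^ Suc m * P (Suc (2 * m)) \<and>
      walk_lim True x q (Suc (2 * m)) (2 * c) = x powi c * x ^ Suc m * Q m"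
    if "\<And>c. walk_lim True x q (2 * m) (2 * c) = x powi c / x ^ m * P (2 * m)"
      "\<And>c. walk_lim True x q (2 * m) (2 * c - 1) = x powi c * x ^ m * Q m" for m c
    unfolding walk_lim_odd that X PS using x
    by (simp add: field_simps power_mult power2_eq_square flip: power_mult_distrib)
  have even: "walk_lim True x q (2 * m) (2 * c) = x powi c / x ^ m * P (2 * m) \<and>
      walk_lim True x q (2 * m) (2 * c - 1) = x powi c * x ^ m * Q m" for c
  proof (induction m arbitrary: c)
    case 0
    then show ?case using alcove_wt_shift[OF x] by (simp add: init)
  next
    case (Suc m)
    note IH = odd[OF conjunct1[OF Suc] conjunct2[OF Suc]]
    have *: "2 * Suc m = Suc (Suc (2 * m))" by simp
    have P2: "P (Suc (Suc (2 * m))) = (x ^ Suc m)\<^sup>2 * Q m + P (Suc (2 * m))"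
      unfolding PS[of "Suc (2 * m)"] by (simp add: power2_eq_square power_add mult_2)
    have Q2: "x ^ Suc m * Q (Suc m) = q ^ Suc (Suc (2 * m)) / x ^ Suc m * P (Suc (2 * m)) + x ^ Suc m * Q m"
      unfolding QS using x by (simp add: field_simps power_mult power2_eq_square power_mult_distrib)
    show ?case
      unfolding * walk_lim_even conjunct1[OF IH] conjunct2[OF IH] P2
        mult.assoc[of "x powi c" "x ^ Suc m" "Q (Suc m)"] Q2
      using x by (simp add: field_simps power2_eq_square)
  qed
  show ?thesis using even odd even by blast
qed

text \<open>As for \<open>walk_lim_dagger\<close>, with the directions exchanged: leftward states
  carry Q and rightward states P.\<close>

lemma walk_lim_twisted:
  fixes x q :: complex
  assumes x: "x \<noteq> 0"
  defines "P \<equiv> PG (q / x) (x ^ 2)" and "Q \<equiv> QG (q / x) (x ^ 2)"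
  shows "walk_lim False x q (2 * m) (2 * c) = x powi c / x ^ m * Q m \<and>
    walk_lim False x q (2 * m) (2 * c - 1) = x powi c * x ^ m * P (2 * m) \<and>
    walk_lim False x q (Suc (2 * m)) (2 * c - 1) = x powi c / x ^ Suc m * Q m \<and>
    walk_lim False x q (Suc (2 * m)) (2 * c) = x powi c * x ^ Suc m * P (Suc (2 * m))"
proof -
  have X: "x powi (a + 1) = x powi a * x" "x powi (a - 1) = x powi a / x" for a
    using x by (simp_all add: power_int_add power_int_diff)
  have PS: "P (Suc k) = (q / x) ^ Suc k * Q (k div 2) + P k"
    and QS: "Q (Suc k) = (x ^ 2) ^ Suc k * P (Suc (2 * k)) + Q k"
    and init: "P 0 = 1" "Q 0 = 1" for k
    by (simp_all add: P_def Q_def)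
  have sq: "a ^ (2 * m) = (a ^ m)\<^sup>2" "a ^ (m * 2) = (a ^ m)\<^sup>2" for a :: complex and m
    by (simp_all add: power_mult [symmetric] mult.commute)
  have odd: "walk_lim False x q (Suc (2 * m)) (2 * c - 1) = x powi c / x ^ Suc m * Q m \<and>
      walk_lim False x q (Suc (2 * m)) (2 * c) = x powi c * x ^ Suc m * P (Suc (2 * m))"
    if "\<And>c. walk_lim False x q (2 * m) (2 * c) = x powi c / x ^ m * Q m"
      "\<And>c. walk_lim False x q (2 * m) (2 * c - 1) = x powi c * x ^ m * P (2 * m)" for m c
    unfolding walk_lim_odd that X PS using x
    by (simp add: sq field_simps power2_eq_square)
  have even: "walk_lim False x q (2 * m) (2 * c) = x powi c / x ^ m * Q m \<and>
      walk_lim False x q (2 * m) (2 * c - 1) = x powi c * x ^ m * P (2 * m)" for c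
  proof (induction m arbitrary: c)
    case 0
    then show ?case using alcove_wt_shift[OF x] by (simp add: init)
  next
    case (Suc m)
    note IH = odd[OF conjunct1[OF Suc] conjunct2[OF Suc]]
    have *: "2 * Suc m = Suc (Suc (2 * m))" by simp
    have P2: "x ^ Suc m * P (Suc (Suc (2 * m))) =
        q ^ Suc (Suc (2 * m)) / x ^ Suc m * Q m + x ^ Suc m * P (Suc (2 * m))"
      unfolding PS[of "Suc (2 * m)"] using x by (simp add: sq field_simps power2_eq_square)
    have Q2: "Q (Suc m) = (x ^ Suc m)\<^sup>2 * P (Suc (2 * m)) + Q m"
      unfolding QS by (simp add: power_mult[symmetric] mult.commute del: power_Suc)
    show ?case
      unfolding * walk_lim_even conjunct1[OF IH] conjunct2[OF IH] Q2
        mult.assoc[of "x powi c" "x ^ Suc m" "P (Suc (Suc (2 * m)))"] P2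
      using x by (simp add: field_simps power2_eq_square)
  qed
  show ?thesis using even odd even by blast
qed

section \<open>The sum over walks as a recursion\<close>

lemma walk_append: "j \<le> length b \<Longrightarrow> walk n (b @ c) j = walk n b j"
  by (induction j) (simp_all add: Let_def nth_append)

lemma even_walk_length: "even (walk_length n) \<longleftrightarrow> n \<le> 0"
proof (cases "n \<le> 0")
  case True
  then have "walk_length n = 2 * nat (- n)" by (simp add: walk_length_def)
  then show ?thesis using True by simp
next
  case False
  then have "walk_length n = Suc (2 * nat (n - 1))" by (simp add: walk_length_def)
  then show ?thesis using False by simp
qed

lemma step_label_parity:
  assumes "j < walk_length n"
  shows "wall_label a = step_label n (Suc j) \<longleftrightarrow> leftward (walk_length n - j) a"
    and "step_label n (Suc j) = 1 \<longleftrightarrow> even (walk_length n - j)"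
    and "step_label n (Suc j) = 0 \<longleftrightarrow> odd (walk_length n - j)"
  using assms
  by (auto simp: wall_label_def step_label_def leftward_def even_walk_length)

definition step_weight :: "bool \<Rightarrow> int \<Rightarrow> complex \<Rightarrow> complex \<Rightarrow> bool list \<Rightarrow> nat \<Rightarrow> complex" where
  "step_weight dag n q v b j =
     (if b ! j then 1 else (1 - v ^ 2) / v *
        fold_weight dag (walk_length n - j) (leftward (walk_length n - j) (walk n b j))
          (q ^ (walk_length n - j) * v ^ 2))"

lemma sum_lists_Suc:
  "(\<Sum>b\<in>{b :: bool list. length b = Suc j}. f b) =
     (\<Sum>b\<in>{b. length b = j}. f (b @ [True]) + f (b @ [False]))"
proof -
  let ?S = "{b :: bool list. length b = j}"
  have fin: "finite ?S" using finite_lists_length_eq[of "UNIV :: bool set" j] by simp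
  have "{b :: bool list. length b = Suc j} = (\<lambda>b. b @ [True]) ` ?S \<union> (\<lambda>b. b @ [False]) ` ?S"
    by (auto simp: length_Suc_conv_rev image_iff)
  moreover have "(\<lambda>b. b @ [True]) ` ?S \<inter> (\<lambda>b. b @ [False]) ` ?S = {}" by auto
  ultimately show ?thesis
    using fin by (simp add: sum.union_disjoint sum.reindex inj_on_def sum.distrib)
qed

text \<open>Interpolates between the recursion (j = 0) and the explicit sum over walks (j = l): the
  first j steps are listed, the rest is left to \<open>walk_sum\<close>.\<close>

lemma walk_sum_prefix:
  assumes "j \<le> walk_length n"
  shows "(\<Sum>b\<in>{b :: bool list. length b = j}. (\<Prod>i<j. step_weight dag n q v b i) *
      walk_sum dag x q v (walk_length n - j) (walk n b j)) = walk_sum dag x q v (walk_length n) 0"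
  using assms
proof (induction j)
  case 0
  then show ?case by simp
next
  case (Suc j)
  let ?l = "walk_length n"
  have k: "?l - j = Suc (?l - Suc j)" and j: "j < ?l" using Suc.prems by auto
  have "(\<Sum>b\<in>{b :: bool list. length b = Suc j}. (\<Prod>i<Suc j. step_weight dag n q v b i) *
      walk_sum dag x q v (?l - Suc j) (walk n b (Suc j))) =
    (\<Sum>b\<in>{b :: bool list. length b = j}. (\<Prod>i<j. step_weight dag n q v b i) *
      walk_sum dag x q v (?l - j) (walk n b j))"
    unfolding sum_lists_Suc
  proof (rule sum.cong[OF refl])
    fix b :: "bool list" assume "b \<in> {b. length b = j}"
    then have b: "length b = j" by simp
    have p: "(\<Prod>i<j. step_weight dag n q v (b @ c) i) = (\<Prod>i<j. step_weight dag n q v b i)" for c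
      using b by (intro prod.cong) (auto simp: step_weight_def walk_append nth_append)
    have w: "walk n (b @ [True]) (Suc j) = cross (?l - j) (walk n b j)"
      "walk n (b @ [False]) (Suc j) = walk n b j"
      using b step_label_parity(1)[OF j] by (simp_all add: walk_append Let_def cross_def nth_append)
    have sw: "step_weight dag n q v (b @ [True]) j = 1"
      "step_weight dag n q v (b @ [False]) j = (1 - v ^ 2) / v * fold_weight dag (Suc (?l - Suc j))
         (leftward (Suc (?l - Suc j)) (walk n b j)) (q ^ Suc (?l - Suc j) * v ^ 2)"
      using b by (simp_all add: step_weight_def nth_append walk_append k del: power_Suc)
    show "(\<Prod>i<Suc j. step_weight dag n q v (b @ [True]) i) *
        walk_sum dag x q v (?l - Suc j) (walk n (b @ [True]) (Suc j)) +
        (\<Prod>i<Suc j. step_weight dag n q v (b @ [False]) i) *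
        walk_sum dag x q v (?l - Suc j) (walk n (b @ [False]) (Suc j)) =
        (\<Prod>i<j. step_weight dag n q v b i) * walk_sum dag x q v (?l - j) (walk n b j)"
      unfolding w prod.lessThan_Suc p sw k walk_sum.simps(2)
      by (simp only: distrib_left mult_ac mult_1_right mult_1)
  qed
  with Suc show ?case by simp
qed

lemma prod_step_weight:
  fixes b :: "bool list" and n :: int
  defines "l \<equiv> walk_length n"
  shows "(\<Prod>i<l. step_weight dag n q v b i) =
    ((1 - v ^ 2) / v) ^ card (foldings n b) *
    (\<Prod>j\<in>foldings n b. fold_weight dag (l + 1 - j) (positive_step n b j) (xi n q v j))"
proof -
  let ?f = "\<lambda>j. (1 - v ^ 2) / v * fold_weight dag (l + 1 - j) (positive_step n b j) (xi n q v j)"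
  have "(\<Prod>i<l. step_weight dag n q v b i) = (\<Prod>j\<in>{1..l}. step_weight dag n q v b (j - 1))"
    by (rule prod.reindex_bij_witness[of _ "\<lambda>j. j - 1" Suc]) auto
  also have "\<dots> = (\<Prod>j\<in>{1..l}. if \<not> b ! (j - 1) then ?f j else 1)"
  proof (rule prod.cong[OF refl])
    fix j assume j: "j \<in> {1..l}"
    then have "leftward (l - (j - 1)) a = (wall_label a = step_label n j)" for a
      using step_label_parity(1)[of "j - 1" n a] by (auto simp: l_def)
    moreover have "l - (j - 1) = l + 1 - j" using j by simp
    ultimately show "step_weight dag n q v b (j - 1) = (if \<not> b ! (j - 1) then ?f j else 1)"
      by (simp add: step_weight_def xi_def positive_step_def flip: l_def)
  qed
  also have "\<dots> = (\<Prod>j\<in>foldings n b. ?f j)"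
    unfolding foldings_def l_def[symmetric] by (rule prod.inter_filter[symmetric]) simp
  finally show ?thesis by (simp only: prod.distrib prod_constant)
qed

lemma prod_foldings:
  fixes b :: "bool list" and g :: "nat \<Rightarrow> complex"
  shows "(\<Prod>j\<in>foldings n b. g j) =
    (\<Prod>j\<in>J0pos n b. g j) * (\<Prod>j\<in>J0neg n b. g j) * (\<Prod>j\<in>J1pos n b. g j) * (\<Prod>j\<in>J1neg n b. g j)"
proof -
  have fin: "finite (foldings n b)" by (simp add: foldings_def)
  have "foldings n b = J0pos n b \<union> J0neg n b \<union> J1pos n b \<union> J1neg n b"
    by (auto simp: J0pos_def J0neg_def J1pos_def J1neg_def step_label_def)
  moreover have "finite (J0pos n b)" "finite (J0neg n b)" "finite (J1pos n b)" "finite (J1neg n b)"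
    using fin by (simp_all add: J0pos_def J0neg_def J1pos_def J1neg_def)
  moreover have "J0pos n b \<inter> J0neg n b = {}" "(J0pos n b \<union> J0neg n b) \<inter> J1pos n b = {}"
    "(J0pos n b \<union> J0neg n b \<union> J1pos n b) \<inter> J1neg n b = {}"
    by (auto simp: J0pos_def J0neg_def J1pos_def J1neg_def)
  ultimately show ?thesis by (simp add: prod.union_disjoint)
qed

lemma folding_label_parity:
  assumes "j \<in> foldings n b"
  shows "step_label n j = 1 \<longleftrightarrow> even (walk_length n + 1 - j)"
    and "step_label n j = 0 \<longleftrightarrow> odd (walk_length n + 1 - j)"
proof -
  have "1 \<le> j" "j \<le> walk_length n" using assms by (auto simp: foldings_def)
  then have "j - 1 < walk_length n" "Suc (j - 1) = j" "walk_length n - (j - 1) = walk_length n + 1 - j"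
    by simp_all
  then show "step_label n j = 1 \<longleftrightarrow> even (walk_length n + 1 - j)"
    and "step_label n j = 0 \<longleftrightarrow> odd (walk_length n + 1 - j)"
    using step_label_parity(2,3)[of "j - 1" n] by simp_all
qed

lemma macdonald_eq_walk_sum:
  assumes "t \<noteq> 0"
  shows "macdonald_A22 n x q t =
      csqrt t powi macdonald_eps n * walk_sum False x q (csqrt t) (walk_length n) 0"
    and "macdonald_A22_dagger n x q t =
      csqrt t powi macdonald_eps n * walk_sum True x q (csqrt t) (walk_length n) 0"
proof -
  let ?v = "csqrt t" and ?l = "walk_length n"
  have v: "?v \<noteq> 0" using assms by simp
  have ws: "walk_sum dag x q ?v ?l 0 = (\<Sum>b\<in>{b :: bool list. length b = ?l}.
      ((1 - ?v ^ 2) / ?v) ^ card (foldings n b) *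
      (\<Prod>j\<in>foldings n b. fold_weight dag (?l + 1 - j) (positive_step n b j) (xi n q ?v j)) *
      (?v powi alcove_d (walk n b ?l) * x powi alcove_wt (walk n b ?l)))" for dag
    unfolding walk_sum_prefix[OF order.refl, where n = n and dag = dag and q = q and v = ?v and x = x, symmetric] prod_step_weight by simp
  have pw: "?v powi (macdonald_eps n + d - int k) * (1 - ?v ^ 2) ^ k =
      ?v powi macdonald_eps n * (?v powi d * ((1 - ?v ^ 2) / ?v) ^ k)" for d k
    using v by (simp add: power_int_add power_int_diff power_divide)
  have fw1: "(\<Prod>j\<in>J1pos n b. fold_weight dag (?l + 1 - j) (positive_step n b j) (xi n q ?v j)) =
        (\<Prod>j\<in>J1pos n b. 1 / (1 - xi n q ?v j))"
      "(\<Prod>j\<in>J1neg n b. fold_weight dag (?l + 1 - j) (positive_step n b j) (xi n q ?v j)) =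
        (\<Prod>j\<in>J1neg n b. xi n q ?v j / (1 - xi n q ?v j))" for b dag
    by (rule prod.cong[OF refl], use folding_label_parity in \<open>auto simp: J1pos_def J1neg_def fold_weight_def\<close>)+
  have fw0: "(\<Prod>j\<in>J0pos n b. fold_weight True (?l + 1 - j) (positive_step n b j) (xi n q ?v j)) =
        (\<Prod>j\<in>J0pos n b. 1 / (1 - xi n q ?v j ^ 2))"
      "(\<Prod>j\<in>J0neg n b. fold_weight True (?l + 1 - j) (positive_step n b j) (xi n q ?v j)) =
        (\<Prod>j\<in>J0neg n b. xi n q ?v j ^ 2 / (1 - xi n q ?v j ^ 2))"
      "(\<Prod>j\<in>J0pos n b. fold_weight False (?l + 1 - j) (positive_step n b j) (xi n q ?v j)) =
        (\<Prod>j\<in>J0pos n b. xi n q ?v j / (1 - xi n q ?v j ^ 2))"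
      "(\<Prod>j\<in>J0neg n b. fold_weight False (?l + 1 - j) (positive_step n b j) (xi n q ?v j)) =
        (\<Prod>j\<in>J0neg n b. xi n q ?v j / (1 - xi n q ?v j ^ 2))" for b
    by (rule prod.cong[OF refl], use folding_label_parity in \<open>auto simp: J0pos_def J0neg_def fold_weight_def\<close>)+
  have un: "(\<Prod>j\<in>J0pos n b \<union> J0neg n b. g j) = (\<Prod>j\<in>J0pos n b. g j) * (\<Prod>j\<in>J0neg n b. g j)"
    for b and g :: "nat \<Rightarrow> complex"
    by (rule prod.union_disjoint) (auto simp: J0pos_def J0neg_def foldings_def)
  show "macdonald_A22 n x q t = ?v powi macdonald_eps n * walk_sum False x q ?v ?l 0"
    unfolding macdonald_A22_def Let_def ws sum_distrib_left pw un prod_foldings fw1 fw0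
    by (intro sum.cong refl) (simp only: mult_ac)
  show "macdonald_A22_dagger n x q t = ?v powi macdonald_eps n * walk_sum True x q ?v ?l 0"
    unfolding macdonald_A22_dagger_def Let_def ws sum_distrib_left pw prod_foldings fw1 fw0
    by (intro sum.cong refl) (simp only: mult_ac)
qed

lemma eps_normalization:
  "v powi macdonald_eps n * walk_sum dag x q v (walk_length n) 0 =
     normalized_walk_sum dag x q v (walk_length n) 0"
  by (simp add: macdonald_eps_def normalized_walk_sum_def leftward_def even_walk_length power_int_minus)

text \<open>Only t \<noteq> 0 enters: at t = 0 the formulas contain negative powers of v =
  0.\<close>

lemma macdonald_tendsto:
  "((\<lambda>t. macdonald_A22_dagger n x q t) \<longlongrightarrow> walk_lim True x q (walk_length n) 0) (at 0)"
  "((\<lambda>t. macdonald_A22 n x q t) \<longlongrightarrow> walk_lim False x q (walk_length n) 0) (at 0)"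
  by (rule Lim_transform_eventually[OF normalized_walk_sum_tendsto],
      rule eventually_mono[OF eventually_neq_at_within[of 0 0 UNIV]],
      simp add: macdonald_eq_walk_sum eps_normalization)+

lemma walk_lim_nonpos:
  assumes "x \<noteq> 0"
  shows "walk_lim True x q (walk_length (- int k)) 0 = PG x (q ^ 2 / x ^ 2) (2 * k) / x ^ k"
    and "walk_lim False x q (walk_length (- int k)) 0 = QG (q / x) (x ^ 2) k / x ^ k"
  using walk_lim_dagger[OF assms, of q k 0] walk_lim_twisted[OF assms, of q k 0]
  by (simp_all add: walk_length_def nat_mult_distrib)

lemma walk_lim_pos:
  assumes "x \<noteq> 0"
  shows "walk_lim True x q (walk_length (int (Suc k))) 0 = x ^ Suc k * QG x (q ^ 2 / x ^ 2) k"
    and "walk_lim False x q (walk_length (int (Suc k))) 0 = x ^ Suc k * PG (q / x) (x ^ 2) (Suc (2 * k))"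
proof -
  have "walk_length (int (Suc k)) = Suc (2 * k)" by (simp add: walk_length_def nat_add_distrib)
  then show "walk_lim True x q (walk_length (int (Suc k))) 0 = x ^ Suc k * QG x (q ^ 2 / x ^ 2) k"
    and "walk_lim False x q (walk_length (int (Suc k))) 0 = x ^ Suc k * PG (q / x) (x ^ 2) (Suc (2 * k))"
    using walk_lim_dagger[OF assms, of q k 0] walk_lim_twisted[OF assms, of q k 0]
    by (simp_all del: walk_lim.simps PG.simps QG.simps)
qed

theorem theorem3p1:
  fixes n :: int
  shows "finite_weight_module (weyl n) \<and> finite_weight_module (twisted_weyl n) \<and>
    (\<forall>x q :: complex. x \<noteq> 0 \<longrightarrow>
      ((\<lambda>t. macdonald_A22_dagger n x q t) \<longlongrightarrow> graded_char (weyl n) x (q ^ 2)) (at 0) \<and>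
      ((\<lambda>t. macdonald_A22 n x q t) \<longlongrightarrow> graded_char (twisted_weyl n) x q) (at 0))"
proof -
  have "n \<le> 0 \<or> n > 0" by linarith
  then obtain k m where n: "n = - int k \<or> n = int (Suc m)"
    by (metis add.inverse_inverse neg_0_le_iff_le nonneg_int_cases pos_int_cases gr0_conv_Suc)
  then have "finite_weight_module (weyl n)" "finite_weight_module (twisted_weyl n)"
    using weyl_nonpos(1) weyl_pos(1) twisted_weyl_nonpos(1) twisted_weyl_pos(1) by auto
  moreover have "graded_char (weyl n) x (q ^ 2) = walk_lim True x q (walk_length n) 0"
    "graded_char (twisted_weyl n) x q = walk_lim False x q (walk_length n) 0" if "x \<noteq> 0" for x q
    using n weyl_nonpos(2) weyl_pos(2) twisted_weyl_nonpos(2) twisted_weyl_pos(2)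
      walk_lim_nonpos walk_lim_pos that by (elim disjE; simp only:)+
  ultimately show ?thesis using macdonald_tendsto by simp
qed

end
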